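(* For $n>1$ there is no orthogonal complex structure on the sphere $S^{2n}$; that is, there is no integrable almost complex structure $J$ on $S^{2n}$ that is orthogonal with respect to the standard round metric.
   Context: An almost complex structure on $S^{2n}$ is a smooth endomorphism $J$ of $TS^{2n}$ with $J^2=-1$; it is orthogonal if $J$ is an isometry of each tangent space for the standard round metric on $S^{2n}$; it is integrable if it comes from a complex manifold structure on $S^{2n}$. *)

theory Defs
  imports "HOL-Analysis.Analysis"
begin

section \<open>Smooth maps\<close>

text \<open>\<open>C_on k U f\<close> is meant for open sets \<open>U\<close>: all iterated directional derivatives of
  \<open>f\<close> of order at most \<open>k\<close> exist as Frechet derivatives and are continuous on \<open>U\<close>.\<close>

primrec C_on :: "nat \<Rightarrow> 'a::euclidean_space set \<Rightarrow> ('a \<Rightarrow> 'b::euclidean_space) \<Rightarrow> bool" where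
  "C_on 0 U f \<longleftrightarrow> continuous_on U f"
| "C_on (Suc k) U f \<longleftrightarrow>
     (\<forall>x\<in>U. f differentiable (at x)) \<and>
     (\<forall>v. C_on k U (\<lambda>x. frechet_derivative f (at x) v))"

text \<open>Smoothness on an arbitrary subset of a Euclidean space: locally the restriction of a
  \<open>C\<close>-infinity map on an open set. On embedded submanifolds this is the intrinsic notion, and on
  open sets it is the usual one.\<close>

definition smooth_on :: "'a::euclidean_space set \<Rightarrow> ('a \<Rightarrow> 'b::euclidean_space) \<Rightarrow> bool" where
  "smooth_on S f \<longleftrightarrow>
     (\<forall>x\<in>S. \<exists>U F. open U \<and> x \<in> U \<and> (\<forall>k. C_on k U F) \<and> (\<forall>y\<in>S \<inter> U. F y = f y))"

section \<open>Almost complex structures on the unit sphere\<close>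

abbreviation unit_sphere :: "'a::euclidean_space set" where
  "unit_sphere \<equiv> sphere 0 1"

definition tangent_space :: "'a::euclidean_space \<Rightarrow> 'a set" where
  "tangent_space p = {v. p \<bullet> v = 0}"

definition tangent_bundle :: "('a::euclidean_space \<times> 'a) set" where
  "tangent_bundle = Sigma unit_sphere tangent_space"

text \<open>\<open>J p v\<close> is the value at \<open>p\<close> of the endomorphism field on the tangent vector \<open>v\<close>; the values
  for \<open>(p, v)\<close> outside the tangent bundle are irrelevant.\<close>

definition almost_complex_structure :: "('a::euclidean_space \<Rightarrow> 'a \<Rightarrow> 'a) \<Rightarrow> bool" where
  "almost_complex_structure J \<longleftrightarrow>
     smooth_on tangent_bundle (\<lambda>(p, v). J p v) \<and>
     (\<forall>p\<in>unit_sphere.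
        (\<forall>v\<in>tangent_space p. J p v \<in> tangent_space p) \<and>
        (\<forall>v\<in>tangent_space p. \<forall>w\<in>tangent_space p. J p (v + w) = J p v + J p w) \<and>
        (\<forall>c. \<forall>v\<in>tangent_space p. J p (c *\<^sub>R v) = c *\<^sub>R J p v) \<and>
        (\<forall>v\<in>tangent_space p. J p (J p v) = - v))"

text \<open>The round metric is the restriction of the ambient inner product to the tangent spaces.\<close>

definition orthogonal_acs :: "('a::euclidean_space \<Rightarrow> 'a \<Rightarrow> 'a) \<Rightarrow> bool" where
  "orthogonal_acs J \<longleftrightarrow>
     (\<forall>p\<in>unit_sphere. \<forall>v\<in>tangent_space p. \<forall>w\<in>tangent_space p. J p v \<bullet> J p w = v \<bullet> w)"

section \<open>Complex manifold structures on the unit sphere\<close>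

text \<open>Holomorphic maps of several variables, for open \<open>S\<close>: the real derivative exists and is
  complex linear at every point.\<close>

definition holomorphic_map_on ::
  "(complex ^ 'n::finite \<Rightarrow> complex ^ 'm::finite) \<Rightarrow> (complex ^ 'n) set \<Rightarrow> bool" where
  "holomorphic_map_on f S \<longleftrightarrow>
     (\<forall>z\<in>S. \<exists>D. (f has_derivative D) (at z) \<and> (\<forall>c v. D (c *s v) = c *s D v))"

text \<open>A chart is a diffeomorphism from an open subset of the sphere (with its standard smooth
  structure) onto an open subset of complex \<open>n\<close>-space.\<close>

definition complex_chart ::
  "'a::euclidean_space set \<Rightarrow> ('a \<Rightarrow> complex ^ 'n::finite) \<Rightarrow> bool" where
  "complex_chart U \<phi> \<longleftrightarrow>
     openin (top_of_set unit_sphere) U \<and> inj_on \<phi> U \<and> open (\<phi> ` U) \<and>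
     smooth_on U \<phi> \<and> smooth_on (\<phi> ` U) (inv_into U \<phi>)"

definition complex_atlas ::
  "('a::euclidean_space set \<times> ('a \<Rightarrow> complex ^ 'n::finite)) set \<Rightarrow> bool" where
  "complex_atlas A \<longleftrightarrow>
     (\<forall>(U, \<phi>)\<in>A. complex_chart U \<phi>) \<and>
     (\<Union>(U, \<phi>)\<in>A. U) = unit_sphere \<and>
     (\<forall>(U, \<phi>)\<in>A. \<forall>(V, \<psi>)\<in>A. holomorphic_map_on (\<psi> \<circ> inv_into U \<phi>) (\<phi> ` (U \<inter> V)))"

text \<open>The almost complex structure of a complex manifold is multiplication by the imaginary unit,
  transported to the tangent spaces by the charts. With \<open>\<psi>\<close> the inverse of a chart \<open>\<phi>\<close> this says
  \<open>d\<psi> (\<i> w) = J (d\<psi> w)\<close>, which is equivalent to \<open>d\<phi> (J v) = \<i> d\<phi> v\<close> but only involves derivatives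
  of a map on an open set.\<close>

definition induces_acs ::
  "('a::euclidean_space set \<times> ('a \<Rightarrow> complex ^ 'n::finite)) set \<Rightarrow> ('a \<Rightarrow> 'a \<Rightarrow> 'a) \<Rightarrow> bool" where
  "induces_acs A J \<longleftrightarrow>
     (\<forall>(U, \<phi>)\<in>A. \<forall>p\<in>U. \<forall>w.
        frechet_derivative (inv_into U \<phi>) (at (\<phi> p)) (\<i> *s w) =
        J p (frechet_derivative (inv_into U \<phi>) (at (\<phi> p)) w))"

text \<open>The type argument records the complex dimension \<open>CARD('n)\<close> of the charts.\<close>

definition integrable_acs :: "'n::finite itself \<Rightarrow> ('a::euclidean_space \<Rightarrow> 'a \<Rightarrow> 'a) \<Rightarrow> bool" where
  "integrable_acs (_ :: 'n itself) J \<longleftrightarrow>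
     (\<exists>A :: ('a set \<times> ('a \<Rightarrow> complex ^ 'n)) set. complex_atlas A \<and> induces_acs A J)"

end

theory Submission
  imports Defs
begin

text \<open>Let \<open>P(p)\<close> be the orthogonal projection of \<open>\<complex>\<^sup>m\<close> onto the \<open>(1,0)\<close>-vectors of \<open>J\<close> at \<open>p\<close>. Integrability and
  orthogonality make \<open>p \<mapsto> P(p)\<close> an antiholomorphic immersion into a Grassmannian, so the pulled back
  Kaehler form \<open>\<Omega> = Im tr (P [dP, dP])\<close> is closed and nondegenerate. In stereographic coordinates on
  \<open>\<real>\<^sup>2\<^sup>n\<close>, with conformal factor \<open>\<lambda> = 2 / (1 + \<bar>x\<bar>\<^sup>2)\<close>, it is comparable to \<open>\<lambda>\<^sup>2\<close>. The radial primitive \<open>\<alpha>\<close> of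
  \<open>\<Omega>\<close> then has size \<open>\<bar>x\<bar> \<lambda>\<close>, and the field \<open>X\<close> dual to \<open>\<alpha>\<close> expands the Liouville volume \<open>\<rho> = sqrt \<bar>det \<Omega>\<bar>\<close>:
  \<open>div (\<rho> X) = n \<rho>\<close>. As \<open>\<bar>\<rho> X\<bar> = O(\<bar>x\<bar>\<^sup>3\<^sup>-\<^sup>4\<^sup>n)\<close>, the flux of \<open>\<rho> X\<close> through large spheres tends to zero when
  \<open>n > 1\<close>, so the total volume vanishes, which is absurd.\<close>

section \<open>Calculus of smooth maps\<close>

text \<open>Geometrically, a closed nondegenerate two-form on S^(2n) contradicts H^2 = 0. In
  stereographic coordinates one point is missing and every closed form is exact, so this topological
  fact has to return as an estimate at infinity. The two-sided comparison of the form with conf^2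
  comes from compactness of the full sphere, pole included. The radial primitive is not bounded near
  the pole in the round metric, but the flux through the sphere of radius R is of order R^(2n-1)
  R^(3-4n) = R^(2-2n). For n = 1 it stays of order one, as it must for the area form of S^2. The
  projection P replaces J because its values lie in a fixed matrix space over C^m, m = 2n + 1, so
  that it can be differentiated without a connection. Orthogonality of J makes the (1,0)-vectors
  isotropic for the complex bilinear product; together with the symmetry of second derivatives of a
  chart this yields antiholomorphy. The map is an immersion because the sphere is curved:
  derivatives of tangent fields have a normal component.\<close>

lemma C_on_cong:
  assumes "open U" "\<And>x. x \<in> U \<Longrightarrow> f x = g x"
  shows "C_on k U f \<longleftrightarrow> C_on k U g"
  using assms(2)
proof (induction k arbitrary: f g)
  case 0
  then show ?case using continuous_on_cong by (metis C_on.simps(1))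
next
  case (Suc k)
  have d: "f differentiable at x \<longleftrightarrow> g differentiable at x"
    and fd: "frechet_derivative f (at x) = frechet_derivative g (at x)" if "x \<in> U" for x
  proof -
    have *: "(f has_derivative D) (at x) \<longleftrightarrow> (g has_derivative D) (at x)" for D
      using has_derivative_transform_within_open[OF _ assms(1) that] Suc.prems by metis
    show "f differentiable at x \<longleftrightarrow> g differentiable at x"
      unfolding differentiable_def using * by blast
    show "frechet_derivative f (at x) = frechet_derivative g (at x)"
      unfolding frechet_derivative_def using * by simp
  qed
  have "C_on k U (\<lambda>x. frechet_derivative f (at x) v) \<longleftrightarrow> C_on k U (\<lambda>x. frechet_derivative g (at x) v)" for v
    by (rule Suc.IH) (simp add: fd)
  then show ?case using d by simp
qed

text \<open>\<open>C_on\<close> is phrased with the choice operator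
  \<open>frechet_derivative\<close>. Since derivatives are unique, any family found by the
  differentiation rules may take its place.\<close>

lemma C_on_SucI:
  assumes "open U" "\<And>x. x \<in> U \<Longrightarrow> (f has_derivative f' x) (at x)"
    and "\<And>v. C_on k U (\<lambda>x. f' x v)"
  shows "C_on (Suc k) U f"
proof -
  have "C_on k U (\<lambda>x. frechet_derivative f (at x) v)" for v
    using C_on_cong[OF assms(1), of "\<lambda>x. frechet_derivative f (at x) v" "\<lambda>x. f' x v" k] assms(2,3)
      frechet_derivative_at by metis
  then show ?thesis using assms(2) by (auto simp: differentiable_def)
qed

lemma C_on_SucD:
  assumes "C_on (Suc k) U f"
  shows "\<And>x. x \<in> U \<Longrightarrow> (f has_derivative frechet_derivative f (at x)) (at x)"
    and "\<And>v. C_on k U (\<lambda>x. frechet_derivative f (at x) v)"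
  using assms by (auto simp: frechet_derivative_works[symmetric])

lemma C_on_imp_continuous_on: "C_on k U f \<Longrightarrow> continuous_on U f"
proof (cases k)
  case (Suc j)
  assume "C_on k U f"
  then show ?thesis unfolding Suc
    by (simp add: continuous_at_imp_continuous_on differentiable_imp_continuous_within)
qed simp

lemma C_on_SucE: "C_on (Suc k) U f \<Longrightarrow> C_on k U f"
proof (induction k arbitrary: f)
  case 0
  then show ?case using C_on_imp_continuous_on by (metis C_on.simps(1))
next
  case (Suc k)
  have "C_on k U (\<lambda>x. frechet_derivative f (at x) v)" for v
    using Suc.IH Suc.prems by simp
  then show ?case using Suc.prems by simp
qed

lemma C_on_subset: "C_on k U f \<Longrightarrow> V \<subseteq> U \<Longrightarrow> C_on k V f"
  by (induction k arbitrary: f) (auto intro: continuous_on_subset)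

lemma C_on_const [simp]: "C_on k U (\<lambda>x. c)"
  by (induction k arbitrary: c) simp_all

lemma C_on_add:
  assumes "open U"
  shows "C_on k U f \<Longrightarrow> C_on k U g \<Longrightarrow> C_on k U (\<lambda>x. f x + g x)"
proof (induction k arbitrary: f g)
  case 0
  then show ?case by (simp add: continuous_on_add)
next
  case (Suc k)
  note f = C_on_SucD[OF Suc.prems(1)] and g = C_on_SucD[OF Suc.prems(2)]
  show ?case
    by (rule C_on_SucI[OF assms has_derivative_add[OF f(1) g(1)] Suc.IH[OF f(2) g(2)]])
qed

lemma C_on_sum:
  assumes "open U" "\<And>i. i \<in> I \<Longrightarrow> C_on k U (f i)"
  shows "C_on k U (\<lambda>x. \<Sum>i\<in>I. f i x)"
  using assms(2)
  by (induction I rule: infinite_finite_induct) (simp_all add: C_on_add[OF assms(1)])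

text \<open>The product rule returns sums of products of the same kind, so the induction closes.
  Scalar multiples, inner products and matrix products are all instances.\<close>

lemma C_on_bilinear:
  assumes "open U" and "bounded_bilinear h"
  shows "C_on k U f \<Longrightarrow> C_on k U g \<Longrightarrow> C_on k U (\<lambda>x. h (f x) (g x))"
proof (induction k arbitrary: f g)
  case 0
  then show ?case
    by (simp add: bounded_bilinear.continuous_on[OF assms(2)])
next
  case (Suc k)
  note f = C_on_SucD[OF Suc.prems(1)] and g = C_on_SucD[OF Suc.prems(2)]
  show ?case
    by (rule C_on_SucI[OF assms(1) bounded_bilinear.FDERIV[OF assms(2) f(1) g(1)]])
      (auto intro!: C_on_add[OF assms(1)] Suc.IH f(2) g(2) Suc.prems[THEN C_on_SucE])
qed

lemma C_on_linear:
  assumes "open U" "bounded_linear L"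
  shows "C_on k U f \<Longrightarrow> C_on k U (\<lambda>x. L (f x))"
proof (induction k arbitrary: f)
  case 0
  then show ?case
    by (simp add: bounded_linear.continuous_on[OF assms(2)])
next
  case (Suc k)
  note f = C_on_SucD[OF Suc.prems(1)]
  show ?case
    by (rule C_on_SucI[OF assms(1) bounded_linear.has_derivative[OF assms(2) f(1)] Suc.IH[OF f(2)]])
qed

lemma C_on_ident: "open U \<Longrightarrow> C_on k U (\<lambda>x. x)"
proof (cases k)
  case (Suc j)
  assume "open U"
  then show ?thesis unfolding Suc by (rule C_on_SucI[OF _ has_derivative_ident]) simp
qed simp

lemmas C_on_scaleR = C_on_bilinear[OF _ bounded_bilinear_scaleR]
lemmas C_on_mult = C_on_bilinear[OF _ bounded_bilinear_mult]
lemmas C_on_inner = C_on_bilinear[OF _ bounded_bilinear_inner]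

lemma C_on_diff:
  assumes "open U" "C_on k U f" "C_on k U g"
  shows "C_on k U (\<lambda>x. f x - g x)"
  using C_on_add[OF assms(1,2) C_on_linear[OF assms(1) bounded_linear_minus[OF bounded_linear_ident] assms(3)]] by simp

lemma C_on_prod:
  fixes f :: "'i \<Rightarrow> 'a::euclidean_space \<Rightarrow> real"
  assumes "open U" "\<And>i. i \<in> I \<Longrightarrow> C_on k U (f i)"
  shows "C_on k U (\<lambda>x. \<Prod>i\<in>I. f i x)"
  using assms(2)
  by (induction I rule: infinite_finite_induct) (simp_all add: C_on_mult[OF assms(1)])

lemma linear_basis_sum:
  assumes "linear F"
  shows "F w = (\<Sum>b\<in>Basis. (w \<bullet> b) *\<^sub>R F b)"
proof -
  have "F (\<Sum>b\<in>Basis. (w \<bullet> b) *\<^sub>R b) = (\<Sum>b\<in>Basis. (w \<bullet> b) *\<^sub>R F b)"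
    using assms by (simp add: linear_sum linear_cmul)
  then show ?thesis by (simp only: euclidean_representation)
qed

lemma linear_axis_sum:
  fixes F :: "real^'n \<Rightarrow> 'b::real_vector"
  assumes "linear F"
  shows "F x = (\<Sum>i\<in>UNIV. x $ i *\<^sub>R F (axis i 1))"
proof -
  have "F (\<Sum>i\<in>UNIV. x $ i *\<^sub>R axis i 1) = (\<Sum>i\<in>UNIV. x $ i *\<^sub>R F (axis i 1))"
    using assms by (simp add: linear_sum linear_cmul)
  then show ?thesis using basis_expansion[of x] by (simp add: scalar_mult_eq_scaleR)
qed

text \<open>In the chain rule the direction in which \<open>F\<close> is differentiated depends on
  \<open>x\<close>. Expanding it in the basis leaves derivatives of \<open>F\<close> in fixed
  directions, to which the induction hypothesis applies.\<close>

lemma C_on_compose: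
  assumes "open U" "open V"
  shows "C_on k V F \<Longrightarrow> C_on k U g \<Longrightarrow> g ` U \<subseteq> V \<Longrightarrow> C_on k U (\<lambda>x. F (g x))"
proof (induction k arbitrary: F)
  case 0
  then show ?case using continuous_on_compose2[of V F U g] by simp
next
  case (Suc k)
  note F = C_on_SucD[OF Suc.prems(1)] and g = C_on_SucD[OF Suc.prems(2)]
  let ?F' = "\<lambda>y. frechet_derivative F (at y)"
  let ?g' = "\<lambda>y. frechet_derivative g (at y)"
  have Fd: "(F has_derivative ?F' (g x)) (at (g x))" if "x \<in> U" for x
    by (rule F(1)) (use Suc.prems(3) that in blast)
  have d: "((\<lambda>x. F (g x)) has_derivative (\<lambda>v. \<Sum>b\<in>Basis. (?g' x v \<bullet> b) *\<^sub>R ?F' (g x) b)) (at x)"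
    if "x \<in> U" for x
    using has_derivative_compose[OF g(1)[OF that] Fd[OF that]]
    by (subst (asm) linear_basis_sum[OF has_derivative_linear[OF Fd[OF that]]])
  show ?case
  proof (rule C_on_SucI[OF assms(1) d])
    fix v
    have 1: "C_on k U (\<lambda>x. ?F' (g x) b)" for b
      by (rule Suc.IH[OF F(2)[of b] C_on_SucE[OF Suc.prems(2)] Suc.prems(3)])
    show "C_on k U (\<lambda>x. \<Sum>b\<in>Basis. (?g' x v \<bullet> b) *\<^sub>R ?F' (g x) b)"
      by (intro C_on_sum C_on_scaleR[OF _ C_on_inner[OF _ g(2) C_on_const] 1] assms(1))
  qed
qed

lemma C_on_inverse:
  fixes f :: "'a::euclidean_space \<Rightarrow> real"
  assumes "open U"
  shows "C_on k U f \<Longrightarrow> (\<And>x. x \<in> U \<Longrightarrow> f x \<noteq> 0) \<Longrightarrow> C_on k U (\<lambda>x. inverse (f x))"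
proof (induction k)
  case 0
  then show ?case by (auto intro!: continuous_on_inverse)
next
  case (Suc k)
  note f = C_on_SucD[OF Suc.prems(1)]
  have i: "C_on k U (\<lambda>x. inverse (f x))" using Suc.IH Suc.prems C_on_SucE by blast
  show ?case
  proof (rule C_on_SucI[OF assms(1)])
    show "((\<lambda>x. inverse (f x)) has_derivative
            (\<lambda>v. (-1) * (inverse (f x) * frechet_derivative f (at x) v * inverse (f x)))) (at x)" if "x \<in> U" for x
      using Deriv.has_derivative_inverse[OF Suc.prems(2)[OF that] f(1)[OF that]] by simp
    show "C_on k U (\<lambda>x. (-1) * (inverse (f x) * frechet_derivative f (at x) v * inverse (f x)))" for v
      by (intro C_on_mult[OF assms] C_on_const i f(2))
  qed
qed

lemma C_on_divide:
  fixes f :: "'a::euclidean_space \<Rightarrow> real"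
  assumes "open U" "C_on k U f" "C_on k U g" "\<And>x. x \<in> U \<Longrightarrow> g x \<noteq> 0"
  shows "C_on k U (\<lambda>x. f x / g x)"
  unfolding divide_inverse by (intro C_on_mult C_on_inverse assms)

lemma C_on_componentwise:
  assumes "open U" "\<And>b. b \<in> Basis \<Longrightarrow> C_on k U (\<lambda>x. f x \<bullet> b)"
  shows "C_on k U f"
proof -
  have "C_on k U (\<lambda>x. \<Sum>b\<in>Basis. (f x \<bullet> b) *\<^sub>R b)"
    by (intro C_on_sum C_on_scaleR assms C_on_const)
  then show ?thesis by (simp add: euclidean_representation)
qed

lemma C_on_vec_lambda:
  fixes f :: "'i::finite \<Rightarrow> 'a::euclidean_space \<Rightarrow> 'b::euclidean_space"
  assumes "open U" "\<And>i. C_on k U (f i)"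
  shows "C_on k U (\<lambda>x. \<chi> i. f i x)"
proof (rule C_on_componentwise[OF assms(1)])
  fix b :: "'b ^ 'i" assume "b \<in> Basis"
  then obtain i c where "b = axis i c" by (auto simp: Basis_vec_def)
  then have "(\<lambda>x. (\<chi> i. f i x) \<bullet> b) = (\<lambda>x. f i x \<bullet> c)" by (simp add: inner_axis)
  then show "C_on k U (\<lambda>x. (\<chi> i. f i x) \<bullet> b)"
    using C_on_inner[OF assms(1) assms(2) C_on_const] by simp
qed

lemma C_on_vec_nth:
  assumes "open U" "C_on k U f"
  shows "C_on k U (\<lambda>x. f x $ i)"
  by (rule C_on_linear[OF assms(1) bounded_linear_vec_nth assms(2)])

lemma C_on_Pair:
  assumes "open U" "C_on k U f" "C_on k U g"
  shows "C_on k U (\<lambda>x. (f x, g x))"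
proof (rule C_on_componentwise[OF assms(1)])
  fix b :: "'b \<times> 'c" assume "b \<in> Basis"
  have "(\<lambda>x. (f x, g x) \<bullet> b) = (\<lambda>x. f x \<bullet> fst b + g x \<bullet> snd b)"
    by (cases b) simp
  then show "C_on k U (\<lambda>x. (f x, g x) \<bullet> b)"
    using C_on_add[OF assms(1) C_on_inner[OF assms(1) assms(2) C_on_const] C_on_inner[OF assms(1) assms(3) C_on_const]]
    by simp
qed

lemma C_on_local:
  assumes "\<And>x. x \<in> S \<Longrightarrow> \<exists>U. open U \<and> x \<in> U \<and> C_on k U g"
  shows "C_on k S g"
  using assms
proof (induction k arbitrary: g)
  case 0
  have "continuous (at x) g" if x: "x \<in> S" for x
  proof -
    obtain U where "open U" "x \<in> U" "C_on 0 U g" using 0[OF x] by blast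
    then show ?thesis using continuous_on_eq_continuous_at[of U g] by simp
  qed
  then show ?case by (simp add: continuous_at_imp_continuous_on)
next
  case (Suc k)
  have "g differentiable at x" if x: "x \<in> S" for x
  proof -
    obtain U where "x \<in> U" "C_on (Suc k) U g" using Suc.prems[OF x] by blast
    then show ?thesis by simp
  qed
  moreover have "C_on k S (\<lambda>x. frechet_derivative g (at x) v)" for v
  proof (rule Suc.IH)
    fix x assume x: "x \<in> S"
    obtain U where U: "open U" "x \<in> U" "C_on (Suc k) U g" using Suc.prems[OF x] by blast
    then show "\<exists>U. open U \<and> x \<in> U \<and> C_on k U (\<lambda>x. frechet_derivative g (at x) v)"
      using C_on_SucD(2)[OF U(3)] by blast
  qed
  ultimately show ?case by simp
qed

lemma smooth_on_openD:
  assumes "smooth_on S f" "open S"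
  shows "C_on k S f"
proof (rule C_on_local)
  fix x assume "x \<in> S"
  then obtain U F where U: "open U" "x \<in> U" "\<forall>k. C_on k U F" "\<forall>y\<in>S \<inter> U. F y = f y"
    using assms(1) unfolding smooth_on_def by meson
  have "C_on k (S \<inter> U) F" using C_on_subset[OF spec[OF U(3)], of "S \<inter> U"] by simp
  then have "C_on k (S \<inter> U) f"
    using C_on_cong[of "S \<inter> U" F f k] U(1,4) assms(2) open_Int[OF assms(2) U(1)] by blast
  then show "\<exists>U. open U \<and> x \<in> U \<and> C_on k U f"
    using open_Int[OF assms(2) U(1)] \<open>x \<in> S\<close> U(2) by blast
qed

section \<open>Symmetry of second derivatives\<close>

abbreviation deriv2 :: "('a::euclidean_space \<Rightarrow> 'b::euclidean_space) \<Rightarrow> 'a \<Rightarrow> 'a \<Rightarrow> 'a \<Rightarrow> 'b" where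
  "deriv2 f x v w \<equiv> frechet_derivative (\<lambda>y. frechet_derivative f (at y) w) (at x) v"

text \<open>The mean value theorem is used twice: for s \<mapsto> f (x + s v + h w) - f (x + s v),
  then for the derivative along \<open>v\<close> as the base point moves along \<open>w\<close>. The
  second difference is symmetric in \<open>v\<close> and \<open>w\<close>, which forces the mixed
  derivatives to agree in the limit.\<close>

lemma second_difference_mean_value:
  fixes f :: "'a::euclidean_space \<Rightarrow> real"
  assumes "C_on 2 (ball x r) f" and h: "h > 0" "h * (norm v + norm w) < r"
  shows "\<exists>p. dist x p \<le> h * (norm v + norm w) \<and>
     f (x + h *\<^sub>R v + h *\<^sub>R w) - f (x + h *\<^sub>R v) - f (x + h *\<^sub>R w) + f x = h * h * deriv2 f p w v"
proof -
  have C: "C_on (Suc (Suc 0)) (ball x r) f" using assms(1) by (simp add: numeral_2_eq_2)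
  define g where "g = (\<lambda>y. frechet_derivative f (at y) v)"
  note f = C_on_SucD[OF C]
  have g: "(g has_derivative frechet_derivative g (at y)) (at y)" if "y \<in> ball x r" for y
    using C_on_SucD(1)[OF f(2)[of v] that] by (simp add: g_def)
  have near: "dist x (x + s *\<^sub>R v + t *\<^sub>R w) \<le> h * (norm v + norm w)" if "0 \<le> s" "s \<le> h" "0 \<le> t" "t \<le> h" for s t
  proof -
    have "dist x (x + s *\<^sub>R v + t *\<^sub>R w) = norm (s *\<^sub>R v + t *\<^sub>R w)"
      by (metis add.assoc dist_commute dist_norm add_diff_cancel_left')
    also have "\<dots> \<le> s * norm v + t * norm w"
      using norm_triangle_ineq[of "s *\<^sub>R v" "t *\<^sub>R w"] that by simp
    also have "\<dots> \<le> h * norm v + h * norm w"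
      using that by (intro add_mono mult_right_mono) auto
    finally show ?thesis by (simp add: algebra_simps)
  qed
  have inb: "x + s *\<^sub>R v + t *\<^sub>R w \<in> ball x r" if "0 \<le> s" "s \<le> h" "0 \<le> t" "t \<le> h" for s t
    using near[OF that] h(2) by auto
  define \<phi> where "\<phi> = (\<lambda>s. f (x + s *\<^sub>R v + h *\<^sub>R w) - f (x + s *\<^sub>R v))"
  have d\<phi>: "(\<phi> has_real_derivative g (x + s *\<^sub>R v + h *\<^sub>R w) - g (x + s *\<^sub>R v)) (at s)"
    if "0 \<le> s" "s \<le> h" for s
  proof -
    have in1: "x + s *\<^sub>R v + h *\<^sub>R w \<in> ball x r" and in2: "x + s *\<^sub>R v \<in> ball x r"
      using inb[of s h] inb[of s 0] that h(1) by auto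
    have 1: "((\<lambda>s. x + s *\<^sub>R v + h *\<^sub>R w) has_derivative (\<lambda>t. t *\<^sub>R v)) (at s)"
      and 2: "((\<lambda>s. x + s *\<^sub>R v) has_derivative (\<lambda>t. t *\<^sub>R v)) (at s)"
      by (auto intro!: derivative_eq_intros)
    show ?thesis unfolding \<phi>_def has_field_derivative_def
      apply (rule has_derivative_eq_rhs[OF has_derivative_diff[OF has_derivative_compose[OF 1 f(1)[OF in1]]
          has_derivative_compose[OF 2 f(1)[OF in2]]]])
      using has_derivative_linear[OF f(1)[OF in1]] has_derivative_linear[OF f(1)[OF in2]]
      by (auto simp: g_def linear_cmul algebra_simps)
  qed
  obtain s where s: "0 < s" "s < h" "\<phi> h - \<phi> 0 = (h - 0) * (g (x + s *\<^sub>R v + h *\<^sub>R w) - g (x + s *\<^sub>R v))"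
    using MVT2[of 0 h \<phi> "\<lambda>s. g (x + s *\<^sub>R v + h *\<^sub>R w) - g (x + s *\<^sub>R v)"] d\<phi> h(1) by auto
  define \<psi> where "\<psi> = (\<lambda>t. g (x + s *\<^sub>R v + t *\<^sub>R w))"
  have d\<psi>: "(\<psi> has_real_derivative frechet_derivative g (at (x + s *\<^sub>R v + t *\<^sub>R w)) w) (at t)"
    if "0 \<le> t" "t \<le> h" for t
  proof -
    have in1: "x + s *\<^sub>R v + t *\<^sub>R w \<in> ball x r" using inb[of s t] that s by auto
    have 1: "((\<lambda>t. x + s *\<^sub>R v + t *\<^sub>R w) has_derivative (\<lambda>u. u *\<^sub>R w)) (at t)"
      by (auto intro!: derivative_eq_intros)
    show ?thesis unfolding \<psi>_def has_field_derivative_def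
      apply (rule has_derivative_eq_rhs[OF has_derivative_compose[OF 1 g[OF in1]]])
      using has_derivative_linear[OF g[OF in1]]
      by (auto simp: linear_cmul algebra_simps)
  qed
  obtain t where t: "0 < t" "t < h" "\<psi> h - \<psi> 0 = (h - 0) * frechet_derivative g (at (x + s *\<^sub>R v + t *\<^sub>R w)) w"
    using MVT2[of 0 h \<psi> "\<lambda>t. frechet_derivative g (at (x + s *\<^sub>R v + t *\<^sub>R w)) w"] d\<psi> h(1) by auto
  show ?thesis
    apply (rule exI[of _ "x + s *\<^sub>R v + t *\<^sub>R w"])
    using near[of s t] s t by (auto simp: \<phi>_def \<psi>_def g_def)
qed

lemma deriv2_commute_real:
  fixes f :: "'a::euclidean_space \<Rightarrow> real"
  assumes "C_on 2 U f" "open U" "x \<in> U"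
  shows "deriv2 f x v w = deriv2 f x w v"
proof (rule ccontr)
  assume ne: "deriv2 f x v w \<noteq> deriv2 f x w v"
  define e where "e = \<bar>deriv2 f x v w - deriv2 f x w v\<bar> / 2"
  have e: "e > 0" using ne by (simp add: e_def)
  have cont: "continuous_on U (\<lambda>y. deriv2 f y v w)" for v w
    using assms(1) by (simp add: numeral_2_eq_2)
  obtain r0 where r0: "r0 > 0" "ball x r0 \<subseteq> U" using assms openE by blast
  have "\<exists>d>0. \<forall>y. dist x y < d \<longrightarrow> \<bar>deriv2 f y v w - deriv2 f x v w\<bar> < e" for v w
  proof -
    have "continuous (at x) (\<lambda>y. deriv2 f y v w)"
      using cont[where v=v and w=w] assms(2,3) by (simp add: continuous_on_eq_continuous_at)
    then obtain d where "d > 0" "\<forall>y. dist y x < d \<longrightarrow> dist (deriv2 f y v w) (deriv2 f x v w) < e"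
      using e unfolding continuous_at_eps_delta by blast
    then show ?thesis by (intro exI[of _ d]) (simp add: dist_commute dist_real_def)
  qed
  then obtain d1 d2 where d: "d1 > 0" "\<And>y. dist x y < d1 \<Longrightarrow> \<bar>deriv2 f y v w - deriv2 f x v w\<bar> < e"
     "d2 > 0" "\<And>y. dist x y < d2 \<Longrightarrow> \<bar>deriv2 f y w v - deriv2 f x w v\<bar> < e" by blast
  define d where "d = min r0 (min d1 d2)"
  \<comment> \<open>The summand 1 keeps the denominator positive when both directions vanish; every
    point met below lies within \<open>d\<close> of \<open>x\<close>.\<close>
  define h where "h = d / (2 * (norm v + norm w + 1))"
  have pos: "norm v + norm w + 1 > 0" by (smt (verit) norm_ge_zero)
  have dpos: "d > 0" using r0 d by (simp add: d_def)
  have h: "h > 0" using dpos pos by (simp add: h_def)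
  have "h * (norm v + norm w) < h * (2 * (norm v + norm w + 1))"
  proof (rule mult_strict_left_mono[OF _ h])
    show "norm v + norm w < 2 * (norm v + norm w + 1)" by (smt (verit) norm_ge_zero)
  qed
  also have "\<dots> = d" using pos by (simp add: h_def)
  finally have hd: "h * (norm v + norm w) < d" .
  have "ball x d \<subseteq> U" using r0(2) by (auto simp: d_def)
  then have C: "C_on 2 (ball x d) f" by (rule C_on_subset[OF assms(1)])
  obtain p where p: "dist x p \<le> h * (norm v + norm w)"
     "f (x + h *\<^sub>R v + h *\<^sub>R w) - f (x + h *\<^sub>R v) - f (x + h *\<^sub>R w) + f x = h * h * deriv2 f p w v"
    using second_difference_mean_value[OF C h hd] by blast
  obtain q where q: "dist x q \<le> h * (norm v + norm w)"
     "f (x + h *\<^sub>R w + h *\<^sub>R v) - f (x + h *\<^sub>R w) - f (x + h *\<^sub>R v) + f x = h * h * deriv2 f q v w"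
    using second_difference_mean_value[OF C h, of w v] hd by (auto simp only: add.commute[of "norm w"])
  have "h * h * deriv2 f p w v = h * h * deriv2 f q v w"
    unfolding p(2)[symmetric] q(2)[symmetric] by (simp add: add_ac)
  then have "deriv2 f p w v = deriv2 f q v w" using h by simp
  moreover have "\<bar>deriv2 f p w v - deriv2 f x w v\<bar> < e" "\<bar>deriv2 f q v w - deriv2 f x v w\<bar> < e"
    using d(4)[of p] d(2)[of q] p(1) q(1) hd by (simp_all add: d_def)
  moreover have "False" if "a = b" "\<bar>a - c\<bar> < \<bar>d - c\<bar> / 2" "\<bar>b - d\<bar> < \<bar>d - c\<bar> / 2" for a b c d :: real
    using that abs_triangle_ineq4[of "d - a" "c - a"] by (simp add: abs_minus_commute)
  ultimately show False unfolding e_def by blast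
qed

lemma deriv2_commute:
  fixes f :: "'a::euclidean_space \<Rightarrow> 'b::euclidean_space"
  assumes "C_on 2 U f" "open U" "x \<in> U"
  shows "deriv2 f x v w = deriv2 f x w v"
proof (rule euclidean_eqI)
  fix b :: 'b assume "b \<in> Basis"
  have C: "C_on (Suc (Suc 0)) U f" using assms(1) by (simp add: numeral_2_eq_2)
  note f = C_on_SucD[OF C]
  have 1: "frechet_derivative (\<lambda>y. f y \<bullet> b) (at y) v = frechet_derivative f (at y) v \<bullet> b" if "y \<in> U" for y v
    by (metis frechet_derivative_at bounded_linear.has_derivative[OF bounded_linear_inner_left f(1)[OF that]])
  have 2: "deriv2 (\<lambda>y. f y \<bullet> b) x v w = deriv2 f x v w \<bullet> b" for v w
  proof -
    have "((\<lambda>y. frechet_derivative f (at y) w) has_derivative (\<lambda>v. deriv2 f x v w)) (at x)"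
      by (rule C_on_SucD(1)[OF f(2) assms(3)])
    from bounded_linear.has_derivative[OF bounded_linear_inner_left this]
    have "((\<lambda>y. frechet_derivative f (at y) w \<bullet> b) has_derivative (\<lambda>v. deriv2 f x v w \<bullet> b)) (at x)" .
    then have "((\<lambda>y. frechet_derivative (\<lambda>y. f y \<bullet> b) (at y) w) has_derivative (\<lambda>v. deriv2 f x v w \<bullet> b)) (at x)"
      by (rule has_derivative_transform_within_open[OF _ assms(2,3)]) (simp add: 1)
    then show ?thesis by (metis frechet_derivative_at)
  qed
  have "C_on 2 U (\<lambda>y. f y \<bullet> b)" using assms(1) by (intro C_on_inner C_on_const assms(2))
  from deriv2_commute_real[OF this assms(2,3)]
  show "deriv2 f x v w \<bullet> b = deriv2 f x w v \<bullet> b" by (simp add: 2)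
qed

section \<open>Maps of class C^1 and integrals with a parameter\<close>

lemma C_on_1I:
  assumes "open U" "\<And>x. x \<in> U \<Longrightarrow> (f has_derivative f' x) (at x)"
    and "\<And>v. continuous_on U (\<lambda>x. f' x v)"
  shows "C_on 1 U f"
  unfolding One_nat_def by (rule C_on_SucI[OF assms(1,2)]) (simp_all add: assms(3))

lemma C_on_1D:
  assumes "C_on 1 U f"
  shows "\<And>x. x \<in> U \<Longrightarrow> (f has_derivative frechet_derivative f (at x)) (at x)"
    and "\<And>v. continuous_on U (\<lambda>x. frechet_derivative f (at x) v)"
  using C_on_SucD[of 0 U f] assms by auto

text \<open>\<open>leibniz_rule\<close> asks for a continuous family in the space of bounded linear
  maps. Continuity there is checked on basis vectors, where \<open>C_on\<close> provides it, and
  evaluation at \<open>v\<close> commutes with the integral.\<close>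

lemma C_on_integral_param:
  fixes f :: "'a::euclidean_space \<times> real \<Rightarrow> 'b::euclidean_space"
  assumes "C_on 1 UNIV f"
  shows "((\<lambda>x. integral {a..b} (\<lambda>t. f (x, t))) has_derivative
            (\<lambda>v. integral {a..b} (\<lambda>t. frechet_derivative f (at (x, t)) (v, 0)))) (at x)"
    and "C_on 1 UNIV (\<lambda>x. integral {a..b} (\<lambda>t. f (x, t)))"
proof -
  define D where "D = (\<lambda>x t v. frechet_derivative f (at (x, t)) (v, 0))"
  have d: "((\<lambda>x. f (x, t)) has_derivative D x t) (at x)" for x t
  proof -
    have "((\<lambda>x. (x, t)) has_derivative (\<lambda>v. (v, 0))) (at x)"
      by (intro derivative_eq_intros) auto
    from has_derivative_compose[OF this C_on_1D(1)[OF assms]] show ?thesis by (simp add: D_def)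
  qed
  have bl: "bounded_linear (D x t)" for x t
    using d has_derivative_bounded_linear by blast
  have cD: "continuous_on UNIV (\<lambda>(x, t). D x t v)" for v
    using C_on_1D(2)[OF assms, of "(v, 0)"] by (simp add: D_def case_prod_beta)
  have cf: "continuous_on UNIV f" using C_on_imp_continuous_on[OF assms] .
  have int: "(\<lambda>t. f (x, t)) integrable_on cbox a b" for x
    by (intro integrable_continuous continuous_on_compose2[OF cf] continuous_intros) auto
  have L: "((\<lambda>x. integral (cbox a b) (\<lambda>t. f (x, t))) has_derivative
            blinfun_apply (integral (cbox a b) (\<lambda>t. Blinfun (D x t)))) (at x within UNIV)" for x
  proof (rule leibniz_rule)
    show "((\<lambda>x. f (x, t)) has_derivative blinfun_apply (Blinfun (D x t))) (at x within UNIV)" for x t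
      using d bl by (simp add: bounded_linear_Blinfun_apply)
    show "continuous_on (UNIV \<times> cbox a b) (\<lambda>(x, t). Blinfun (D x t))"
      using continuous_on_subset[OF cD]
      by (auto intro!: continuous_on_blinfun_componentwise simp: case_prod_beta bounded_linear_Blinfun_apply bl)
  qed (use int in auto)
  have "blinfun_apply (integral (cbox a b) (\<lambda>t. Blinfun (D x t))) v = integral (cbox a b) (\<lambda>t. D x t v)" for x v
  proof -
    have "continuous_on (cbox a b) (\<lambda>t. Blinfun (D x t))"
    proof (rule continuous_on_blinfun_componentwise)
      fix i :: 'a
      have "continuous_on (cbox a b) (\<lambda>t. (\<lambda>(x, t). D x t i) (x, t))"
        by (intro continuous_on_compose2[OF cD] continuous_intros) auto
      then show "continuous_on (cbox a b) (\<lambda>t. blinfun_apply (Blinfun (D x t)) i)"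
        by (simp add: bounded_linear_Blinfun_apply bl)
    qed
    from integrable_continuous[OF this]
    show ?thesis using integral_linear[OF _ blinfun.bounded_linear_left, of "\<lambda>t. Blinfun (D x t)" "cbox a b" v]
      by (simp add: o_def bounded_linear_Blinfun_apply bl)
  qed
  then have eq: "blinfun_apply (integral (cbox a b) (\<lambda>t. Blinfun (D x t))) = (\<lambda>v. integral (cbox a b) (\<lambda>t. D x t v))" for x
    by blast
  have L': "((\<lambda>x. integral {a..b} (\<lambda>t. f (x, t))) has_derivative (\<lambda>v. integral {a..b} (\<lambda>t. D x t v))) (at x)" for x
    using L[of x] unfolding eq interval_cbox by simp
  then show "((\<lambda>x. integral {a..b} (\<lambda>t. f (x, t))) has_derivative
            (\<lambda>v. integral {a..b} (\<lambda>t. frechet_derivative f (at (x, t)) (v, 0)))) (at x)"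
    by (simp add: D_def)
  show "C_on 1 UNIV (\<lambda>x. integral {a..b} (\<lambda>t. f (x, t)))"
  proof (rule C_on_1I[OF open_UNIV L'])
    fix v
    have "continuous_on (UNIV \<times> cbox a b) (\<lambda>(x, t). D x t v)"
      using cD continuous_on_subset by blast
    from integral_continuous_on_param[OF this]
    show "continuous_on UNIV (\<lambda>x. integral {a..b} (\<lambda>t. D x t v))"
      unfolding interval_cbox .
  qed
qed

section \<open>Symplectic forms on Euclidean space\<close>

lemma lborel_integral_translate:
  fixes f :: "'a::euclidean_space \<Rightarrow> real"
  assumes "integrable lborel f"
  shows "integrable lborel (\<lambda>x. f (x + a))" "(\<integral>x. f (x + a) \<partial>lborel) = (\<integral>x. f x \<partial>lborel)"
proof -
  have d: "distr lborel borel ((+) a) = (lborel :: 'a measure)" by (rule lborel_distr_plus)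
  have f: "f \<in> borel_measurable borel" using assms by simp
  show "integrable lborel (\<lambda>x. f (x + a))"
    using integrable_distr[of "(+) a" "lborel :: 'a measure" borel f] assms d by (simp add: add.commute)
  show "(\<integral>x. f (x + a) \<partial>lborel) = (\<integral>x. f x \<partial>lborel)"
    using integral_distr[of "(+) a" "lborel :: 'a measure" borel f] f d by (simp add: add.commute)
qed

lemma integrable_compact_support:
  fixes f :: "'a::euclidean_space \<Rightarrow> real"
  assumes "continuous_on UNIV f" "\<And>x. norm x > r \<Longrightarrow> f x = 0"
  shows "integrable lborel f"
proof -
  have "integrable lborel (\<lambda>x. indicator (cball 0 r) x *\<^sub>R f x)"
    using borel_integrable_compact[OF compact_cball continuous_on_subset[OF assms(1) subset_UNIV]] .
  moreover have "(\<lambda>x. indicator (cball 0 r) x *\<^sub>R f x) = f"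
    using assms(2) by (auto simp: indicator_def fun_eq_iff)
  ultimately show ?thesis by simp
qed

lemma has_derivative_line:
  assumes "(f has_derivative D) (at (x + s *\<^sub>R v))"
  shows "((\<lambda>s. f (x + s *\<^sub>R v)) has_vector_derivative D v) (at s)"
proof -
  have "((\<lambda>s. x + s *\<^sub>R v) has_derivative (\<lambda>t. t *\<^sub>R v)) (at s)"
    by (auto intro!: derivative_eq_intros)
  from has_derivative_compose[OF this assms] show ?thesis
    using has_derivative_linear[OF assms] by (simp add: has_vector_derivative_def linear_cmul)
qed

text \<open>By translation invariance every difference quotient of \<open>f\<close> has integral
  zero, and the quotients converge dominatedly to the derivative.\<close>

lemma integral_derivative_compact_support:
  fixes f :: "'a::euclidean_space \<Rightarrow> real"
  assumes C: "C_on 1 UNIV f" and supp: "\<And>x. norm x > r \<Longrightarrow> f x = 0"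
  shows "integrable lborel (\<lambda>x. frechet_derivative f (at x) v)"
    and "(\<integral>x. frechet_derivative f (at x) v \<partial>lborel) = 0"
proof -
  define g where "g = (\<lambda>x. frechet_derivative f (at x) v)"
  note f = C_on_1D[OF C]
  have cg: "continuous_on UNIV g" using f(2) by (simp add: g_def)
  have g0: "g x = 0" if "norm x > r" for x
  proof -
    have "open {x::'a. norm x > r}" by (intro open_Collect_less continuous_intros)
    then have "((\<lambda>x. 0) has_derivative frechet_derivative f (at x)) (at x)"
      using has_derivative_transform_within_open[OF f(1)[of x], of "{x. norm x > r}" "\<lambda>x. 0"] supp that by auto
    then have "frechet_derivative f (at x) = (\<lambda>v. 0)"
      using has_derivative_unique has_derivative_const by blast
    then show ?thesis by (simp add: g_def)
  qed
  show ig: "integrable lborel (\<lambda>x. frechet_derivative f (at x) v)"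
    using integrable_compact_support[OF cg g0] by (simp add: g_def)
  have "compact (g ` cball 0 r)"
    using compact_continuous_image[OF continuous_on_subset[OF cg] compact_cball] by auto
  then obtain B0 where B0: "\<And>x. norm x \<le> r \<Longrightarrow> \<bar>g x\<bar> \<le> B0"
    using compact_imp_bounded[of "g ` cball 0 r"] unfolding bounded_iff by (metis image_eqI mem_cball_0 real_norm_def)
  define B where "B = max 0 B0"
  have B: "\<bar>g x\<bar> \<le> B" for x
    using B0[of x] g0[of x] by (cases "norm x \<le> r") (auto simp: B_def)
  have B_nonneg: "B \<ge> 0" by (simp add: B_def)
  have line: "((\<lambda>s. f (x + s *\<^sub>R v)) has_real_derivative g (x + s *\<^sub>R v)) (at s)" for x s
    using has_derivative_line[OF f(1)] by (simp add: g_def has_real_derivative_iff_has_vector_derivative)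
  define h where "h = (\<lambda>k::nat. 1 / (real k + 1))"
  have h: "0 < h k" "h k \<le> 1" for k by (auto simp: h_def)
  have hlim: "h \<longlonglongrightarrow> 0" unfolding h_def by real_asymp
  define q where "q = (\<lambda>k x. (f (x + h k *\<^sub>R v) - f x) / h k)"
  have intf: "integrable lborel f" by (rule integrable_compact_support[OF C_on_imp_continuous_on[OF C] supp])
  have cf: "continuous_on UNIV f" by (rule C_on_imp_continuous_on[OF C])
  have "(\<lambda>k. \<integral>x. q k x \<partial>lborel) \<longlonglongrightarrow> (\<integral>x. g x \<partial>lborel)"
  proof (rule integral_dominated_convergence)
    show "g \<in> borel_measurable lborel" using cg by (simp add: borel_measurable_continuous_onI)
    show "q k \<in> borel_measurable lborel" for k
      unfolding q_def using lborel_integral_translate(1)[OF intf] intf by simp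
    \<comment> \<open>The shifts have length at most \<open>norm v\<close>, so all difference
      quotients are supported in this enlarged ball, where the mean value theorem bounds them by
      \<open>B\<close>.\<close>
    have "emeasure lborel (cball (0::'a) (r + norm v)) < \<infinity>"
      using emeasure_bounded_finite bounded_cball by blast
    then show "integrable lborel (\<lambda>x::'a. B * indicator (cball 0 (r + norm v)) x :: real)"
      by (intro integrable_mult_right integrable_real_indicator) auto
    show "AE x in lborel. (\<lambda>k. q k x) \<longlonglongrightarrow> g x"
    proof (rule AE_I2)
      fix x
      have "((\<lambda>t. (f (x + t *\<^sub>R v) - f x) / t) \<longlongrightarrow> g x) (at 0)"
        using line[of x 0] by (simp add: has_field_derivative_iff)
      moreover have "filterlim h (at 0) sequentially"
        using hlim h(1) by (intro filterlim_atI) (auto intro!: always_eventually simp: less_imp_neq[symmetric])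
      ultimately show "(\<lambda>k. q k x) \<longlonglongrightarrow> g x"
        unfolding q_def by (rule filterlim_compose)
    qed
    show "AE x in lborel. norm (q k x) \<le> B * indicator (cball 0 (r + norm v)) x" for k
    proof (rule AE_I2)
      fix x
      show "norm (q k x) \<le> B * indicator (cball 0 (r + norm v)) x"
      proof (cases "norm x \<le> r + norm v")
        case True
        obtain z where "f (x + h k *\<^sub>R v) - f (x + 0 *\<^sub>R v) = (h k - 0) * g (x + z *\<^sub>R v)"
          using MVT2[of 0 "h k" "\<lambda>s. f (x + s *\<^sub>R v)" "\<lambda>s. g (x + s *\<^sub>R v)"] line h(1) by blast
        then have "q k x = g (x + z *\<^sub>R v)" using h(1)[of k] by (simp add: q_def)
        then show ?thesis using B True by simp
      next
        case False
        have "norm (h k *\<^sub>R v) \<le> norm v" using h[of k] mult_right_mono[of "h k" 1 "norm v"] by simp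
        then have "norm (x + h k *\<^sub>R v) > r" using False norm_diff_ineq[of x "h k *\<^sub>R v"] by simp
        moreover have "norm x > r" using False norm_ge_zero[of v] by linarith
        ultimately show ?thesis using supp by (simp add: q_def B_nonneg)
      qed
    qed
  qed
  moreover have "(\<integral>x. q k x \<partial>lborel) = 0" for k
    using lborel_integral_translate[OF intf, of "h k *\<^sub>R v"] intf by (simp add: q_def)
  ultimately show "(\<integral>x. frechet_derivative f (at x) v \<partial>lborel) = 0"
    using LIMSEQ_unique[of "\<lambda>k. 0::real" 0] by (simp add: g_def)
qed

section \<open>Derivatives of determinants and of the Liouville density\<close>

lemma C_on_det:
  fixes A :: "'a::euclidean_space \<Rightarrow> real^'n^'n"
  assumes "open U" "\<And>i j. C_on k U (\<lambda>x. A x $ i $ j)"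
  shows "C_on k U (\<lambda>x. det (A x))"
  unfolding det_def by (intro C_on_sum C_on_mult C_on_prod assms C_on_const)

text \<open>A permutation other than the identity moves at least two points. After one factor of its
  product has been differentiated, an off-diagonal entry of the identity matrix remains, so only the
  diagonal term survives.\<close>

lemma has_derivative_det_at_identity:
  fixes B :: "'a::real_normed_vector \<Rightarrow> real^'n^'n"
  assumes B: "\<And>i j. ((\<lambda>y. B y $ i $ j) has_derivative (\<lambda>v. B' v $ i $ j)) (at x)"
    and id: "B x = mat 1"
  shows "((\<lambda>y. det (B y)) has_derivative (\<lambda>v. trace (B' v))) (at x)"
proof -
  let ?P = "{p. p permutes (UNIV :: 'n set)}"
  have "((\<lambda>y. det (B y)) has_derivative
     (\<lambda>v. \<Sum>p\<in>?P. of_int (sign p) * (\<Sum>i\<in>UNIV. B' v $ i $ p i * (\<Prod>j\<in>UNIV - {i}. B x $ j $ p j)))) (at x)"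
    unfolding det_def
    by (intro has_derivative_sum has_derivative_mult_right has_derivative_prod B)
  moreover have "(\<Sum>p\<in>?P. of_int (sign p) * (\<Sum>i\<in>UNIV. B' v $ i $ p i * (\<Prod>j\<in>UNIV - {i}. B x $ j $ p j)))
    = trace (B' v)" for v
  proof -
    have z: "(\<Prod>j\<in>UNIV - {i}. B x $ j $ p j) = 0" if p: "p permutes UNIV" "p \<noteq> id" for p and i :: 'n
    proof -
      obtain j where j: "j \<noteq> i" "p j \<noteq> j"
      proof (cases "p i = i")
        case True
        then show thesis using p(2) that by (metis eq_id_iff)
      next
        case False
        moreover have "inj p" using p(1) permutes_inj by blast
        ultimately show thesis using that[of "p i"] by (metis injD)
      qed
      then have "B x $ j $ p j = 0" by (simp add: id mat_def)
      then show ?thesis using j by (intro prod_zero) auto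
    qed
    have "(\<Sum>p\<in>?P. of_int (sign p) * (\<Sum>i\<in>UNIV. B' v $ i $ p i * (\<Prod>j\<in>UNIV - {i}. B x $ j $ p j)))
      = (\<Sum>p\<in>{id}. of_int (sign p) * (\<Sum>i\<in>UNIV. B' v $ i $ p i * (\<Prod>j\<in>UNIV - {i}. B x $ j $ p j)))"
      by (rule sum.mono_neutral_right) (auto simp: permutes_id z)
    also have "\<dots> = trace (B' v)" by (simp add: id mat_def trace_def)
    finally show ?thesis .
  qed
  ultimately show ?thesis by simp
qed

text \<open>Jacobi's formula, reduced to the identity matrix by det (A y) = det (A x) det (W A
  y).\<close>

lemma has_derivative_det:
  fixes A :: "'a::real_normed_vector \<Rightarrow> real^'n^'n"
  assumes A: "\<And>i j. ((\<lambda>y. A y $ i $ j) has_derivative (\<lambda>v. A' v $ i $ j)) (at x)"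
    and W: "W ** A x = mat 1"
  shows "((\<lambda>y. det (A y)) has_derivative (\<lambda>v. det (A x) * trace (W ** A' v))) (at x)"
proof -
  have "((\<lambda>y. (W ** A y) $ i $ j) has_derivative (\<lambda>v. (W ** A' v) $ i $ j)) (at x)" for i j
    unfolding matrix_matrix_mult_def by (simp, intro has_derivative_sum has_derivative_mult_right A)
  from has_derivative_det_at_identity[of "\<lambda>y. W ** A y", OF this W]
  have "((\<lambda>y. det (A x) * det (W ** A y)) has_derivative (\<lambda>v. det (A x) * trace (W ** A' v))) (at x)"
    by (rule has_derivative_mult_right)
  moreover have "det (A x) * det W = 1" using W det_mul[of W "A x"] by (simp add: mult.commute)
  then have "det (A x) * det (W ** A y) = det (A y)" for y
    by (simp add: det_mul mult.assoc[symmetric])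
  ultimately show ?thesis by simp
qed

text \<open>Written with \<open>2 * t\<close> in the denominator, one formula covers both signs, so
  the density sqrt |det \<Omega>| calls for no discussion of the sign of the determinant.\<close>

lemma has_real_derivative_sqrt_abs:
  assumes "t \<noteq> 0"
  shows "((\<lambda>t. sqrt \<bar>t\<bar>) has_real_derivative sqrt \<bar>t\<bar> / (2 * t)) (at t)"
proof (cases "t > 0")
  case True
  have "inverse (sqrt t) / 2 = sqrt \<bar>t\<bar> / (2 * t)"
    using True real_sqrt_mult_self[of t] by (simp add: field_simps)
  then have "(sqrt has_real_derivative sqrt \<bar>t\<bar> / (2 * t)) (at t)"
    using DERIV_real_sqrt[OF True] by (simp add: mult.commute)
  moreover have "\<forall>\<^sub>F s in nhds t. sqrt s = sqrt \<bar>s\<bar>"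
    using eventually_nhds_in_open[of "{0<..}" t] True by (auto elim!: eventually_mono)
  ultimately show ?thesis by (subst (asm) DERIV_cong_ev) auto
next
  case False
  then have t: "t < 0" using assms by simp
  have "((\<lambda>s. sqrt (- s)) has_real_derivative sqrt \<bar>t\<bar> / (2 * t)) (at t)"
    using t by (auto intro!: derivative_eq_intros simp: field_simps)
  moreover have "\<forall>\<^sub>F s in nhds t. sqrt (- s) = sqrt \<bar>s\<bar>"
    using eventually_nhds_in_open[of "{..<0}" t] t by (auto elim!: eventually_mono)
  ultimately show ?thesis by (subst (asm) DERIV_cong_ev) auto
qed

lemma C_on_sqrt_abs:
  fixes f :: "'a::euclidean_space \<Rightarrow> real"
  assumes "open U" "C_on 1 U f" "\<And>x. x \<in> U \<Longrightarrow> f x \<noteq> 0"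
  shows "C_on 1 U (\<lambda>x. sqrt \<bar>f x\<bar>)"
proof (rule C_on_compose[OF assms(1) _ _ assms(2)])
  show "open (- {0::real})" by auto
  show "C_on 1 (- {0::real}) (\<lambda>t. sqrt \<bar>t\<bar>)"
  proof (rule C_on_1I)
    show "((\<lambda>t. sqrt \<bar>t\<bar>) has_derivative (\<lambda>v. sqrt \<bar>t\<bar> / (2 * t) * v)) (at t)" if "t \<in> - {0}" for t
      using has_real_derivative_sqrt_abs[of t] that unfolding has_field_derivative_def by blast
    show "continuous_on (- {0}) (\<lambda>t. sqrt \<bar>t\<bar> / (2 * t) * v)" for v
      by (intro continuous_intros) auto
  qed auto
qed (use assms(3) in auto)

text \<open>With \<open>\<omega> = \<Omega>\<close> and \<open>\<iota>\<^sub>X \<omega> = \<alpha>\<close>, this is Cartan's formula: the Lie derivative of a closed \<open>\<omega> = d\<alpha>\<close>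
  along \<open>X\<close> is \<open>\<omega>\<close> again. The trace of the identity says how \<open>X\<close> scales the Liouville volume.\<close>

lemma trace_Liouville:
  fixes \<Omega> W DX :: "real^'n^'n" and DO :: "real^'n \<Rightarrow> real^'n^'n"
  assumes skew: "\<And>i j. \<Omega> $ i $ j = - \<Omega> $ j $ i"
    and W: "W ** \<Omega> = mat 1"
    and lin: "linear DO"
    and closed: "\<And>i j k. DO (axis i 1) $ j $ k + DO (axis j 1) $ k $ i + DO (axis k 1) $ i $ j = 0"
    and skewD: "\<And>v i j. DO v $ i $ j = - DO v $ j $ i"
    and d\<alpha>: "\<And>k j. D\<alpha> $ k $ j - D\<alpha> $ j $ k = \<Omega> $ k $ j"
    and X: "\<And>k j. (\<Sum>i\<in>UNIV. DX $ k $ i * \<Omega> $ i $ j + X $ i * DO (axis k 1) $ i $ j) = D\<alpha> $ k $ j"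
  shows "trace (W ** DO X) + 2 * (\<Sum>i\<in>UNIV. DX $ i $ i) = of_nat CARD('n)"
proof -
  have DOX: "DO X $ k $ j = (\<Sum>i\<in>UNIV. X $ i * DO (axis i 1) $ k $ j)" for k j
    by (subst linear_axis_sum[OF lin]) (simp add: sum_component)
  have e: "DO X $ k $ j = \<Omega> $ k $ j - (DX ** \<Omega>) $ k $ j + (DX ** \<Omega>) $ j $ k" for k j
  proof -
    have "\<Omega> $ k $ j = (\<Sum>i\<in>UNIV. DX $ k $ i * \<Omega> $ i $ j + X $ i * DO (axis k 1) $ i $ j)
        - (\<Sum>i\<in>UNIV. DX $ j $ i * \<Omega> $ i $ k + X $ i * DO (axis j 1) $ i $ k)"
      using d\<alpha> X by metis
    also have "\<dots> = (DX ** \<Omega>) $ k $ j - (DX ** \<Omega>) $ j $ k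
        + (\<Sum>i\<in>UNIV. X $ i * (DO (axis k 1) $ i $ j - DO (axis j 1) $ i $ k))"
      by (simp add: matrix_matrix_mult_def sum.distrib sum_subtractf right_diff_distrib)
    also have "(\<Sum>i\<in>UNIV. X $ i * (DO (axis k 1) $ i $ j - DO (axis j 1) $ i $ k)) = DO X $ k $ j"
      unfolding DOX
    proof (rule sum.cong[OF refl])
      fix i
      \<comment> \<open>Closedness merges the two partial derivatives left over from d (\<iota>_X
        \<Omega>) into the derivative of \<Omega> along X.\<close>
      have "DO (axis k 1) $ i $ j - DO (axis j 1) $ i $ k = DO (axis i 1) $ k $ j"
        using closed[of i k j] skewD[of "axis k 1" i j] skewD[of "axis j 1" i k] skewD[of "axis i 1" k j] by linarith
      then show "X $ i * (DO (axis k 1) $ i $ j - DO (axis j 1) $ i $ k) = X $ i * DO (axis i 1) $ k $ j" by simp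
    qed
    finally show ?thesis by simp
  qed
  have tO: "transpose \<Omega> = - \<Omega>"
    by (simp add: vec_eq_iff transpose_def, metis skew)
  have W2: "\<Omega> ** W = mat 1" using W matrix_left_right_inverse by blast
  \<comment> \<open>This is L_X \<Omega> = \<Omega> in coordinates. After multiplication by
    \<open>W\<close>, each of the last two products has the trace of \<open>DX\<close>; hence the
    factor 2 in the conclusion.\<close>
  have M: "DO X = \<Omega> - DX ** \<Omega> - \<Omega> ** transpose DX"
  proof -
    have "transpose (DX ** \<Omega>) = - (\<Omega> ** transpose DX)"
      by (simp add: matrix_transpose_mul tO) (simp add: vec_eq_iff matrix_matrix_mult_def sum_negf)
    moreover have "DO X = \<Omega> - DX ** \<Omega> + transpose (DX ** \<Omega>)"
      by (simp add: vec_eq_iff e transpose_def)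
    ultimately show ?thesis by simp
  qed
  have "trace (W ** DO X) = trace (W ** \<Omega>) - trace (W ** (DX ** \<Omega>)) - trace (W ** (\<Omega> ** transpose DX))"
    unfolding M
    by (simp add: trace_sub[symmetric]) (simp add: vec_eq_iff matrix_matrix_mult_def sum_subtractf right_diff_distrib trace_def)
  also have "trace (W ** (DX ** \<Omega>)) = trace DX"
    using trace_mul_sym[of W "DX ** \<Omega>"] by (simp add: matrix_mul_assoc[symmetric] W2)
  also have "trace (W ** (\<Omega> ** transpose DX)) = trace DX"
    by (simp add: matrix_mul_assoc W) (simp add: trace_def transpose_def)
  finally show ?thesis by (simp add: W trace_def mat_def)
qed

text \<open>The conformal factor of stereographic projection.\<close>

definition conf :: "'a::real_normed_vector \<Rightarrow> real" where
  "conf x = 2 / (1 + (norm x)\<^sup>2)"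

lemma conf_pos: "conf x > 0"
  by (simp add: conf_def add_pos_nonneg)

section \<open>The radial primitive of a closed two-form\<close>

text \<open>With r the square of the norm, \<open>2 * t^2 / (1 + t^2 * r)\<close> is an
  antiderivative. The weight t is that of the radial homotopy operator on two-forms, whose size this
  integral controls.\<close>

lemma integral_conf_squared:
  "((\<lambda>t. t * (conf (t *\<^sub>R x))\<^sup>2) has_integral conf x) {0..1}"
proof -
  let ?r = "(norm x)\<^sup>2"
  have pos: "1 + t\<^sup>2 * ?r > 0" for t :: real by (simp add: add_pos_nonneg)
  have "((\<lambda>t. 2 * t\<^sup>2 / (1 + t\<^sup>2 * ?r)) has_real_derivative 4 * t / (1 + t\<^sup>2 * ?r)\<^sup>2) (at t within {0..1})" for t
    using pos[of t] by (auto intro!: derivative_eq_intros simp: power2_eq_square field_simps)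
  then have "((\<lambda>t. 4 * t / (1 + t\<^sup>2 * ?r)\<^sup>2) has_integral (2 * 1\<^sup>2 / (1 + 1\<^sup>2 * ?r) - 2 * 0\<^sup>2 / (1 + 0\<^sup>2 * ?r))) {0..1}"
    by (intro fundamental_theorem_of_calculus) (auto simp: has_real_derivative_iff_has_vector_derivative)
  moreover have "t * (conf (t *\<^sub>R x))\<^sup>2 = 4 * t / (1 + t\<^sup>2 * ?r)\<^sup>2" for t
    by (simp add: conf_def power_mult_distrib power_divide)
  ultimately show ?thesis by (simp add: conf_def)
qed

text \<open>The primitive \<open>\<alpha> j x\<close> is the integral of t \<Omega>(t x)(x, e_j)
  over t in [0, 1]. By closedness its exterior derivative is the integral of d/dt (t^2 \<Omega>(t
  x)), which is \<Omega> x. In the bound, integration gains a factor \<open>norm x\<close> and gives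
  up one power of \<open>conf x\<close>.\<close>

lemma Poincare_lemma:
  fixes \<Omega> :: "real^'n \<Rightarrow> real^'n^'n" and M :: real
  assumes C: "C_on 1 UNIV \<Omega>"
    and skew: "\<And>x i j. \<Omega> x $ i $ j = - \<Omega> x $ j $ i"
    and closed: "\<And>x i j k. frechet_derivative \<Omega> (at x) (axis i 1) $ j $ k
       + frechet_derivative \<Omega> (at x) (axis j 1) $ k $ i + frechet_derivative \<Omega> (at x) (axis k 1) $ i $ j = 0"
    and bound: "\<And>x i j. \<bar>\<Omega> x $ i $ j\<bar> \<le> M * (conf x)\<^sup>2"
  obtains \<alpha> :: "'n \<Rightarrow> real^'n \<Rightarrow> real" where "\<And>j. C_on 1 UNIV (\<alpha> j)"
    "\<And>x j k. frechet_derivative (\<alpha> j) (at x) (axis k 1) - frechet_derivative (\<alpha> k) (at x) (axis j 1) = \<Omega> x $ k $ j"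
    "\<And>x j. \<bar>\<alpha> j x\<bar> \<le> CARD('n) * M * norm x * conf x"
proof -
  define D where "D = (\<lambda>x. frechet_derivative \<Omega> (at x))"
  have D: "(\<Omega> has_derivative D x) (at x)" for x
    using C_on_1D(1)[OF C] by (simp add: D_def)
  have cl: "D x (axis i 1) $ j $ k + D x (axis j 1) $ k $ i + D x (axis k 1) $ i $ j = 0" for x i j k
    unfolding D_def by (rule closed)
  have linD: "linear (D x)" for x using has_derivative_linear[OF D] .
  have Dij: "((\<lambda>x. \<Omega> x $ i $ j) has_derivative (\<lambda>v. D x v $ i $ j)) (at x)" for x i j
    by (intro bounded_linear.has_derivative[OF bounded_linear_vec_nth] D)
  have skewD: "D x v $ i $ j = - D x v $ j $ i" for x v i j
  proof -
    have "((\<lambda>x. \<Omega> x $ i $ j) has_derivative (\<lambda>v. - D x v $ j $ i)) (at x)"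
      unfolding skew[of _ i j] by (intro has_derivative_minus Dij)
    then show ?thesis using has_derivative_unique[OF Dij] by metis
  qed
  have M: "M \<ge> 0"
  proof -
    have "0 \<le> M * (conf (0::real^'n))\<^sup>2"
      using bound[of 0 undefined undefined] abs_ge_zero order_trans by blast
    then show ?thesis using conf_pos[of "0::real^'n"] by (simp add: zero_le_mult_iff)
  qed
  define f where "f = (\<lambda>j (p :: (real^'n) \<times> real). snd p * (\<Sum>i\<in>UNIV. fst p $ i * \<Omega> (snd p *\<^sub>R fst p) $ i $ j))"
  have Cf: "C_on 1 UNIV (f j)" for j
  proof -
    have 1: "C_on 1 UNIV (\<lambda>p::(real^'n) \<times> real. fst p)" "C_on 1 UNIV (\<lambda>p::(real^'n) \<times> real. snd p)"
      by (rule C_on_linear[OF open_UNIV bounded_linear_fst C_on_ident[OF open_UNIV]],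
          rule C_on_linear[OF open_UNIV bounded_linear_snd C_on_ident[OF open_UNIV]])
    have 2: "C_on 1 UNIV (\<lambda>p::(real^'n) \<times> real. \<Omega> (snd p *\<^sub>R fst p))"
      by (rule C_on_compose[OF open_UNIV open_UNIV C C_on_scaleR[OF open_UNIV 1(2,1)]]) simp
    show ?thesis unfolding f_def
      by (rule C_on_mult[OF open_UNIV 1(2) C_on_sum[OF open_UNIV
            C_on_mult[OF open_UNIV C_on_vec_nth[OF open_UNIV 1(1)]
              C_on_vec_nth[OF open_UNIV C_on_vec_nth[OF open_UNIV 2]]]]])
  qed
  define \<alpha> where "\<alpha> = (\<lambda>j x. integral {0..1} (\<lambda>t. f j (x, t)))"
  define G where "G = (\<lambda>x j k t. frechet_derivative (f j) (at (x, t)) (axis k 1, 0))"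
  have G: "G x j k t = t * \<Omega> (t *\<^sub>R x) $ k $ j + t\<^sup>2 * (\<Sum>i\<in>UNIV. x $ i * D (t *\<^sub>R x) (axis k 1) $ i $ j)" for x j k t
  proof -
    have "((\<lambda>x. (x, t)) has_derivative (\<lambda>v. (v, 0))) (at x)"
      by (intro derivative_eq_intros) auto
    from has_derivative_compose[OF this C_on_1D(1)[OF Cf[of j]]]
    have 1: "((\<lambda>x. f j (x, t)) has_derivative (\<lambda>v. frechet_derivative (f j) (at (x, t)) (v, 0))) (at x)" by simp
    have "((\<lambda>x. t *\<^sub>R x) has_derivative (\<lambda>v. t *\<^sub>R v)) (at x)" by (intro derivative_eq_intros) auto
    from has_derivative_compose[OF this Dij]
    have 2: "((\<lambda>x. \<Omega> (t *\<^sub>R x) $ i $ j) has_derivative (\<lambda>v. D (t *\<^sub>R x) (t *\<^sub>R v) $ i $ j)) (at x)" for i .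
    have "((\<lambda>x. f j (x, t)) has_derivative (\<lambda>v. t * (\<Sum>i\<in>UNIV. x $ i * D (t *\<^sub>R x) (t *\<^sub>R v) $ i $ j + v $ i * \<Omega> (t *\<^sub>R x) $ i $ j))) (at x)"
      unfolding f_def fst_conv snd_conv
      by (intro has_derivative_mult_right has_derivative_sum has_derivative_mult 2
          bounded_linear_imp_has_derivative bounded_linear_vec_nth)
    from has_derivative_unique[OF 1 this]
    have "G x j k t = t * (\<Sum>i\<in>UNIV. x $ i * D (t *\<^sub>R x) (t *\<^sub>R axis k 1) $ i $ j + axis k 1 $ i * \<Omega> (t *\<^sub>R x) $ i $ j)"
      unfolding G_def by metis
    also have "\<dots> = t * (\<Sum>i\<in>UNIV. t * (x $ i * D (t *\<^sub>R x) (axis k 1) $ i $ j)) + t * (\<Sum>i\<in>UNIV. axis k 1 $ i * \<Omega> (t *\<^sub>R x) $ i $ j)"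
      by (simp add: linear_cmul[OF linD] sum.distrib ring_distribs mult_ac)
    also have "(\<Sum>i\<in>UNIV. axis k 1 $ i * \<Omega> (t *\<^sub>R x) $ i $ j) = \<Omega> (t *\<^sub>R x) $ k $ j"
      by (simp add: axis_def if_distrib[of "\<lambda>x. x * _"] cong: if_cong)
    finally show ?thesis by (simp add: sum_distrib_left[symmetric] power2_eq_square)
  qed
  have intG: "G x j k integrable_on {0..1}" for x j k
  proof -
    have "continuous_on {0..1} (\<lambda>t::real. (\<lambda>p. frechet_derivative (f j) (at p) (axis k 1, 0)) (x, t))"
      by (intro continuous_on_compose2[OF C_on_1D(2)[OF Cf]] continuous_intros) auto
    then show ?thesis unfolding G_def using integrable_continuous_real by blast
  qed
  have "(\<alpha> j has_derivative (\<lambda>v. integral {0..1} (\<lambda>t. frechet_derivative (f j) (at (x, t)) (v, 0)))) (at x)" for j x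
    unfolding \<alpha>_def by (rule C_on_integral_param(1)[OF Cf])
  then have D\<alpha>: "frechet_derivative (\<alpha> j) (at x) (axis k 1) = integral {0..1} (G x j k)" for j x k
    unfolding G_def by (metis frechet_derivative_at)
  show thesis
  proof (rule that)
    show "C_on 1 UNIV (\<alpha> j)" for j
      unfolding \<alpha>_def by (rule C_on_integral_param(2)[OF Cf])
    show "frechet_derivative (\<alpha> j) (at x) (axis k 1) - frechet_derivative (\<alpha> k) (at x) (axis j 1) = \<Omega> x $ k $ j" for x j k
    proof -
      \<comment> \<open>The antisymmetrised integrand is an exact t-derivative. The summand 0 gives
        the argument the form of a base point plus a multiple of a direction, as in
        \<open>has_derivative_line\<close>.\<close>
      have "((\<lambda>t. t\<^sup>2 * \<Omega> (0 + t *\<^sub>R x) $ k $ j) has_vector_derivative G x j k t - G x k j t) (at t within {0..1})" for t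
      proof -
        have sc: "(\<Sum>i\<in>UNIV. x $ i * D (t *\<^sub>R x) (axis k 1) $ i $ j) - (\<Sum>i\<in>UNIV. x $ i * D (t *\<^sub>R x) (axis j 1) $ i $ k)
            = D (t *\<^sub>R x) x $ k $ j"
        proof -
          have "D (t *\<^sub>R x) x $ k $ j = (\<Sum>i\<in>UNIV. x $ i * D (t *\<^sub>R x) (axis i 1) $ k $ j)"
            by (subst linear_axis_sum[OF linD]) (simp add: sum_component)
          also have "\<dots> = (\<Sum>i\<in>UNIV. x $ i * D (t *\<^sub>R x) (axis k 1) $ i $ j - x $ i * D (t *\<^sub>R x) (axis j 1) $ i $ k)"
          proof (rule sum.cong[OF refl])
            fix i
            have "D (t *\<^sub>R x) (axis i 1) $ k $ j = D (t *\<^sub>R x) (axis k 1) $ i $ j - D (t *\<^sub>R x) (axis j 1) $ i $ k"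
              using cl[where i=i and j=k and k=j and x="t *\<^sub>R x"]
                skewD[where x="t *\<^sub>R x" and v="axis k 1" and i=i and j=j] by linarith
            then show "x $ i * D (t *\<^sub>R x) (axis i 1) $ k $ j
              = x $ i * D (t *\<^sub>R x) (axis k 1) $ i $ j - x $ i * D (t *\<^sub>R x) (axis j 1) $ i $ k"
              by (simp add: right_diff_distrib)
          qed
          finally show ?thesis by (simp add: sum_subtractf)
        qed
        have sk: "\<Omega> (t *\<^sub>R x) $ j $ k = - \<Omega> (t *\<^sub>R x) $ k $ j" by (rule skew)
        have "((\<lambda>t. \<Omega> (0 + t *\<^sub>R x) $ k $ j) has_vector_derivative D (0 + t *\<^sub>R x) x $ k $ j) (at t)"
          by (rule has_derivative_line[OF Dij])
        then have 1: "((\<lambda>t. \<Omega> (0 + t *\<^sub>R x) $ k $ j) has_real_derivative D (t *\<^sub>R x) x $ k $ j) (at t)"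
          by (simp add: has_real_derivative_iff_has_vector_derivative)
        have 2: "((\<lambda>t. t\<^sup>2) has_real_derivative 2 * t) (at t)"
          by (auto intro!: derivative_eq_intros)
        have "G x j k t - G x k j t = 2 * t * \<Omega> (0 + t *\<^sub>R x) $ k $ j + D (t *\<^sub>R x) x $ k $ j * t\<^sup>2"
          unfolding G sc[symmetric] sk by (simp add: algebra_simps)
        then show ?thesis
          using DERIV_mult[OF 2 1] has_vector_derivative_at_within
          by (auto simp: has_real_derivative_iff_has_vector_derivative)
      qed
      then have "((\<lambda>t. G x j k t - G x k j t) has_integral (1\<^sup>2 * \<Omega> (0 + 1 *\<^sub>R x) $ k $ j - 0\<^sup>2 * \<Omega> (0 + 0 *\<^sub>R x) $ k $ j)) {0..1}"
        by (intro fundamental_theorem_of_calculus) auto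
      then have "integral {0..1} (\<lambda>t. G x j k t - G x k j t) = \<Omega> x $ k $ j"
        by (simp add: integral_unique)
      then show ?thesis by (simp add: D\<alpha> integral_diff[OF intG intG])
    qed
    show "\<bar>\<alpha> j x\<bar> \<le> CARD('n) * M * norm x * conf x" for x j
    proof -
      have hi: "((\<lambda>t. CARD('n) * M * norm x * (t * (conf (t *\<^sub>R x))\<^sup>2)) has_integral CARD('n) * M * norm x * conf x) {0..1}"
        by (rule has_integral_mult_right[OF integral_conf_squared])
      have "norm (integral {0..1} (\<lambda>t. f j (x, t))) \<le> integral {0..1} (\<lambda>t. CARD('n) * M * norm x * (t * (conf (t *\<^sub>R x))\<^sup>2))"
      proof (rule integral_norm_bound_integral)
        show "(\<lambda>t. f j (x, t)) integrable_on {0..1}"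
          by (intro integrable_continuous_real continuous_on_compose2[OF C_on_imp_continuous_on[OF Cf]] continuous_intros) auto
        show "(\<lambda>t. CARD('n) * M * norm x * (t * (conf (t *\<^sub>R x))\<^sup>2)) integrable_on {0..1}"
          using hi by blast
        fix t :: real assume t: "t \<in> {0..1}"
        have "\<bar>\<Sum>i\<in>UNIV. x $ i * \<Omega> (t *\<^sub>R x) $ i $ j\<bar> \<le> (\<Sum>i\<in>(UNIV::'n set). norm x * (M * (conf (t *\<^sub>R x))\<^sup>2))"
          by (rule order_trans[OF sum_abs sum_mono])
            (auto simp: abs_mult intro!: mult_mono component_le_norm_cart bound)
        also have "\<dots> = CARD('n) * M * norm x * (conf (t *\<^sub>R x))\<^sup>2" by simp
        finally have "t * \<bar>\<Sum>i\<in>UNIV. x $ i * \<Omega> (t *\<^sub>R x) $ i $ j\<bar> \<le> t * (CARD('n) * M * norm x * (conf (t *\<^sub>R x))\<^sup>2)"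
          using t by (intro mult_left_mono) auto
        then show "norm (f j (x, t)) \<le> CARD('n) * M * norm x * (t * (conf (t *\<^sub>R x))\<^sup>2)"
          using t by (simp add: f_def abs_mult mult_ac)
      qed
      then show ?thesis unfolding integral_unique[OF hi] by (simp add: \<alpha>_def)
    qed
  qed
qed

section \<open>The Liouville field and its size\<close>

lemma abs_det_le:
  fixes A :: "real^'n^'n"
  assumes "\<And>i j. \<bar>A $ i $ j\<bar> \<le> b"
  shows "\<bar>det A\<bar> \<le> fact CARD('n) * b ^ CARD('n)"
proof -
  have "\<bar>det A\<bar> \<le> (\<Sum>p\<in>{p. p permutes (UNIV :: 'n set)}. \<bar>of_int (sign p) * (\<Prod>i\<in>UNIV. A $ i $ p i)\<bar>)"
    unfolding det_def by (rule sum_abs)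
  also have "\<dots> \<le> (\<Sum>p\<in>{p. p permutes (UNIV :: 'n set)}. b ^ CARD('n))"
  proof (rule sum_mono)
    fix p
    have "\<bar>of_int (sign p) * (\<Prod>i\<in>UNIV. A $ i $ p i)\<bar> = (\<Prod>i\<in>UNIV. \<bar>A $ i $ p i\<bar>)"
      by (simp add: abs_mult abs_prod sign_def)
    also have "\<dots> \<le> (\<Prod>i\<in>(UNIV::'n set). b)"
      by (rule prod_mono) (use assms in auto)
    finally show "\<bar>of_int (sign p) * (\<Prod>i\<in>UNIV. A $ i $ p i)\<bar> \<le> b ^ CARD('n)" by simp
  qed
  also have "\<dots> = fact CARD('n) * b ^ CARD('n)"
    by (simp add: card_permutations)
  finally show ?thesis .
qed

lemma has_derivative_density:
  fixes \<Omega> :: "real^'n \<Rightarrow> real^'n^'n"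
  assumes D: "(\<Omega> has_derivative D) (at x)" and W: "W ** \<Omega> x = mat 1"
  shows "((\<lambda>y. sqrt \<bar>det (\<Omega> y)\<bar>) has_derivative (\<lambda>v. sqrt \<bar>det (\<Omega> x)\<bar> / 2 * trace (W ** D v))) (at x)"
proof -
  have nz: "det (\<Omega> x) \<noteq> 0"
    using W invertible_det_nz invertible_left_inverse by blast
  have "((\<lambda>y. \<Omega> y $ i $ j) has_derivative (\<lambda>v. D v $ i $ j)) (at x)" for i j
    by (intro bounded_linear.has_derivative[OF bounded_linear_vec_nth] D)
  from has_derivative_det[OF this W]
  have 1: "((\<lambda>y. det (\<Omega> y)) has_derivative (\<lambda>v. det (\<Omega> x) * trace (W ** D v))) (at x)" .
  have 2: "((\<lambda>t. sqrt \<bar>t\<bar>) has_derivative (*) (sqrt \<bar>det (\<Omega> x)\<bar> / (2 * det (\<Omega> x)))) (at (det (\<Omega> x)))"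
    using has_real_derivative_sqrt_abs[OF nz] unfolding has_field_derivative_def .
  have "((\<lambda>y. sqrt \<bar>det (\<Omega> y)\<bar>) has_derivative
     (\<lambda>v. sqrt \<bar>det (\<Omega> x)\<bar> / (2 * det (\<Omega> x)) * (det (\<Omega> x) * trace (W ** D v)))) (at x)"
    using has_derivative_compose[OF 1 2] .
  then show ?thesis using nz by simp
qed

text \<open>\<open>X\<close> solves \<iota>_X \<Omega> = \<alpha>, and \<open>Z\<close> is \<rho> X
  with \<rho> = sqrt |det \<Omega>|. With N = CARD('n), \<open>trace_Liouville\<close> turns into
  div (\<rho> X) = (N/2) \<rho>. The bound on \<open>Z\<close> combines |X| = O(|x| / conf) with
  \<rho> = O(conf^N).\<close>

lemma Liouville_field:
  fixes \<Omega> :: "real^'n \<Rightarrow> real^'n^'n" and M :: real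
  assumes C: "C_on 1 UNIV \<Omega>"
    and skew: "\<And>x i j. \<Omega> x $ i $ j = - \<Omega> x $ j $ i"
    and closed: "\<And>x i j k. frechet_derivative \<Omega> (at x) (axis i 1) $ j $ k
       + frechet_derivative \<Omega> (at x) (axis j 1) $ k $ i + frechet_derivative \<Omega> (at x) (axis k 1) $ i $ j = 0"
    and bound: "\<And>x i j. \<bar>\<Omega> x $ i $ j\<bar> \<le> M * (conf x)\<^sup>2"
    and lower: "\<And>x v. (conf x)\<^sup>2 * norm v \<le> norm (\<Omega> x *v v)"
  obtains Z :: "'n \<Rightarrow> real^'n \<Rightarrow> real" and \<rho> :: "real^'n \<Rightarrow> real" and K :: real
  where "\<And>k. C_on 1 UNIV (Z k)" "continuous_on UNIV \<rho>" "\<And>x. \<rho> x > 0"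
    "\<And>x. (\<Sum>k\<in>UNIV. frechet_derivative (Z k) (at x) (axis k 1)) = CARD('n) / 2 * \<rho> x"
    "\<And>k x. \<bar>Z k x\<bar> \<le> K * (norm x * (conf x) ^ (CARD('n) - 1))"
proof -
  let ?n = "CARD('n)"
  obtain \<alpha> :: "'n \<Rightarrow> real^'n \<Rightarrow> real" where \<alpha>: "\<And>j. C_on 1 UNIV (\<alpha> j)"
    "\<And>x j k. frechet_derivative (\<alpha> j) (at x) (axis k 1) - frechet_derivative (\<alpha> k) (at x) (axis j 1) = \<Omega> x $ k $ j"
    "\<And>x j. \<bar>\<alpha> j x\<bar> \<le> ?n * M * norm x * conf x"
    using Poincare_lemma[OF C skew closed bound] by blast
  define D where "D = (\<lambda>x. frechet_derivative \<Omega> (at x))"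
  have D: "(\<Omega> has_derivative D x) (at x)" for x
    using C_on_1D(1)[OF C] by (simp add: D_def)
  have cl: "D x (axis i 1) $ j $ k + D x (axis j 1) $ k $ i + D x (axis k 1) $ i $ j = 0" for x i j k
    unfolding D_def by (rule closed)
  have Dij: "((\<lambda>x. \<Omega> x $ i $ j) has_derivative (\<lambda>v. D x v $ i $ j)) (at x)" for x i j
    by (intro bounded_linear.has_derivative[OF bounded_linear_vec_nth] D)
  have skewD: "D x v $ i $ j = - D x v $ j $ i" for x v i j
  proof -
    have "((\<lambda>x. \<Omega> x $ i $ j) has_derivative (\<lambda>v. - D x v $ j $ i)) (at x)"
      unfolding skew[of _ i j] by (intro has_derivative_minus Dij)
    then show ?thesis using has_derivative_unique[OF Dij] by metis
  qed
  have M: "M \<ge> 0"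
  proof -
    have "0 \<le> M * (conf (0::real^'n))\<^sup>2"
      using bound[of 0 undefined undefined] abs_ge_zero order_trans by blast
    then show ?thesis using conf_pos[of "0::real^'n"] by (simp add: zero_le_mult_iff)
  qed
  have "inj ((*v) (\<Omega> x))" for x
  proof (rule linear_injective_0[THEN iffD2, rule_format])
    fix v assume "\<Omega> x *v v = 0"
    then have "(conf x)\<^sup>2 * norm v \<le> 0" using lower[of x v] by simp
    then show "v = 0" using conf_pos[of x] by (simp add: mult_le_0_iff)
  qed simp
  then have "\<exists>W. W ** \<Omega> x = mat 1" for x
    using matrix_left_invertible_injective by blast
  then obtain W where W: "\<And>x. W x ** \<Omega> x = mat 1" by metis
  have nz: "det (\<Omega> x) \<noteq> 0" for x
    using W invertible_det_nz invertible_left_inverse by blast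
  \<comment> \<open>Cramer's rule shows that \<open>X\<close> is of class C^1, being a quotient of
    polynomials in \<alpha> and \<Omega>; the inverses \<open>W x\<close> are only chosen
    pointwise.\<close>
  define X where "X = (\<lambda>k x. det (\<chi> i j. if j = k then \<alpha> i x else \<Omega> x $ j $ i) / det (\<Omega> x))"
  have X: "(\<Sum>i\<in>UNIV. \<Omega> x $ i $ j * X i x) = \<alpha> j x" for x j
  proof -
    have d: "det (transpose (\<Omega> x)) \<noteq> 0" using nz by (simp add: det_transpose)
    have "transpose (\<Omega> x) *v (\<chi> k. X k x) = (\<chi> i. \<alpha> i x)"
      unfolding cramer[OF d] by (simp add: X_def det_transpose) (simp add: transpose_def cong: if_cong)
    then show ?thesis by (simp add: vec_eq_iff matrix_vector_mult_def transpose_def)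
  qed
  have COij: "C_on 1 UNIV (\<lambda>x. \<Omega> x $ i $ j)" for i j
    by (rule C_on_vec_nth[OF open_UNIV C_on_vec_nth[OF open_UNIV C]])
  have Cdet: "C_on 1 UNIV (\<lambda>x. det (\<Omega> x))" by (rule C_on_det[OF open_UNIV COij])
  have CX: "C_on 1 UNIV (X k)" for k
  proof -
    have "C_on 1 UNIV (\<lambda>x. det (\<chi> i j. if j = k then \<alpha> i x else \<Omega> x $ j $ i))"
    proof (rule C_on_det[OF open_UNIV])
      fix i j
      show "C_on 1 UNIV (\<lambda>x. (\<chi> i j. if j = k then \<alpha> i x else \<Omega> x $ j $ i) $ i $ j)"
        by (cases "j = k") (simp_all del: C_on.simps One_nat_def add: \<alpha>(1) COij)
    qed
    then show ?thesis unfolding X_def by (rule C_on_divide[OF open_UNIV _ Cdet nz])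
  qed
  define \<rho> where "\<rho> = (\<lambda>x. sqrt \<bar>det (\<Omega> x)\<bar>)"
  have C\<rho>: "C_on 1 UNIV \<rho>" unfolding \<rho>_def by (rule C_on_sqrt_abs[OF open_UNIV Cdet nz])
  have \<rho>pos: "\<rho> x > 0" for x using nz[of x] by (simp add: \<rho>_def)
  define DX where "DX = (\<lambda>x k. frechet_derivative (X k) (at x))"
  have DX: "(X k has_derivative DX x k) (at x)" for k x
    unfolding DX_def by (rule C_on_1D(1)[OF CX]) simp
  have D\<alpha>: "(\<alpha> k has_derivative frechet_derivative (\<alpha> k) (at x)) (at x)" for k x
    by (rule C_on_1D(1)[OF \<alpha>(1)]) simp
  have D\<rho>: "(\<rho> has_derivative (\<lambda>v. \<rho> x / 2 * trace (W x ** D x v))) (at x)" for x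
    unfolding \<rho>_def by (rule has_derivative_density[OF D W])
  have XDX: "(\<Sum>i\<in>UNIV. \<Omega> x $ i $ j * DX x i v + D x v $ i $ j * X i x) = frechet_derivative (\<alpha> j) (at x) v" for x j v
  proof -
    have "((\<lambda>x. \<Sum>i\<in>UNIV. \<Omega> x $ i $ j * X i x) has_derivative
        (\<lambda>v. \<Sum>i\<in>UNIV. \<Omega> x $ i $ j * DX x i v + D x v $ i $ j * X i x)) (at x)"
      by (intro has_derivative_sum has_derivative_mult Dij DX)
    then have "(\<lambda>v. \<Sum>i\<in>UNIV. \<Omega> x $ i $ j * DX x i v + D x v $ i $ j * X i x) = frechet_derivative (\<alpha> j) (at x)"
      unfolding X by (rule has_derivative_unique[OF _ D\<alpha>])
    then show ?thesis by (rule fun_cong)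
  qed
  have tr: "trace (W x ** D x (\<chi> i. X i x)) + 2 * (\<Sum>i\<in>UNIV. DX x i (axis i 1)) = ?n" for x
  proof -
    let ?D\<alpha> = "\<chi> k j. frechet_derivative (\<alpha> j) (at x) (axis k 1)" and ?DX = "\<chi> k i. DX x i (axis k 1)"
    have "trace (W x ** D x (\<chi> i. X i x)) + 2 * (\<Sum>i\<in>UNIV. ?DX $ i $ i) = ?n"
    proof (rule trace_Liouville[OF skew W has_derivative_linear[OF D] cl skewD])
      show "?D\<alpha> $ k $ j - ?D\<alpha> $ j $ k = \<Omega> x $ k $ j" for k j using \<alpha>(2) by simp
      show "(\<Sum>i\<in>UNIV. ?DX $ k $ i * \<Omega> x $ i $ j + (\<chi> i. X i x) $ i * D x (axis k 1) $ i $ j) = ?D\<alpha> $ k $ j" for k j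
        unfolding vec_lambda_beta XDX[symmetric] by (simp add: mult.commute)
    qed
    then show ?thesis by simp
  qed
  define Z where "Z = (\<lambda>k x. \<rho> x * X k x)"
  have CZ: "C_on 1 UNIV (Z k)" for k unfolding Z_def by (rule C_on_mult[OF open_UNIV C\<rho> CX])
  have divZ: "(\<Sum>k\<in>UNIV. frechet_derivative (Z k) (at x) (axis k 1)) = ?n / 2 * \<rho> x" for x
  proof -
    have "(Z k has_derivative (\<lambda>v. \<rho> x * DX x k v + \<rho> x / 2 * trace (W x ** D x v) * X k x)) (at x)" for k
      unfolding Z_def by (rule has_derivative_mult[OF D\<rho> DX])
    then have "frechet_derivative (Z k) (at x) = (\<lambda>v. \<rho> x * DX x k v + \<rho> x / 2 * trace (W x ** D x v) * X k x)" for k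
      by (simp add: frechet_derivative_at[symmetric])
    then have "(\<Sum>k\<in>UNIV. frechet_derivative (Z k) (at x) (axis k 1))
      = \<rho> x * (\<Sum>k\<in>UNIV. DX x k (axis k 1)) + (\<Sum>k\<in>UNIV. X k x * (\<rho> x / 2 * trace (W x ** D x (axis k 1))))"
      by (simp add: sum.distrib sum_distrib_left mult_ac)
    also have "(\<Sum>k\<in>UNIV. X k x * (\<rho> x / 2 * trace (W x ** D x (axis k 1)))) = \<rho> x / 2 * trace (W x ** D x (\<chi> i. X i x))"
      using linear_axis_sum[OF has_derivative_linear[OF D\<rho>], of x "\<chi> i. X i x"] by simp
    also have "\<rho> x * (\<Sum>k\<in>UNIV. DX x k (axis k 1)) + \<rho> x / 2 * trace (W x ** D x (\<chi> i. X i x))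
      = \<rho> x / 2 * (trace (W x ** D x (\<chi> i. X i x)) + 2 * (\<Sum>k\<in>UNIV. DX x k (axis k 1)))"
      by (simp add: algebra_simps)
    finally show ?thesis unfolding tr by simp
  qed
  \<comment> \<open>From conf^2 |X| \<le> |\<Omega> X| = |\<alpha>|, where the l1-norm of \<alpha>
    is at most N times its bound from \<open>Poincare_lemma\<close>; one factor
    \<open>conf x\<close> cancels.\<close>
  have Xb: "\<bar>X k x\<bar> * conf x \<le> ?n * (?n * M * norm x)" for k x
  proof -
    have "(\<Sum>i\<in>UNIV. \<Omega> x $ j $ i * X i x) = - \<alpha> j x" for j
    proof -
      have "(\<Sum>i\<in>UNIV. \<Omega> x $ j $ i * X i x) = (\<Sum>i\<in>UNIV. - (\<Omega> x $ i $ j * X i x))"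
      proof (rule sum.cong[OF refl])
        show "\<Omega> x $ j $ i * X i x = - (\<Omega> x $ i $ j * X i x)" for i
          by (subst skew) simp
      qed
      then show ?thesis by (simp only: sum_negf X)
    qed
    then have "\<Omega> x *v (\<chi> i. X i x) = - (\<chi> j. \<alpha> j x)"
      by (simp add: vec_eq_iff matrix_vector_mult_def)
    then have "(conf x)\<^sup>2 * norm (\<chi> i. X i x) \<le> norm (\<chi> j. \<alpha> j x)" using lower[of x "\<chi> i. X i x"] by simp
    also have "\<dots> \<le> (\<Sum>j\<in>UNIV. \<bar>\<alpha> j x\<bar>)" using norm_le_l1_cart[of "\<chi> j. \<alpha> j x"] by simp
    also have "\<dots> \<le> (\<Sum>j\<in>(UNIV::'n set). ?n * M * norm x * conf x)" by (rule sum_mono) (rule \<alpha>(3))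
    also have "\<dots> = conf x * (?n * (?n * M * norm x))" by simp
    finally have *: "conf x * norm (\<chi> i. X i x) \<le> ?n * (?n * M * norm x)"
      using conf_pos[of x] by (simp add: power2_eq_square mult.assoc)
    have "\<bar>X k x\<bar> \<le> norm (\<chi> i. X i x)" using component_le_norm_cart[of "\<chi> i. X i x" k] by simp
    then have "conf x * \<bar>X k x\<bar> \<le> conf x * norm (\<chi> i. X i x)"
      by (rule mult_left_mono) (use conf_pos[of x] in simp)
    then show ?thesis unfolding mult.commute[of "\<bar>X k x\<bar>"] using * by (rule order_trans)
  qed
  \<comment> \<open>The determinant has N! terms, each at most (M conf^2)^N; the root of this is
    \<open>c\<close> times conf^N.\<close>
  define c where "c = sqrt (fact ?n * M ^ ?n)"
  have c: "c \<ge> 0" using M by (simp add: c_def)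
  have \<rho>b: "\<rho> x \<le> c * (conf x) ^ ?n" for x
  proof -
    have "\<bar>det (\<Omega> x)\<bar> \<le> fact ?n * (M * (conf x)\<^sup>2) ^ ?n" by (rule abs_det_le) (rule bound)
    also have "\<dots> = fact ?n * M ^ ?n * ((conf x) ^ ?n)\<^sup>2"
      by (simp add: power_mult_distrib power_mult[symmetric] mult.commute)
    finally have "\<rho> x \<le> sqrt (fact ?n * M ^ ?n * ((conf x) ^ ?n)\<^sup>2)"
      unfolding \<rho>_def by (rule real_sqrt_le_mono)
    also have "\<dots> = c * (conf x) ^ ?n" unfolding c_def real_sqrt_mult using conf_pos[of x] by simp
    finally show ?thesis .
  qed
  have Zb: "\<bar>Z k x\<bar> \<le> c * (?n * (?n * M)) * (norm x * (conf x) ^ (?n - 1))" for k x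
  proof -
    have "\<bar>Z k x\<bar> = \<rho> x * \<bar>X k x\<bar>" using \<rho>pos[of x] by (simp add: Z_def abs_mult)
    also have "\<dots> \<le> (c * (conf x) ^ ?n) * \<bar>X k x\<bar>" by (rule mult_right_mono[OF \<rho>b]) simp
    also have "(conf x) ^ ?n = (conf x) ^ (?n - 1) * conf x"
      by (metis Suc_diff_1 power_Suc2 zero_less_card_finite)
    also have "(c * ((conf x) ^ (?n - 1) * conf x)) * \<bar>X k x\<bar> = (c * (conf x) ^ (?n - 1)) * (\<bar>X k x\<bar> * conf x)" by simp
    also have "\<dots> \<le> (c * (conf x) ^ (?n - 1)) * (?n * (?n * M * norm x))"
      by (rule mult_left_mono[OF Xb]) (use c conf_pos[of x] in simp)
    finally show ?thesis by (simp add: mult_ac)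
  qed
  show thesis
    by (rule that[OF CZ C_on_imp_continuous_on[OF C\<rho>] \<rho>pos divZ Zb])
qed

section \<open>Cutoff functions and the flux at infinity\<close>

text \<open>Squaring removes the corner of the positive part at 0, which makes it a building block
  for C^1 cutoffs.\<close>

lemma has_real_derivative_pos_part_squared:
  "((\<lambda>t. (max 0 t)\<^sup>2) has_real_derivative 2 * max 0 t) (at t)"
proof -
  consider "t > 0" | "t < 0" | "t = 0" by linarith
  then show ?thesis
  proof cases
    case 1
    have "((\<lambda>t. t\<^sup>2) has_real_derivative 2 * max 0 t) (at t)"
      using 1 by (auto intro!: derivative_eq_intros)
    moreover have "\<forall>\<^sub>F s in nhds t. s\<^sup>2 = (max 0 s)\<^sup>2"
      using eventually_nhds_in_open[of "{0<..}" t] 1 by (auto elim!: eventually_mono)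
    ultimately show ?thesis by (subst (asm) DERIV_cong_ev) auto
  next
    case 2
    have "((\<lambda>t. 0) has_real_derivative 2 * max 0 t) (at t)" using 2 by simp
    moreover have "\<forall>\<^sub>F s in nhds t. 0 = (max 0 s)\<^sup>2"
      using eventually_nhds_in_open[of "{..<0}" t] 2 by (auto elim!: eventually_mono)
    ultimately show ?thesis by (subst (asm) DERIV_cong_ev) auto
  next
    case 3
    have "((\<lambda>h. max 0 h) \<longlongrightarrow> max 0 (0::real)) (at 0)" by (intro tendsto_intros)
    then have lim: "((\<lambda>h. max 0 h) \<longlongrightarrow> 2 * max 0 (0::real)) (at 0)" unfolding max.idem mult_zero_right .
    have "\<forall>\<^sub>F h in at 0. max 0 h = ((max 0 h)\<^sup>2 - (max 0 0)\<^sup>2) / (h - 0 :: real)"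
      by (rule always_eventually) (auto simp: max_def power2_eq_square)
    then show ?thesis unfolding 3 has_field_derivative_iff by (rule Lim_transform_eventually[OF lim])
  qed
qed

text \<open>A piecewise polynomial step from 1 on s \<le> 1 down to 0 on s \<ge> 2; each of the two
  squared positive parts smooths one end to class C^1.\<close>

definition cutoff :: "real \<Rightarrow> real" where
  "cutoff s = (max 0 (1 - (max 0 (s - 1))\<^sup>2))\<^sup>2"

definition cutoff' :: "real \<Rightarrow> real" where
  "cutoff' s = - 4 * max 0 (1 - (max 0 (s - 1))\<^sup>2) * max 0 (s - 1)"

lemma cutoff_deriv: "(cutoff has_real_derivative cutoff' s) (at s)"
proof -
  have 1: "((\<lambda>s. (max 0 (s - 1))\<^sup>2) has_real_derivative 2 * max 0 (s - 1) * 1) (at s)"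
    by (rule DERIV_chain2[OF has_real_derivative_pos_part_squared]) (auto intro!: derivative_eq_intros)
  have 2: "((\<lambda>s. 1 - (max 0 (s - 1))\<^sup>2) has_real_derivative (0 - 2 * max 0 (s - 1) * 1)) (at s)"
    by (intro DERIV_diff DERIV_const 1)
  show ?thesis
    unfolding cutoff_def[abs_def] cutoff'_def
    using DERIV_chain2[OF has_real_derivative_pos_part_squared 2] by (simp add: algebra_simps)
qed

lemma cutoff_bounds: "0 \<le> cutoff s" "s \<le> 1 \<Longrightarrow> cutoff s = 1" "s \<ge> 2 \<Longrightarrow> cutoff s = 0"
proof -
  show "s \<ge> 2 \<Longrightarrow> cutoff s = 0"
    using power_mono[of 1 "s - 1" 2] by (simp add: cutoff_def)
qed (auto simp: cutoff_def)

lemma cutoff'_bounds: "\<bar>cutoff' s\<bar> \<le> 4" "s \<notin> {1..2} \<Longrightarrow> cutoff' s = 0"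
proof -
  have 2: "cutoff' s = 0" if "s \<ge> 2" for s
    using power_mono[of 1 "s - 1" 2] that by (simp add: cutoff'_def)
  then show "s \<notin> {1..2} \<Longrightarrow> cutoff' s = 0"
    by (cases "s \<ge> 2") (auto simp: cutoff'_def)
  show "\<bar>cutoff' s\<bar> \<le> 4"
  proof (cases "s \<ge> 2")
    case False
    have "\<bar>max 0 (1 - (max 0 (s - 1))\<^sup>2)\<bar> * \<bar>max 0 (s - 1)\<bar> \<le> 1 * 1"
      by (rule mult_mono) (use False in \<open>auto simp: max_def\<close>)
    then show ?thesis by (simp add: cutoff'_def abs_mult)
  qed (simp add: 2)
qed

lemma C_on_cutoff: "C_on 1 UNIV cutoff"
proof (rule C_on_1I[OF open_UNIV])
  show "(cutoff has_derivative (\<lambda>v. cutoff' s * v)) (at s)" for s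
    using cutoff_deriv[of s] unfolding has_field_derivative_def .
  show "continuous_on UNIV (\<lambda>s. cutoff' s * v)" for v
    unfolding cutoff'_def by (intro continuous_intros)
qed

text \<open>The integral of div (\<eta> Z) vanishes for a cutoff \<eta> at radius R. The part \<eta>
  div Z contributes at least a fixed positive amount from the unit ball, while the part d\<eta>(Z)
  is O(R^(2-N)) with N = CARD('n). For large R these are incompatible.\<close>

lemma no_expanding_field:
  fixes Z :: "'n::finite \<Rightarrow> real^'n \<Rightarrow> real"
  assumes C: "\<And>k. C_on 1 UNIV (Z k)" and \<rho>: "continuous_on UNIV \<rho>" "\<And>x. \<rho> x > 0"
    and div: "\<And>x. (\<Sum>k\<in>UNIV. frechet_derivative (Z k) (at x) (axis k 1)) = CARD('n) / 2 * \<rho> x"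
    and bound: "\<And>k x. \<bar>Z k x\<bar> \<le> K * (norm x * (conf x) ^ (CARD('n) - 1))"
    and n: "CARD('n) \<ge> 3"
  shows False
proof -
  let ?n = "CARD('n)"
  let ?V = "measure lborel (ball (0::real^'n) 1)"
  have V: "?V > 0" by (rule content_ball_pos) simp
  define B where "B = max K 0"
  have Zb: "\<bar>Z k x\<bar> \<le> B * (norm x * (conf x) ^ (?n - 1))" for k x
    using bound[of k x] mult_right_mono[of K B "norm x * (conf x) ^ (?n - 1)"] conf_pos[of x]
    by (simp add: B_def)
  have B: "B \<ge> 0" by (simp add: B_def)
  obtain x0 where x0: "x0 \<in> cball (0::real^'n) 1" "\<And>x. x \<in> cball 0 1 \<Longrightarrow> \<rho> x0 \<le> \<rho> x"
    using continuous_attains_inf[OF compact_cball _ continuous_on_subset[OF \<rho>(1) subset_UNIV], of "0::real^'n" 1] by auto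
  define m where "m = \<rho> x0"
  have m: "m > 0" using \<rho>(2) by (simp add: m_def)
  \<comment> \<open>16 = 4 * 2 * 2: the bound of \<open>cutoff'\<close>, the derivative of x
    \<bullet> x, and |x|^2 / R^2 \<le> 2 on the transition shell. The sum over \<open>k\<close>
    gives CARD('n), and conf \<le> 2 / R^2 gives the power of 2.\<close>
  define c where "c = 16 * ?n * B * 2 ^ (?n - 1)"
  have c: "c \<ge> 0" using B by (simp add: c_def)
  have main: "?n / 2 * m \<le> c * 2 ^ ?n / R" if R: "R \<ge> 1" for R :: real
  proof -
    \<comment> \<open>The squared norm keeps \<eta> differentiable at the origin; \<eta> varies only
      for R \<le> |x| \<le> sqrt 2 R.\<close>
    define \<eta> where "\<eta> = (\<lambda>x::real^'n. cutoff ((x \<bullet> x) / R\<^sup>2))"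
    define D\<eta> where "D\<eta> = (\<lambda>(x::real^'n) v. cutoff' ((x \<bullet> x) / R\<^sup>2) * (2 * (x \<bullet> v) / R\<^sup>2))"
    have Cq: "C_on 1 UNIV (\<lambda>x::real^'n. (x \<bullet> x) / R\<^sup>2)"
      by (rule C_on_divide[OF open_UNIV C_on_inner[OF open_UNIV C_on_ident[OF open_UNIV] C_on_ident[OF open_UNIV]] C_on_const])
        (use R in auto)
    have C\<eta>: "C_on 1 UNIV \<eta>"
      unfolding \<eta>_def by (rule C_on_compose[OF open_UNIV open_UNIV C_on_cutoff Cq]) simp
    have \<eta>D: "(\<eta> has_derivative D\<eta> x) (at x)" for x
    proof -
      have 1: "((\<lambda>x::real^'n. (x \<bullet> x) / R\<^sup>2) has_derivative (\<lambda>v. 2 * (x \<bullet> v) / R\<^sup>2)) (at x)"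
      proof (rule bounded_linear.has_derivative[OF bounded_linear_divide])
        show "((\<lambda>x::real^'n. x \<bullet> x) has_derivative (\<lambda>v. 2 * (x \<bullet> v))) (at x)"
          by (auto intro!: derivative_eq_intros simp: inner_commute)
      qed
      have 2: "(cutoff has_derivative (*) (cutoff' ((x \<bullet> x) / R\<^sup>2))) (at ((x \<bullet> x) / R\<^sup>2))"
        using cutoff_deriv unfolding has_field_derivative_def .
      show ?thesis unfolding \<eta>_def D\<eta>_def by (rule has_derivative_compose[OF 1 2])
    qed
    define F where "F = (\<lambda>k x. \<eta> x * Z k x)"
    have CF: "C_on 1 UNIV (F k)" for k
      unfolding F_def by (rule C_on_mult[OF open_UNIV C\<eta> C])
    have supp: "\<eta> x = 0" if "norm x > 2 * R" for x
    proof -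
      have "(2 * R)\<^sup>2 \<le> x \<bullet> x" unfolding power2_norm_eq_inner[symmetric]
        using that R by (intro power_mono) auto
      moreover have "2 * R\<^sup>2 \<le> (2 * R)\<^sup>2" by (simp add: power_mult_distrib)
      ultimately have "2 * R\<^sup>2 \<le> x \<bullet> x" by linarith
      then have "2 \<le> (x \<bullet> x) / R\<^sup>2" using R by (simp add: pos_le_divide_eq)
      then show ?thesis unfolding \<eta>_def by (rule cutoff_bounds(3))
    qed
    have suppF: "F k x = 0" if "norm x > 2 * R" for k x using supp[OF that] by (simp add: F_def)
    define S where "S = (\<lambda>x. \<Sum>k\<in>UNIV. frechet_derivative (F k) (at x) (axis k 1))"
    have intS: "integrable lborel S" and S0: "(\<integral>x. S x \<partial>lborel) = 0"
      unfolding S_def using integral_derivative_compact_support[OF CF suppF] by simp_all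
    define E where "E = (\<lambda>x. \<Sum>k\<in>UNIV. D\<eta> x (axis k 1) * Z k x)"
    have S: "S x = \<eta> x * (?n / 2 * \<rho> x) + E x" for x
    proof -
      have "(F k has_derivative (\<lambda>v. \<eta> x * frechet_derivative (Z k) (at x) v + D\<eta> x v * Z k x)) (at x)" for k
        unfolding F_def by (intro has_derivative_mult \<eta>D C_on_1D(1)[OF C] UNIV_I)
      then have "frechet_derivative (F k) (at x) = (\<lambda>v. \<eta> x * frechet_derivative (Z k) (at x) v + D\<eta> x v * Z k x)" for k
        using frechet_derivative_at by metis
      then show ?thesis unfolding S_def E_def div[symmetric]
        by (simp add: sum.distrib sum_distrib_left)
    qed
    define w where "w = c / R ^ (2 * (?n - 1))"
    have w: "w \<ge> 0" using c R by (simp add: w_def)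
    have Eb: "\<bar>E x\<bar> \<le> w * indicator (cball 0 (2 * R)) x" for x
    proof (cases "(x \<bullet> x) / R\<^sup>2 \<in> {1..2}")
      case False
      then have "E x = 0" by (simp add: E_def D\<eta>_def cutoff'_bounds(2))
      then show ?thesis using w by simp
    next
      case True
      then have r: "R\<^sup>2 \<le> (norm x)\<^sup>2" "(norm x)\<^sup>2 \<le> 2 * R\<^sup>2"
        using R by (auto simp: power2_norm_eq_inner pos_le_divide_eq pos_divide_le_eq)
      have "2 * R\<^sup>2 \<le> (2 * R)\<^sup>2" by (simp add: power_mult_distrib)
      then have "(norm x)\<^sup>2 \<le> (2 * R)\<^sup>2" using r(2) by linarith
      then have "norm x \<le> 2 * R" by (rule power2_le_imp_le) (use R in simp)
      then have ind: "x \<in> cball 0 (2 * R)" by simp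
      have "conf x \<le> 2 / R\<^sup>2" unfolding conf_def
      proof (rule divide_left_mono)
        show "0 < (1 + (norm x)\<^sup>2) * R\<^sup>2" using R by (intro mult_pos_pos add_pos_nonneg) auto
      qed (use r(1) in linarith)+
      then have cf: "(conf x) ^ (?n - 1) \<le> (2 / R\<^sup>2) ^ (?n - 1)"
        using conf_pos[of x] by (intro power_mono) auto
      have t: "\<bar>D\<eta> x (axis k 1) * Z k x\<bar> \<le> 16 * B * (2 / R\<^sup>2) ^ (?n - 1)" for k
      proof -
        have "\<bar>D\<eta> x (axis k 1)\<bar> \<le> 4 * (2 * norm x / R\<^sup>2)"
        proof -
          have "\<bar>x \<bullet> axis k 1\<bar> \<le> norm x" using component_le_norm_cart[of x k] by (simp add: inner_axis)
          then have "\<bar>2 * (x \<bullet> axis k 1) / R\<^sup>2\<bar> \<le> 2 * norm x / R\<^sup>2"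
            by (simp add: abs_mult divide_right_mono)
          then show ?thesis unfolding D\<eta>_def abs_mult by (intro mult_mono cutoff'_bounds) auto
        qed
        then have "\<bar>D\<eta> x (axis k 1) * Z k x\<bar> \<le> 4 * (2 * norm x / R\<^sup>2) * (B * (norm x * (conf x) ^ (?n - 1)))"
          unfolding abs_mult by (intro mult_mono Zb) auto
        also have "\<dots> = 8 * B * ((norm x)\<^sup>2 / R\<^sup>2) * (conf x) ^ (?n - 1)"
          by (simp add: power2_eq_square)
        also have "\<dots> \<le> 8 * B * 2 * (2 / R\<^sup>2) ^ (?n - 1)"
          by (intro mult_mono cf) (use B R r(2) conf_pos[of x] in \<open>auto simp: pos_divide_le_eq\<close>)
        finally show ?thesis by simp
      qed
      have "\<bar>E x\<bar> \<le> (\<Sum>k\<in>(UNIV::'n set). 16 * B * (2 / R\<^sup>2) ^ (?n - 1))"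
        unfolding E_def by (rule order_trans[OF sum_abs sum_mono]) (rule t)
      also have "\<dots> = w"
        by (simp add: w_def c_def power_divide power_mult)
      finally show ?thesis using ind by simp
    qed
    have lowS: "?n / 2 * m * indicator (ball 0 1) x - w * indicator (cball 0 (2 * R)) x \<le> S x" for x
    proof -
      have "?n / 2 * m * indicator (ball 0 1) x \<le> \<eta> x * (?n / 2 * \<rho> x)"
      proof (cases "x \<in> ball 0 1")
        case True
        then have "norm x < 1" by simp
        then have "x \<bullet> x \<le> 1" using power_mono[of "norm x" 1 2] by (simp add: power2_norm_eq_inner[symmetric])
        also have "1 \<le> R\<^sup>2" using R by simp
        finally have "\<eta> x = 1" unfolding \<eta>_def using R by (intro cutoff_bounds(2)) simp
        moreover have "m \<le> \<rho> x" unfolding m_def using x0(2)[of x] True by simp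
        ultimately show ?thesis using True by (simp add: mult_left_mono)
      next
        case False
        then show ?thesis using \<rho>(2)[of x] cutoff_bounds(1) by (simp add: \<eta>_def)
      qed
      then show ?thesis using Eb[of x] unfolding S by linarith
    qed
    have fin: "emeasure lborel A < \<infinity>" if "bounded A" for A :: "(real^'n) set"
      using emeasure_bounded_finite that by blast
    have i1: "integrable lborel (\<lambda>x::real^'n. ?n / 2 * m * indicator (ball 0 1) x)"
      by (intro integrable_mult_right integrable_real_indicator fin) auto
    have i2: "integrable lborel (\<lambda>x::real^'n. w * indicator (cball 0 (2 * R)) x)"
      by (intro integrable_mult_right integrable_real_indicator fin) auto
    have "(\<integral>x. ?n / 2 * m * indicator (ball 0 1) x - w * indicator (cball 0 (2 * R)) (x::real^'n) \<partial>lborel) \<le> (\<integral>x. S x \<partial>lborel)"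
      by (rule integral_mono[OF Bochner_Integration.integrable_diff[OF i1 i2] intS lowS])
    moreover have "(\<integral>x. ?n / 2 * m * indicator (ball 0 1) x - w * indicator (cball 0 (2 * R)) (x::real^'n) \<partial>lborel)
        = ?n / 2 * m * ?V - w * measure lborel (cball (0::real^'n) (2 * R))"
      by (subst Bochner_Integration.integral_diff[OF i1 i2]) simp
    ultimately have "?n / 2 * m * ?V - w * measure lborel (cball (0::real^'n) (2 * R)) \<le> 0"
      unfolding S0 by simp
    moreover have "measure lborel (cball (0::real^'n) (2 * R)) = (2 * R) ^ ?n * ?V"
      using R content_ball_conv_unit_ball[of "2 * R" "0::real^'n"] by (simp add: content_cball_conv_ball)
    ultimately have "?V * (?n / 2 * m) \<le> ?V * (w * (2 * R) ^ ?n)" by (simp add: algebra_simps)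
    then have "?n / 2 * m \<le> w * (2 * R) ^ ?n" using V by (simp only: mult_le_cancel_left_pos)
    also have "w * (2 * R) ^ ?n = c * 2 ^ ?n * (R ^ ?n / R ^ (2 * (?n - 1)))"
      by (simp add: w_def power_mult_distrib)
    also have "R ^ ?n / R ^ (2 * (?n - 1)) \<le> 1 / R"
    proof -
      have "R * R ^ ?n = R ^ Suc ?n" by simp
      \<comment> \<open>The inequality N + 1 \<le> 2 (N - 1) is the dimension condition N \<ge>
        3.\<close>
      also have "\<dots> \<le> R ^ (2 * (?n - 1))" using R n by (intro power_increasing) auto
      finally show ?thesis using R by (simp add: field_simps)
    qed
    finally show ?thesis using c by (simp add: mult_left_mono)
  qed
  \<comment> \<open>Chosen so that the error is at most half of the lower bound N/2 * m.\<close>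
  define R where "R = max 1 (c * 2 ^ ?n / (?n / 4 * m))"
  have np: "?n / 4 * m > 0" using m by simp
  have "c * 2 ^ ?n / (?n / 4 * m) \<le> R" by (simp add: R_def)
  then have "c * 2 ^ ?n \<le> R * (?n / 4 * m)" using np by (simp only: pos_divide_le_eq)
  moreover have R1: "R \<ge> 1" by (simp add: R_def)
  ultimately have "c * 2 ^ ?n / R \<le> ?n / 4 * m" by (simp add: pos_divide_le_eq mult.commute)
  with main[OF R1] have "?n / 2 * m \<le> ?n / 4 * m" by linarith
  then show False using np by (simp add: mult.commute)
qed

text \<open>In dimension 2 the round area form conf^2 dx \<and> dy has all the other properties, so
  the dimension bound is where the topology of the sphere is felt.\<close>

lemma no_conformally_bounded_symplectic_form:
  fixes \<Omega> :: "real^'n \<Rightarrow> real^'n^'n" and M :: real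
  assumes "C_on 1 UNIV \<Omega>"
    and "\<And>x i j. \<Omega> x $ i $ j = - \<Omega> x $ j $ i"
    and "\<And>x i j k. frechet_derivative \<Omega> (at x) (axis i 1) $ j $ k
       + frechet_derivative \<Omega> (at x) (axis j 1) $ k $ i + frechet_derivative \<Omega> (at x) (axis k 1) $ i $ j = 0"
    and "\<And>x i j. \<bar>\<Omega> x $ i $ j\<bar> \<le> M * (conf x)\<^sup>2"
    and "\<And>x v. (conf x)\<^sup>2 * norm v \<le> norm (\<Omega> x *v v)"
    and n: "CARD('n) \<ge> 3"
  shows False
proof (rule Liouville_field[OF assms(1-5)])
  fix Z :: "'n \<Rightarrow> real^'n \<Rightarrow> real" and \<rho> K
  assume *: "\<And>k. C_on 1 UNIV (Z k)" "continuous_on UNIV \<rho>" "\<And>x. \<rho> x > 0"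
    "\<And>x. (\<Sum>k\<in>UNIV. frechet_derivative (Z k) (at x) (axis k 1)) = CARD('n) / 2 * \<rho> x"
    "\<And>k x. \<bar>Z k x\<bar> \<le> K * (norm x * (conf x) ^ (CARD('n) - 1))"
  show False by (rule no_expanding_field[OF * n])
qed

section \<open>The curvature form of a family of projections\<close>

lemma bounded_bilinear_matrix_mult:
  "bounded_bilinear ((**) :: complex^'n^'m \<Rightarrow> complex^'k^'n \<Rightarrow> complex^'k^'m)"
proof -
  have "bilinear ((**) :: complex^'n^'m \<Rightarrow> complex^'k^'n \<Rightarrow> complex^'k^'m)"
    unfolding bilinear_def
    by (auto intro!: linearI simp: vec_eq_iff matrix_matrix_mult_def ring_distribs sum.distrib scaleR_sum_right)
  then show ?thesis by (simp add: bilinear_conv_bounded_bilinear)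
qed

lemmas matrix_mult_distribs =
  bounded_bilinear.add_left[OF bounded_bilinear_matrix_mult] bounded_bilinear.add_right[OF bounded_bilinear_matrix_mult]
  bounded_bilinear.diff_left[OF bounded_bilinear_matrix_mult] bounded_bilinear.diff_right[OF bounded_bilinear_matrix_mult]

lemma bounded_linear_trace: "bounded_linear (trace :: complex^'n^'n \<Rightarrow> complex)"
  by (rule linear_conv_bounded_linear[THEN iffD1])
    (auto intro!: linearI simp: trace_def sum.distrib scaleR_sum_right)

lemma matrix_mult_neg:
  fixes A :: "'a::ring_1^'n^'m" and B :: "'a^'k^'n"
  shows "(- A) ** B = - (A ** B)" "A ** (- B) = - (A ** B)"
  by (simp_all add: vec_eq_iff matrix_matrix_mult_def sum_negf)

lemma trace_neg: "trace (- A :: 'a::comm_ring_1^'n^'n) = - trace A"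
  by (simp add: trace_def sum_negf)

text \<open>Tangent vectors to the idempotents anticommute with the reflection \<open>2 P - 1\<close>, so an odd number of
  them has trace zero.\<close>

lemma trace_three_tangents:
  fixes P A B C :: "complex^'n^'n"
  assumes P: "P ** P = P"
    and t: "P ** A + A ** P = A" "P ** B + B ** P = B" "P ** C + C ** P = C"
  shows "trace (A ** B ** C) = 0"
proof -
  define e where "e = P + P - mat 1"
  have ee: "e ** e = mat 1"
    by (simp only: e_def matrix_mult_distribs P matrix_mul_lid matrix_mul_rid) simp
  have anti: "e ** X = - (X ** e)" if "P ** X + X ** P = X" for X
  proof -
    have "e ** X + X ** e = (P ** X + X ** P) + (P ** X + X ** P) - X - X"
      by (simp only: e_def matrix_mult_distribs matrix_mul_lid matrix_mul_rid) simp
    then have "e ** X + X ** e = 0" unfolding that by simp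
    then show ?thesis by (simp add: eq_neg_iff_add_eq_0)
  qed
  have "trace (A ** B ** C) = trace ((A ** B ** C ** e) ** e)"
    by (simp add: matrix_mul_assoc[symmetric] ee)
  also have "\<dots> = trace (e ** A ** B ** C ** e)"
    by (subst trace_mul_sym) (simp add: matrix_mul_assoc)
  also have "e ** A ** B ** C ** e = - (A ** B ** C)"
  proof -
    have "e ** A ** B ** C ** e = - (A ** (e ** B) ** C ** e)"
      by (simp add: anti[OF t(1)] matrix_mult_neg matrix_mul_assoc)
    also have "\<dots> = A ** B ** (e ** C) ** e"
      by (simp add: anti[OF t(2)] matrix_mult_neg matrix_mul_assoc)
    also have "\<dots> = - (A ** B ** C ** (e ** e))"
      by (simp add: anti[OF t(3)] matrix_mult_neg matrix_mul_assoc)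
    finally show ?thesis by (simp add: ee)
  qed
  finally show ?thesis by (simp add: trace_neg)
qed

section \<open>The curvature form and its closedness\<close>

text \<open>For Hermitian projections this is, up to a constant factor, the first Chern form of the
  bundle range P with the connection induced from the flat one. The difference of traces is then
  purely imaginary, so \<open>Im\<close> loses nothing.\<close>

definition curvature_form :: "(real^'n \<Rightarrow> complex^'m^'m) \<Rightarrow> real^'n \<Rightarrow> real^'n^'n" where
  "curvature_form P x = (\<chi> i j.
     let D = frechet_derivative P (at x) in
     Im (trace (P x ** D (axis i 1) ** D (axis j 1)) - trace (P x ** D (axis j 1) ** D (axis i 1))))"

lemma curvature_form_skew: "curvature_form P x $ i $ j = - curvature_form P x $ j $ i"
  by (simp add: curvature_form_def Let_def)

lemma C_on_curvature_form:
  fixes P :: "real^'n \<Rightarrow> complex^'m^'m"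
  assumes C: "C_on 2 UNIV P"
  shows "C_on 1 UNIV (curvature_form P)"
proof -
  have C2: "C_on (Suc (Suc 0)) UNIV P" using C by (simp add: numeral_2_eq_2)
  have CP: "C_on 1 UNIV P" using C_on_SucE[OF C2] by simp
  have CD: "C_on 1 UNIV (\<lambda>x. frechet_derivative P (at x) v)" for v
    using C_on_SucD(2)[OF C2] by (simp only: One_nat_def)
  have Ct: "C_on 1 UNIV (\<lambda>x. trace (P x ** frechet_derivative P (at x) v ** frechet_derivative P (at x) w))" for v w
    by (rule C_on_linear[OF open_UNIV bounded_linear_trace
          C_on_bilinear[OF open_UNIV bounded_bilinear_matrix_mult
            C_on_bilinear[OF open_UNIV bounded_bilinear_matrix_mult CP CD] CD]])
  show ?thesis
    unfolding curvature_form_def[abs_def] Let_def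
    by (intro C_on_vec_lambda[OF open_UNIV] C_on_linear[OF open_UNIV bounded_linear_Im] C_on_diff[OF open_UNIV] Ct)
qed

lemma tangent_to_idempotents:
  fixes P :: "real^'n \<Rightarrow> complex^'m^'m"
  assumes D: "(P has_derivative D) (at x)" and idem: "\<And>x. P x ** P x = P x"
  shows "P x ** D v + D v ** P x = D v"
proof -
  have "((\<lambda>x. P x ** P x) has_derivative (\<lambda>v. P x ** D v + D v ** P x)) (at x)"
    by (rule bounded_bilinear.FDERIV[OF bounded_bilinear_matrix_mult D D])
  then have "(P has_derivative (\<lambda>v. P x ** D v + D v ** P x)) (at x)" by (simp only: idem)
  then have "(\<lambda>v. P x ** D v + D v ** P x) = D" by (rule has_derivative_unique[OF _ D])
  then show ?thesis by (rule fun_cong)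
qed

text \<open>Differentiating tr (P [dP, dP]) gives terms with three first derivatives, which vanish
  by \<open>trace_three_tangents\<close>, and terms with one second derivative, which cancel in the
  cyclic sum by symmetry.\<close>

lemma curvature_form_closed:
  fixes P :: "real^'n \<Rightarrow> complex^'m^'m"
  assumes C: "C_on 2 UNIV P" and idem: "\<And>x. P x ** P x = P x"
  shows "frechet_derivative (curvature_form P) (at x) (axis i 1) $ j $ k
       + frechet_derivative (curvature_form P) (at x) (axis j 1) $ k $ i
       + frechet_derivative (curvature_form P) (at x) (axis k 1) $ i $ j = 0"
proof -
  have C2: "C_on (Suc (Suc 0)) UNIV P" using C by (simp add: numeral_2_eq_2)
  define D where "D = (\<lambda>x. frechet_derivative P (at x))"
  define H where "H = (\<lambda>u v. deriv2 P x u v)"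
  have D: "(P has_derivative D y) (at y)" for y
    unfolding D_def by (rule C_on_SucD(1)[OF C2]) simp
  have DD: "((\<lambda>y. D y v) has_derivative (\<lambda>u. H u v)) (at x)" for v
    unfolding D_def H_def by (rule C_on_SucD(1)[OF C_on_SucD(2)[OF C2]]) simp
  have H: "H u v = H v u" for u v
    unfolding H_def by (rule deriv2_commute[OF C open_UNIV UNIV_I])
  \<comment> \<open>\<open>T\<close> and \<open>U\<close> hold the second derivative in the first
    and in the second of the two tangent slots.\<close>
  define T where "T = (\<lambda>a b c. trace (P x ** H a b ** D x c))"
  define U where "U = (\<lambda>a b c. trace (P x ** D x a ** H b c))"
  have d\<tau>: "((\<lambda>y. trace (P y ** D y v ** D y w)) has_derivative (\<lambda>u. T u v w + U v u w)) (at x)" for v w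
  proof -
    have "((\<lambda>y. trace (P y ** D y v ** D y w)) has_derivative
      (\<lambda>u. trace ((P x ** D x v) ** H u w + (P x ** H u v + D x u ** D x v) ** D x w))) (at x)"
      by (intro bounded_linear.has_derivative[OF bounded_linear_trace]
          bounded_bilinear.FDERIV[OF bounded_bilinear_matrix_mult] D DD)
    moreover have "trace ((P x ** D x v) ** H u w + (P x ** H u v + D x u ** D x v) ** D x w) = T u v w + U v u w" for u
      using trace_three_tangents[OF idem, of x "D x u" "D x v" "D x w"] tangent_to_idempotents[OF D idem]
      by (simp add: T_def U_def trace_add matrix_mult_distribs)
    ultimately show ?thesis by simp
  qed
  have dO: "frechet_derivative (curvature_form P) (at x) u $ a $ b
     = Im ((T u (axis a 1) (axis b 1) + U (axis a 1) u (axis b 1)) - (T u (axis b 1) (axis a 1) + U (axis b 1) u (axis a 1)))" for u a b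
  proof -
    have "((\<lambda>y. curvature_form P y $ a $ b) has_derivative (\<lambda>u. Im ((T u (axis a 1) (axis b 1) + U (axis a 1) u (axis b 1))
        - (T u (axis b 1) (axis a 1) + U (axis b 1) u (axis a 1))))) (at x)"
      unfolding curvature_form_def Let_def vec_lambda_beta D_def[THEN fun_cong, symmetric]
      by (intro bounded_linear.has_derivative[OF bounded_linear_Im] has_derivative_diff d\<tau>)
    moreover have d: "((\<lambda>y. curvature_form P y $ a $ b) has_derivative
        (\<lambda>u. frechet_derivative (curvature_form P) (at x) u $ a $ b)) (at x)"
      by (intro bounded_linear.has_derivative[OF bounded_linear_vec_nth] C_on_1D(1)[OF C_on_curvature_form[OF C]] UNIV_I)
    ultimately show ?thesis using fun_cong[OF has_derivative_unique[OF d]] by blast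
  qed
  have T: "T a b c = T b a c" and U: "U a b c = U a c b" for a b c
    by (simp_all add: T_def U_def H[of a b] H[of b c])
  show ?thesis
    unfolding dO using T[of "axis i 1" "axis j 1"] T[of "axis j 1" "axis k 1"] T[of "axis k 1" "axis i 1"]
      U[of _ "axis i 1" "axis j 1"] U[of _ "axis j 1" "axis k 1"] U[of _ "axis k 1" "axis i 1"]
    by simp
qed

section \<open>Projections onto the vectors of type (1,0)\<close>

definition cvec :: "real^'m \<Rightarrow> complex^'m" where
  "cvec v = (\<chi> i. of_real (v $ i))"

lemma axis_nth': "axis b x $ a = (if a = b then x else 0)"
  by (simp add: axis_def)

definition tproj :: "'a::real_inner \<Rightarrow> 'a \<Rightarrow> 'a" where
  "tproj p v = v - (p \<bullet> v) *\<^sub>R p"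

locale orthogonal_structure =
  fixes J :: "real^'m \<Rightarrow> real^'m \<Rightarrow> real^'m"
  assumes acs: "almost_complex_structure J" and orth: "orthogonal_acs J"
begin

text \<open>The vector \<open>u - \<i> J u\<close> of type \<open>(1,0)\<close>.\<close>

definition hol :: "real^'m \<Rightarrow> real^'m \<Rightarrow> complex^'m" where
  "hol p u = (\<chi> a. Complex (u $ a) (- J p u $ a))"

text \<open>The orthogonal projection of \<open>\<complex>\<^sup>m\<close> onto the space of \<open>(1,0)\<close>-vectors at \<open>p\<close>.\<close>

definition PT :: "real^'m \<Rightarrow> complex^'m^'m" where
  "PT p = (\<chi> a b. hol p (tproj p (axis b 1)) $ a / 2)"

context
  fixes p :: "real^'m"
  assumes p: "p \<in> unit_sphere"
begin

lemma pp: "p \<bullet> p = 1"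
  using p by (simp add: norm_eq_1)

lemma tproj_tangent [simp]: "p \<bullet> tproj p v = 0"
  by (simp add: tproj_def inner_diff_right pp)

lemma tproj_eq: "p \<bullet> u = 0 \<Longrightarrow> tproj p u = u"
  by (simp add: tproj_def)

lemma J_props:
  assumes "p \<bullet> u = 0" "p \<bullet> v = 0"
  shows "p \<bullet> J p u = 0" "J p (u + v) = J p u + J p v" "J p (c *\<^sub>R u) = c *\<^sub>R J p u"
    "J p (J p u) = - u" "J p u \<bullet> J p v = u \<bullet> v"
  using acs orth p assms unfolding almost_complex_structure_def orthogonal_acs_def
  by (auto simp: tangent_space_def)

text \<open>Orthogonality is applied to \<open>u\<close> and \<open>J p v\<close>, using J J v = -
  v.\<close>

lemma J_skew:
  assumes "p \<bullet> u = 0" "p \<bullet> v = 0"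
  shows "J p u \<bullet> v = - (u \<bullet> J p v)"
  using J_props(5)[of u "J p v"] J_props(1,4)[of v v] assms by simp

lemma hol_add: "p \<bullet> u = 0 \<Longrightarrow> p \<bullet> v = 0 \<Longrightarrow> hol p (u + v) = hol p u + hol p v"
  by (simp add: hol_def vec_eq_iff J_props complex_eq_iff)

lemma hol_scale: "p \<bullet> u = 0 \<Longrightarrow> hol p (c *\<^sub>R u) = c *\<^sub>R hol p u"
  by (simp add: hol_def vec_eq_iff J_props complex_eq_iff)

lemma hol_J: "p \<bullet> u = 0 \<Longrightarrow> hol p (J p u) = \<i> *s hol p u"
  by (simp add: hol_def vec_eq_iff J_props complex_eq_iff)

lemma hol_eq: "hol p u = cvec u - \<i> *s cvec (J p u)"
  by (simp add: hol_def cvec_def vec_eq_iff complex_eq_iff)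

lemma linear_hol_tproj: "linear (\<lambda>v. hol p (tproj p v))"
proof (rule linearI)
  have t: "tproj p (u + v) = tproj p u + tproj p v" "tproj p (c *\<^sub>R u) = c *\<^sub>R tproj p u" for u v c
    by (simp_all add: tproj_def algebra_simps inner_add_right)
  show "hol p (tproj p (u + v)) = hol p (tproj p u) + hol p (tproj p v)" for u v
    by (simp add: t hol_add)
  show "hol p (tproj p (c *\<^sub>R u)) = c *\<^sub>R hol p (tproj p u)" for c u
    by (simp add: t hol_scale)
qed

text \<open>A real tangent vector u is half the sum of u - \<i> J u and u + \<i> J u, and the normal
  part is killed; this is the origin of the factor 1/2 in \<open>PT\<close>.\<close>

lemma PT_cvec: "PT p *v cvec w = (1/2) *s hol p (tproj p w)"
proof -
  have "hol p (tproj p w) = (\<Sum>b\<in>UNIV. w $ b *\<^sub>R hol p (tproj p (axis b 1)))"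
    by (rule linear_axis_sum[OF linear_hol_tproj])
  then show ?thesis
    by (simp add: PT_def cvec_def matrix_vector_mult_def vec_eq_iff sum_component sum_distrib_left
        scaleR_conv_of_real[where 'a = complex] sum_divide_distrib mult.commute)
qed

text \<open>As \<open>hol p (J p u)\<close> is \<i> times \<open>hol p u\<close>, the contributions
  of u and of - \<i> J u are equal halves.\<close>

lemma PT_hol:
  assumes u: "p \<bullet> u = 0"
  shows "PT p *v hol p u = hol p u"
proof -
  have "PT p *v hol p u = PT p *v cvec u - \<i> *s (PT p *v cvec (J p u))"
    by (simp add: hol_eq matrix_vector_mult_diff_distrib vector_scalar_commute)
  also have "\<dots> = hol p u"
    using u by (simp add: PT_cvec tproj_eq J_props hol_J) (simp add: vec_eq_iff)
  finally show ?thesis .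
qed

lemma PT_column: "column b (PT p) = (1/2) *s hol p (tproj p (axis b 1))"
  by (simp add: column_def PT_def vec_eq_iff)

lemma PT_idem: "PT p ** PT p = PT p"
proof -
  have "column b (PT p ** PT p) = column b (PT p)" for b
  proof -
    have "column b (PT p ** PT p) = PT p *v column b (PT p)"
      by (simp add: column_def matrix_matrix_mult_def matrix_vector_mult_def vec_eq_iff)
    also have "\<dots> = column b (PT p)"
      unfolding PT_column by (simp add: vector_scalar_commute PT_hol)
    finally show ?thesis .
  qed
  then show ?thesis by (simp add: column_def vec_eq_iff)
qed

lemma PT_entry:
  "PT p $ a $ b = Complex (((if a = b then 1 else 0) - p $ a * p $ b) / 2) (- (J p (tproj p (axis b 1)) $ a) / 2)"
  by (simp add: PT_def hol_def complex_eq_iff tproj_def inner_axis axis_nth')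

lemma J_entry_skew: "J p (tproj p (axis b 1)) $ a = - J p (tproj p (axis a 1)) $ b"
proof -
  have e: "J p (tproj p (axis b 1)) $ a = J p (tproj p (axis b 1)) \<bullet> tproj p (axis a 1)" for a b
  proof -
    have "J p (tproj p (axis b 1)) \<bullet> p = 0"
      using J_props(1)[of "tproj p (axis b 1)" p] by (metis J_props(1) inner_commute tproj_tangent)
    then show ?thesis by (simp add: tproj_def inner_diff_right inner_axis)
  qed
  show ?thesis unfolding e using J_skew[of "tproj p (axis b 1)" "tproj p (axis a 1)"] by (simp add: inner_commute)
qed

lemma PT_hermitian: "PT p $ a $ b = cnj (PT p $ b $ a)"
  unfolding PT_entry using J_entry_skew[of b a] by (simp add: complex_eq_iff mult.commute)

text \<open>C^m is the orthogonal sum of the (1,0)-vectors, the (0,1)-vectors and the complex normal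
  line. The projection onto the second summand is the conjugate of \<open>PT\<close>, which is its
  transpose because \<open>PT\<close> is Hermitian.\<close>

lemma PT_decomposition: "PT p $ a $ b + PT p $ b $ a + of_real (p $ a * p $ b) = (if a = b then 1 else 0)"
  unfolding PT_entry using J_entry_skew[of b a] by (simp add: complex_eq_iff mult.commute)

lemma normal_hol: "p \<bullet> u = 0 \<Longrightarrow> (\<Sum>a\<in>UNIV. of_real (p $ a) * hol p u $ a) = 0"
  using J_props(1)[of u u]
  by (simp add: hol_def complex_eq_iff inner_vec_def sum_negf)

lemma normal_PT: "(\<Sum>a\<in>UNIV. of_real (p $ a) * PT p $ a $ b) = 0"
  using normal_hol[of "tproj p (axis b 1)"]
  by (simp add: PT_def sum_divide_distrib[symmetric])

lemma norm_hol:
  assumes "p \<bullet> u = 0"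
  shows "(\<Sum>a\<in>UNIV. (cmod (hol p u $ a))\<^sup>2) = 2 * (norm u)\<^sup>2"
proof -
  have "(\<Sum>a\<in>UNIV. (cmod (hol p u $ a))\<^sup>2) = u \<bullet> u + J p u \<bullet> J p u"
    by (simp add: hol_def inner_vec_def cmod_power2 sum.distrib) (simp add: power2_eq_square)
  then show ?thesis using assms by (simp add: J_props power2_norm_eq_inner)
qed

text \<open>\<open>PT\<close> is meaningful on the sphere only, so its derivatives are taken through
  an extension to an open set of the ambient space. Each of the finitely many columns evaluates
  \<open>J\<close> on one section y \<mapsto> tproj y (axis b 1), which is polynomial in y, and
  smoothness of \<open>J\<close> supplies an extension near its value at p.\<close>

lemma PT_smooth_extension:
  obtains V Q where "open V" "p \<in> V" "\<And>k. C_on k V Q" "\<And>y. y \<in> V \<Longrightarrow> y \<in> unit_sphere \<Longrightarrow> Q y = PT y"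
proof -
  have "\<forall>b. \<exists>U F. open U \<and> (p, tproj p (axis b 1)) \<in> U \<and> (\<forall>k. C_on k U F) \<and>
      (\<forall>y\<in>tangent_bundle \<inter> U. F y = (\<lambda>(p, v). J p v) y)"
  proof
    fix b
    have "(p, tproj p (axis b 1)) \<in> tangent_bundle"
      using p by (simp add: tangent_bundle_def tangent_space_def)
    then show "\<exists>U F. open U \<and> (p, tproj p (axis b 1)) \<in> U \<and> (\<forall>k. C_on k U F) \<and>
      (\<forall>y\<in>tangent_bundle \<inter> U. F y = (\<lambda>(p, v). J p v) y)"
      using acs unfolding almost_complex_structure_def smooth_on_def by blast
  qed
  from choice[OF this] obtain U where "\<forall>b. \<exists>F. open (U b) \<and> (p, tproj p (axis b 1)) \<in> U b \<and> (\<forall>k. C_on k (U b) F) \<and>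
      (\<forall>y\<in>tangent_bundle \<inter> U b. F y = (\<lambda>(p, v). J p v) y)" by blast
  from choice[OF this] obtain F where UF: "\<forall>b. open (U b) \<and> (p, tproj p (axis b 1)) \<in> U b \<and> (\<forall>k. C_on k (U b) (F b)) \<and>
      (\<forall>y\<in>tangent_bundle \<inter> U b. F b y = (\<lambda>(p, v). J p v) y)" by blast
  have U: "open (U b)" "(p, tproj p (axis b 1)) \<in> U b" "C_on k (U b) (F b)"
    "y \<in> tangent_bundle \<Longrightarrow> y \<in> U b \<Longrightarrow> F b y = (\<lambda>(p, v). J p v) y" for b k y
    using UF by blast+
  define s where "s = (\<lambda>b (y::real^'m). (y, tproj y (axis b 1)))"
  have Cs: "C_on k UNIV (s b)" for k b
    unfolding s_def tproj_def
    by (rule C_on_Pair[OF open_UNIV C_on_ident[OF open_UNIV]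
          C_on_diff[OF open_UNIV C_on_const C_on_scaleR[OF open_UNIV
              C_on_inner[OF open_UNIV C_on_ident[OF open_UNIV] C_on_const] C_on_ident[OF open_UNIV]]]])
  define V where "V = (\<Inter>b. s b -` U b)"
  have oV: "open V"
    unfolding V_def
    by (intro open_INT finite_UNIV ballI open_vimage U(1) C_on_imp_continuous_on[OF Cs[where k = 0]]) auto
  have pV: "p \<in> V" using U(2) by (simp add: V_def s_def)
  \<comment> \<open>The entries from \<open>PT_entry\<close>, with the extension \<open>F b\<close>
    in place of \<open>J\<close> and written by sums and products so that the smoothness rules
    apply.\<close>
  define Q where "Q = (\<lambda>y. \<chi> a b. of_real (((if a = b then 1 else 0) - y $ a * y $ b) / 2) + of_real (- (F b (s b y) $ a) / 2) * \<i>)"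
  have CF: "C_on k V (\<lambda>y. F b (s b y))" for k b
    by (rule C_on_compose[OF oV U(1) U(3) C_on_subset[OF Cs]]) (auto simp: V_def)
  have Ca: "C_on k V (\<lambda>y. y $ a)" for k a
    by (rule C_on_vec_nth[OF oV C_on_ident[OF oV]])
  have "C_on k V Q" for k
    unfolding Q_def
    by (intro C_on_vec_lambda[OF oV] C_on_add[OF oV] C_on_mult[OF oV C_on_linear[OF oV bounded_linear_of_real] C_on_const]
        C_on_linear[OF oV bounded_linear_of_real] C_on_divide[OF oV] C_on_diff[OF oV] C_on_const C_on_mult[OF oV] Ca
        C_on_linear[OF oV bounded_linear_minus[OF bounded_linear_ident]] C_on_vec_nth[OF oV] CF) auto
  moreover have "Q y = PT y" if "y \<in> V" "y \<in> unit_sphere" for y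
  proof -
    have "F b (s b y) = J y (tproj y (axis b 1))" for b
    proof -
      have "y \<bullet> y = 1" using that(2) by (simp add: norm_eq_1)
      then have "s b y \<in> tangent_bundle"
        using that(2) by (simp add: s_def tangent_bundle_def tangent_space_def tproj_def inner_diff_right)
      then show ?thesis using U(4)[of "s b y" b] that(1) by (auto simp: V_def s_def)
    qed
    then show ?thesis
      by (simp add: Q_def vec_eq_iff complex_eq_iff PT_def hol_def) (simp add: tproj_def inner_axis axis_nth')
  qed
  ultimately show thesis using that oV pV by blast
qed

end

end

section \<open>Charts and the antiholomorphic dependence of the projection\<close>

text \<open>This serves to differentiate an identity valid near a point: both sides have known
  derivatives, which must agree.\<close>

lemma has_derivative_unique_open:
  assumes "(f has_derivative F) (at z)" "(g has_derivative G) (at z)" "open W" "z \<in> W"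
    and "\<And>y. y \<in> W \<Longrightarrow> f y = g y"
  shows "F v = G v"
proof -
  have "(g has_derivative F) (at z)"
    by (rule has_derivative_transform_within_open[OF assms(1,3,4)]) (rule assms(5))
  then show ?thesis using has_derivative_unique[OF _ assms(2)] by blast
qed

text \<open>The complex bilinear pairing, without conjugation: for an orthogonal \<open>J\<close>
  the (1,0)-vectors are isotropic for it.\<close>

definition cdot :: "complex^'m \<Rightarrow> complex^'m \<Rightarrow> complex" where
  "cdot x y = (\<Sum>a\<in>UNIV. x $ a * y $ a)"

lemma cdot_commute: "cdot x y = cdot y x"
  by (simp add: cdot_def mult.commute)

lemma bounded_bilinear_cdot: "bounded_bilinear cdot"
proof -
  have "bilinear (cdot :: complex^'m \<Rightarrow> _)"
    unfolding bilinear_def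
    by (auto intro!: linearI simp: cdot_def ring_distribs sum.distrib scaleR_sum_right)
  then show ?thesis by (simp add: bilinear_conv_bounded_bilinear)
qed

lemma cdot_simps:
  "cdot (x + y) z = cdot x z + cdot y z" "cdot (x - y) z = cdot x z - cdot y z"
  "cdot z (x + y) = cdot z x + cdot z y" "cdot z (x - y) = cdot z x - cdot z y"
  "cdot (c *s x) z = c * cdot x z" "cdot z (c *s x) = c * cdot z x"
  by (simp_all add: cdot_def ring_distribs sum.distrib sum_subtractf sum_distrib_left mult_ac)

lemma bounded_bilinear_matrix_vector:
  "bounded_bilinear ((*v) :: complex^'n^'m \<Rightarrow> complex^'n \<Rightarrow> complex^'m)"
proof -
  have "bilinear ((*v) :: complex^'n^'m \<Rightarrow> complex^'n \<Rightarrow> complex^'m)"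
    unfolding bilinear_def
    by (auto intro!: linearI simp: vec_eq_iff matrix_vector_mult_def ring_distribs sum.distrib scaleR_sum_right)
  then show ?thesis by (simp add: bilinear_conv_bounded_bilinear)
qed

lemma bounded_linear_cvec: "bounded_linear cvec"
  by (rule linear_conv_bounded_linear[THEN iffD1])
    (auto intro!: linearI simp: cvec_def vec_eq_iff scaleR_conv_of_real[where 'a = complex])

lemma bounded_linear_smult: "bounded_linear (\<lambda>x :: complex^'n. c *s x)"
  by (rule linear_conv_bounded_linear[THEN iffD1])
    (auto intro!: linearI simp: vec_eq_iff ring_distribs)

text \<open>For injectivity: a smooth extension \<open>F\<close> of the chart satisfies F \<circ>
  \<psi> = id near \<phi> p, so its derivative is a left inverse of the derivative of
  \<psi>.\<close>

lemma inverse_chart: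
  fixes \<phi> :: "'a::euclidean_space \<Rightarrow> complex^'n"
  assumes chart: "complex_chart U \<phi>" and p: "p \<in> U"
  defines "W \<equiv> \<phi> ` U" and "\<psi> \<equiv> inv_into U \<phi>"
  shows "open W" "\<phi> p \<in> W" "\<psi> (\<phi> p) = p" "\<And>k. C_on k W \<psi>" "\<And>y. y \<in> W \<Longrightarrow> \<psi> y \<in> U"
    "\<And>y. y \<in> W \<Longrightarrow> \<phi> (\<psi> y) = y" "\<And>y. y \<in> W \<Longrightarrow> norm (\<psi> y) = 1"
    "inj (frechet_derivative \<psi> (at (\<phi> p)))"
proof -
  have c: "openin (top_of_set unit_sphere) U" "inj_on \<phi> U" "open (\<phi> ` U)" "smooth_on U \<phi>"
    "smooth_on (\<phi> ` U) (inv_into U \<phi>)"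
    using chart by (auto simp: complex_chart_def)
  show W: "open W" using c by (simp add: W_def)
  show z: "\<phi> p \<in> W" using p by (simp add: W_def)
  show zp: "\<psi> (\<phi> p) = p" using c(2) p by (simp add: \<psi>_def)
  show C: "C_on k W \<psi>" for k
    unfolding W_def \<psi>_def by (rule smooth_on_openD[OF c(5,3)])
  show U: "\<psi> y \<in> U" if "y \<in> W" for y using that unfolding W_def \<psi>_def by (rule inv_into_into)
  show \<phi>\<psi>: "\<phi> (\<psi> y) = y" if "y \<in> W" for y using that unfolding W_def \<psi>_def by (rule f_inv_into_f)
  have "U \<subseteq> unit_sphere" using openin_imp_subset[OF c(1)] .
  then show "norm (\<psi> y) = 1" if "y \<in> W" for y using U[OF that] by auto
  obtain V F where VF: "open V" "p \<in> V" "\<forall>k. C_on k V F" "\<forall>y\<in>U \<inter> V. F y = \<phi> y"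
    using c(4) p unfolding smooth_on_def by meson
  then have V: "open V" "p \<in> V" "C_on k V F" "y \<in> U \<Longrightarrow> y \<in> V \<Longrightarrow> F y = \<phi> y" for k y
    by simp_all
  have cont: "continuous_on W \<psi>" by (rule C_on_imp_continuous_on[OF C[of 0]])
  define W' where "W' = W \<inter> \<psi> -` V"
  have W': "open W'" unfolding W'_def by (rule continuous_open_preimage[OF cont W V(1)])
  have dF: "(F has_derivative frechet_derivative F (at (\<psi> (\<phi> p)))) (at (\<psi> (\<phi> p)))"
    unfolding zp by (rule C_on_1D(1)[OF V(3) V(2)])
  have d\<psi>: "(\<psi> has_derivative frechet_derivative \<psi> (at (\<phi> p))) (at (\<phi> p))"
    by (rule C_on_1D(1)[OF C z])
  have "frechet_derivative F (at (\<psi> (\<phi> p))) (frechet_derivative \<psi> (at (\<phi> p)) w) = w" for w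
    by (rule has_derivative_unique_open[OF has_derivative_compose[OF d\<psi> dF] has_derivative_ident W'])
      (use z zp V U \<phi>\<psi> in \<open>auto simp: W'_def\<close>)
  then show "inj (frechet_derivative \<psi> (at (\<phi> p)))" by (rule inj_on_inverseI)
qed

context orthogonal_structure
begin

text \<open>In a chart \<open>\<psi>\<close>, the expression \<open>E v w\<close> below is a multiple of the second derivative of \<open>\<psi>\<close> in two
  holomorphic directions. Pairing it with a third \<open>(1,0)\<close>-vector is symmetric in the first two slots
  and antisymmetric in the last two, hence zero.\<close>

lemma PT_antiholomorphic:
  assumes p: "p \<in> unit_sphere" and int: "integrable_acs TYPE('n::finite) J"
    and dim: "CARD('m) = 2 * CARD('n) + 1"
    and V: "open V" "p \<in> V" "C_on 1 V Q" "\<And>y. y \<in> V \<Longrightarrow> y \<in> unit_sphere \<Longrightarrow> Q y = PT y"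
    and u: "p \<bullet> u = 0"
  shows "(frechet_derivative Q (at p) (J p u) ** PT p) $ a $ b = - \<i> * (frechet_derivative Q (at p) u ** PT p) $ a $ b"
proof -
  obtain \<A> :: "((real^'m) set \<times> (real^'m \<Rightarrow> complex^'n)) set" where \<A>: "complex_atlas \<A>" "induces_acs \<A> J"
    using int by (auto simp: integrable_acs_def)
  have "p \<in> (\<Union>(U, \<phi>)\<in>\<A>. U)" using \<A>(1) p by (simp add: complex_atlas_def)
  then obtain U \<phi> where U: "(U, \<phi>) \<in> \<A>" "p \<in> U" by auto
  have chart: "complex_chart U \<phi>" using \<A>(1) U(1) by (auto simp: complex_atlas_def)
  define W where "W = \<phi> ` U"
  define \<psi> where "\<psi> = inv_into U \<phi>"
  define z where "z = \<phi> p"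
  note ch = inverse_chart[OF chart U(2), folded W_def \<psi>_def z_def]
  note W = ch(1,2) and zp = ch(3)
  have C2: "C_on (Suc (Suc 0)) W \<psi>" by (rule ch(4))
  define D where "D = (\<lambda>w y. frechet_derivative \<psi> (at y) w)"
  have D: "(\<psi> has_derivative (\<lambda>w. D w y)) (at y)" if "y \<in> W" for y
    using C_on_SucD(1)[OF C2 that] by (simp add: D_def)
  define H where "H = (\<lambda>v w. deriv2 \<psi> z v w)"
  have H: "((\<lambda>y. D w y) has_derivative (\<lambda>v. H v w)) (at z)" for w
    unfolding D_def H_def by (rule C_on_SucD(1)[OF C_on_SucD(2)[OF C2] W(2)])
  have Hsym: "H v w = H w v" for v w
    unfolding H_def by (rule deriv2_commute[OF ch(4) W])
  have lin: "linear (\<lambda>w. D w y)" if "y \<in> W" for y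
    using has_derivative_linear[OF D[OF that]] .
  have J: "J (\<psi> y) (D w y) = D (\<i> *s w) y" if "y \<in> W" for y w
  proof -
    have "\<forall>p\<in>U. \<forall>w. frechet_derivative (inv_into U \<phi>) (at (\<phi> p)) (\<i> *s w) =
        J p (frechet_derivative (inv_into U \<phi>) (at (\<phi> p)) w)"
      using \<A>(2) U(1) unfolding induces_acs_def by auto
    from this[rule_format, OF ch(5)[OF that], of w] show ?thesis
      unfolding \<psi>_def[symmetric] ch(6)[OF that] D_def by simp
  qed
  have sph: "\<psi> y \<in> unit_sphere" if "y \<in> W" for y using ch(7)[OF that] by simp
  have tan: "\<psi> y \<bullet> D w y = 0" if "y \<in> W" for y w
  proof -
    have "\<psi> y \<bullet> D w y + D w y \<bullet> \<psi> y = 0"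
    proof (rule has_derivative_unique_open[OF has_derivative_inner[OF D[OF that] D[OF that]] has_derivative_const W(1) that])
      show "\<psi> y \<bullet> \<psi> y = 1" if "y \<in> W" for y using ch(7)[OF that] by (simp add: norm_eq_1)
    qed
    then show ?thesis by (simp add: inner_commute)
  qed
  \<comment> \<open>An injective linear map from real dimension 2 CARD('n) into a tangent space of
    the same dimension.\<close>
  have onto: "\<exists>w. D w z = u" if "p \<bullet> u = 0" for u
  proof -
    have sub: "range (\<lambda>w. D w z) \<subseteq> {u. p \<bullet> u = 0}" using tan[OF W(2)] zp by auto
    have "dim (range (\<lambda>w. D w z)) = dim (UNIV :: (complex^'n) set)"
      using ch(8) by (intro dim_image_eq lin W) (auto simp: D_def inj_on_def)
    also have "\<dots> = 2 * CARD('n)" by simp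
    finally have "dim (range (\<lambda>w. D w z)) = 2 * CARD('n)" .
    moreover have "dim {u. p \<bullet> u = 0} = 2 * CARD('n)"
      using p dim by (subst dim_hyperplane) auto
    ultimately have "range (\<lambda>w. D w z) = {u. p \<bullet> u = 0}"
      by (intro subspace_dim_equal sub subspace_hyperplane linear_subspace_image lin W) auto
    then have "u \<in> range (\<lambda>w. D w z)" using that by simp
    then obtain w where "u = D w z" by (rule rangeE)
    then show ?thesis by blast
  qed
  \<comment> \<open>This is the (1,0)-field of d\<psi> w along the chart. Replacing J (d\<psi> w) by
    d\<psi> (\<i> w) makes it differentiable without differentiating \<open>J\<close>; integrability
    enters here.\<close>
  define \<sigma> where "\<sigma> = (\<lambda>w y. cvec (D w y) - \<i> *s cvec (D (\<i> *s w) y))"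
  have \<sigma>: "\<sigma> w y = hol (\<psi> y) (D w y)" if "y \<in> W" for w y
    using hol_eq[OF sph[OF that]] J[OF that] by (simp add: \<sigma>_def)
  define S where "S = (\<lambda>v w. cvec (H v w) - \<i> *s cvec (H v (\<i> *s w)))"
  have S: "(\<sigma> w has_derivative (\<lambda>v. S v w)) (at z)" for w
    unfolding \<sigma>_def S_def
    by (intro has_derivative_diff bounded_linear.has_derivative[OF bounded_linear_cvec] H
        bounded_linear.has_derivative[OF bounded_linear_smult])
  \<comment> \<open>Twice the Wirtinger derivative of \<open>\<sigma> w\<close> in the direction
    \<open>v\<close>.\<close>
  define E where "E = (\<lambda>v w. S v w - \<i> *s S (\<i> *s v) w)"
  have Esym: "E v w = E w v" for v w
    unfolding E_def S_def Hsym[of v w] Hsym[of v "\<i> *s w"] Hsym[of "\<i> *s v" w] Hsym[of "\<i> *s v" "\<i> *s w"]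
    by (simp add: vec_eq_iff algebra_simps)
  \<comment> \<open>The real part vanishes because J is orthogonal, the imaginary part because J is
    skew.\<close>
  have \<sigma>\<sigma>: "cdot (\<sigma> w y) (\<sigma> u y) = 0" if y: "y \<in> W" for w u y
  proof -
    note t = tan[OF y] and Jp = J_props[OF sph[OF y] tan[OF y] tan[OF y]] and sk = J_skew[OF sph[OF y] tan[OF y] tan[OF y]]
    have c: "cdot (cvec a) (cvec b) = of_real (a \<bullet> b)" for a b :: "real^'m"
      by (simp add: cdot_def cvec_def inner_vec_def)
    have "cdot (\<sigma> w y) (\<sigma> u y) = of_real (D w y \<bullet> D u y) - of_real (J (\<psi> y) (D w y) \<bullet> J (\<psi> y) (D u y))
       - \<i> * (of_real (J (\<psi> y) (D w y) \<bullet> D u y) + of_real (D w y \<bullet> J (\<psi> y) (D u y)))"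
      unfolding \<sigma>[OF y] hol_eq[OF sph[OF y]] by (simp add: cdot_simps c algebra_simps)
    then show ?thesis using Jp(5) sk by simp
  qed
  have ES: "cdot (E v w) (\<sigma> u z) + cdot (\<sigma> w z) (E v u) = 0" for v w u
  proof -
    have *: "cdot (\<sigma> w z) (S v u) + cdot (S v w) (\<sigma> u z) = 0" for v
      by (rule has_derivative_unique_open[OF bounded_bilinear.FDERIV[OF bounded_bilinear_cdot S S] has_derivative_const W])
        (rule \<sigma>\<sigma>)
    have "cdot (E v w) (\<sigma> u z) + cdot (\<sigma> w z) (E v u) =
       (cdot (\<sigma> w z) (S v u) + cdot (S v w) (\<sigma> u z)) - \<i> * (cdot (\<sigma> w z) (S (\<i> *s v) u) + cdot (S (\<i> *s v) w) (\<sigma> u z))"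
      by (simp add: E_def cdot_simps algebra_simps)
    then show ?thesis using * by simp
  qed
  have E0: "cdot (E v w) (\<sigma> u z) = 0" for v w u
  proof -
    define B where "B = (\<lambda>v w u. cdot (E v w) (\<sigma> u z))"
    have s: "B v w u = B w v u" for v w u by (simp add: B_def Esym)
    have t: "B v w u = - B v u w" for v w u
      using ES[of v w u] unfolding B_def by (simp add: cdot_commute add_eq_0_iff)
    have "B v w u = - B v w u" by (metis s t add.inverse_inverse)
    then have "B v w u = 0" by simp
    then show ?thesis by (simp add: B_def)
  qed
  \<comment> \<open>Differentiating \<psi> \<bullet> \<sigma> w = 0 trades the normal component of S
    for - d\<psi> v \<bullet> \<sigma> w. In the combination E these terms assemble to - \<sigma> v
    \<bullet> \<sigma> w, which is zero.\<close>
  have Ep: "cdot (cvec p) (E v w) = 0" for v w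
  proof -
    have *: "cdot (cvec (\<psi> z)) (S v w) + cdot (cvec (D v z)) (\<sigma> w z) = 0" for v
    proof (rule has_derivative_unique_open[OF bounded_bilinear.FDERIV[OF bounded_bilinear_cdot
            bounded_linear.has_derivative[OF bounded_linear_cvec D[OF W(2)]] S] has_derivative_const W])
      fix y assume y: "y \<in> W"
      show "cdot (cvec (\<psi> y)) (\<sigma> w y) = 0"
        using normal_hol[OF sph[OF y] tan[OF y]] by (simp add: \<sigma>[OF y] cdot_def cvec_def)
    qed
    have "cdot (cvec p) (E v w) = (cdot (cvec (\<psi> z)) (S v w) + cdot (cvec (D v z)) (\<sigma> w z))
       - \<i> * (cdot (cvec (\<psi> z)) (S (\<i> *s v) w) + cdot (cvec (D (\<i> *s v) z)) (\<sigma> w z)) - cdot (\<sigma> v z) (\<sigma> w z)"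
      unfolding zp by (simp add: E_def \<sigma>_def[THEN fun_cong, THEN fun_cong, of v z] cdot_simps algebra_simps)
    then show ?thesis using * \<sigma>\<sigma>[OF W(2)] by simp
  qed
  have column: "\<exists>w. column b (PT p) = (1/2) *s \<sigma> w z" for b
  proof -
    obtain w where "D w z = tproj p (axis b 1)" using onto[of "tproj p (axis b 1)"] tproj_tangent[OF p] by blast
    then have "column b (PT p) = (1/2) *s \<sigma> w z" using PT_column[OF p, of b] \<sigma>[OF W(2), of w] zp by simp
    then show ?thesis by (rule exI)
  qed
  \<comment> \<open>In the resolution of the identity, the (0,1)-part of E pairs it with the
    (1,0)-columns of PT, which \<open>E0\<close> makes zero, and the normal part is zero by
    \<open>Ep\<close>. So E is of type (1,0).\<close>
  have PE: "PT p *v E v w = E v w" for v w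
  proof -
    have "E v w $ a = (PT p *v E v w) $ a" for a
    proof -
      obtain w' where w': "column a (PT p) = (1/2) *s \<sigma> w' z" using column by blast
      have "E v w $ a = (\<Sum>b\<in>UNIV. (if a = b then 1 else 0) * E v w $ b)"
        by (simp add: if_distrib[of "\<lambda>x. x * _"] cong: if_cong)
      also have "\<dots> = (\<Sum>b\<in>UNIV. (PT p $ a $ b + PT p $ b $ a + of_real (p $ a * p $ b)) * E v w $ b)"
        unfolding PT_decomposition[OF p] ..
      also have "\<dots> = (PT p *v E v w) $ a + cdot (column a (PT p)) (E v w) + of_real (p $ a) * cdot (cvec p) (E v w)"
        by (simp add: matrix_vector_mult_def cdot_def column_def cvec_def ring_distribs sum.distrib sum_distrib_left mult_ac)
      also have "cdot (column a (PT p)) (E v w) = 0"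
        unfolding w' cdot_simps cdot_commute[of _ "E v w"] E0 by simp
      finally show ?thesis by (simp add: Ep)
    qed
    then show ?thesis by (simp add: vec_eq_iff)
  qed
  have cont: "continuous_on W \<psi>" by (rule C_on_imp_continuous_on[OF C2])
  define W' where "W' = W \<inter> \<psi> -` V"
  have W': "open W'" "z \<in> W'"
    using continuous_open_preimage[OF cont W(1) V(1)] W(2) V(2) zp by (auto simp: W'_def)
  let ?D = "frechet_derivative Q (at p)"
  have dQ: "(Q has_derivative ?D) (at (\<psi> z))"
    unfolding zp by (rule C_on_1D(1)[OF V(3,2)])
  have Qp: "Q (\<psi> z) = PT p" using V(2,4) p zp by simp
  have linQ: "linear ?D" using has_derivative_linear[OF dQ] .
  \<comment> \<open>Differentiating PT \<sigma> = \<sigma> gives (dPT) \<sigma> = (1 - PT) S. The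
    combination that defines E turns the right side into (1 - PT) E = 0.\<close>
  have key: "?D (D v z) *v \<sigma> w z = \<i> *s (?D (D (\<i> *s v) z) *v \<sigma> w z)" for v w
  proof -
    have *: "Q (\<psi> z) *v S v w + ?D (D v z) *v \<sigma> w z = S v w" for v
    proof (rule has_derivative_unique_open[OF bounded_bilinear.FDERIV[OF bounded_bilinear_matrix_vector
            has_derivative_compose[OF D[OF W(2)] dQ] S] S W'])
      fix y assume y: "y \<in> W'"
      then have y': "y \<in> W" "\<psi> y \<in> V" by (auto simp: W'_def)
      show "Q (\<psi> y) *v \<sigma> w y = \<sigma> w y"
        using PT_hol[OF sph[OF y'(1)] tan[OF y'(1)]] V(4)[OF y'(2) sph[OF y'(1)]] \<sigma>[OF y'(1)] by simp
    qed
    have e: "?D (D v z) *v \<sigma> w z = S v w - PT p *v S v w" for v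
      using *[of v] unfolding Qp by (simp add: eq_diff_eq add.commute)
    have "?D (D v z) *v \<sigma> w z - \<i> *s (?D (D (\<i> *s v) z) *v \<sigma> w z)
      = (S v w - PT p *v S v w) - \<i> *s (S (\<i> *s v) w - PT p *v S (\<i> *s v) w)"
      unfolding e ..
    also have "\<dots> = E v w - PT p *v E v w"
      by (simp add: E_def matrix_vector_mult_diff_distrib vector_scalar_commute vector_ssub_ldistrib algebra_simps)
    finally show ?thesis using PE by simp
  qed
  obtain v where v: "D v z = u" using onto[OF u] by blast
  then have Jv: "D (\<i> *s v) z = J p u" using J[OF W(2), of v] zp by simp
  obtain w where w: "column b (PT p) = (1/2) *s \<sigma> w z" using column by blast
  have ent: "(M ** PT p) $ a $ b = (M *v column b (PT p)) $ a" for M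
    by (simp add: matrix_matrix_mult_def matrix_vector_mult_def column_def)
  have "(?D u ** PT p) $ a $ b = (1/2) * (\<i> *s (?D (J p u) *v \<sigma> w z)) $ a"
    unfolding ent w using key[of v w] v Jv by (simp add: vector_scalar_commute)
  also have "\<dots> = \<i> * (?D (J p u) ** PT p) $ a $ b"
    unfolding ent w by (simp add: vector_scalar_commute)
  finally show ?thesis by simp
qed

end

section \<open>Stereographic coordinates\<close>

lemma conf_eq: "conf x * (1 + x \<bullet> x) = 2"
proof -
  have "1 + x \<bullet> x \<noteq> 0" using inner_ge_zero[of x] by linarith
  then show ?thesis by (simp add: conf_def power2_norm_eq_inner nonzero_divide_eq_eq)
qed

lemma C_on_conf: "C_on k UNIV (conf :: real^'n \<Rightarrow> real)"
proof -
  have "1 + x \<bullet> x \<noteq> 0" for x :: "real^'n" using inner_ge_zero[of x] by linarith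
  then show ?thesis
    unfolding conf_def[abs_def] power2_norm_eq_inner
    by (intro C_on_divide[OF open_UNIV] C_on_add[OF open_UNIV] C_on_inner[OF open_UNIV] C_on_ident[OF open_UNIV] C_on_const) auto
qed

lemma conf_has_derivative:
  "((conf :: real^'n \<Rightarrow> real) has_derivative (\<lambda>v. - ((conf x)\<^sup>2 * (x \<bullet> v)))) (at x)"
proof -
  have nz: "1 + x \<bullet> x \<noteq> 0" using inner_ge_zero[of x] by linarith
  have "((\<lambda>x. 2 / (1 + x \<bullet> x)) has_derivative (\<lambda>v. - ((2 / (1 + x \<bullet> x))\<^sup>2 * (x \<bullet> v)))) (at x)"
    using nz by (auto intro!: derivative_eq_intros simp: inner_commute power2_eq_square field_simps)
  then show ?thesis unfolding conf_def[abs_def] power2_norm_eq_inner .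
qed

text \<open>\<open>E\<close> identifies Euclidean space isometrically with the hyperplane orthogonal
  to the pole \<open>q\<close>. The pole is the limit of \<Phi> at infinity, and \<Phi> 0 = - q. The
  abstract \<open>E\<close> avoids any matching of the index types 'n and 'm.\<close>

locale stereographic =
  fixes E :: "real^'n \<Rightarrow> real^'m" and q :: "real^'m"
  assumes linE: "linear E" and normE: "\<And>x. norm (E x) = norm x"
    and q: "norm q = 1" and Eq: "\<And>x. E x \<bullet> q = 0" and card: "CARD('m) = CARD('n) + 1"
begin

definition \<Phi> :: "real^'n \<Rightarrow> real^'m" where
  "\<Phi> x = conf x *\<^sub>R E x + (1 - conf x) *\<^sub>R q"

definition D\<Phi> :: "real^'n \<Rightarrow> real^'n \<Rightarrow> real^'m" where
  "D\<Phi> x v = conf x *\<^sub>R E v - ((conf x)\<^sup>2 * (x \<bullet> v)) *\<^sub>R (E x - q)"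

lemma EE: "E x \<bullet> E y = x \<bullet> y"
  using normE[of "x + y"] by (simp add: dot_norm linear_add[OF linE, symmetric] normE)

lemma qE: "q \<bullet> E x = 0"
  using Eq[of x] by (simp add: inner_commute)

lemma qq: "q \<bullet> q = 1" using q by (simp add: norm_eq_1)

lemma \<Phi>_sphere: "\<Phi> x \<in> unit_sphere"
proof -
  have "\<Phi> x \<bullet> \<Phi> x = (conf x)\<^sup>2 * (x \<bullet> x) + (1 - conf x)\<^sup>2"
    by (simp add: \<Phi>_def inner_add_left inner_add_right EE Eq qE qq power2_eq_square)
  also have "\<dots> = conf x * (conf x * (1 + x \<bullet> x)) + 1 - 2 * conf x"
    by (simp add: power2_eq_square algebra_simps)
  also have "\<dots> = 1" unfolding conf_eq by simp
  finally show ?thesis by (simp add: norm_eq_1)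
qed

lemma C_on_\<Phi>: "C_on k UNIV \<Phi>"
proof -
  have "bounded_linear E" using linE by (simp add: linear_conv_bounded_linear)
  then show ?thesis unfolding \<Phi>_def[abs_def]
    by (intro C_on_add[OF open_UNIV] C_on_scaleR[OF open_UNIV] C_on_conf C_on_const C_on_diff[OF open_UNIV]
        C_on_linear[OF open_UNIV _ C_on_ident[OF open_UNIV]])
qed

lemma \<Phi>_has_derivative: "(\<Phi> has_derivative D\<Phi> x) (at x)"
proof -
  have bl: "(E has_derivative E) (at x)"
    using linE by (simp add: linear_conv_bounded_linear bounded_linear_imp_has_derivative)
  have "(\<Phi> has_derivative (\<lambda>v. (conf x *\<^sub>R E v + (- ((conf x)\<^sup>2 * (x \<bullet> v))) *\<^sub>R E x)
      + ((1 - conf x) *\<^sub>R 0 + (0 - (- ((conf x)\<^sup>2 * (x \<bullet> v)))) *\<^sub>R q))) (at x)"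
    unfolding \<Phi>_def[abs_def]
    by (intro has_derivative_add has_derivative_scaleR has_derivative_diff has_derivative_const conf_has_derivative bl)
  then show ?thesis
    by (rule has_derivative_eq_rhs) (simp add: D\<Phi>_def fun_eq_iff algebra_simps)
qed

lemma D\<Phi>_tangent: "\<Phi> x \<bullet> D\<Phi> x v = 0"
proof -
  have "\<Phi> x \<bullet> D\<Phi> x v + D\<Phi> x v \<bullet> \<Phi> x = 0"
  proof (rule has_derivative_unique_open[OF has_derivative_inner[OF \<Phi>_has_derivative \<Phi>_has_derivative] has_derivative_const open_UNIV UNIV_I])
    show "\<Phi> y \<bullet> \<Phi> y = 1" for y using \<Phi>_sphere[of y] by (simp add: norm_eq_1)
  qed
  then show ?thesis by (simp add: inner_commute)
qed

text \<open>Conformality: the terms in (x \<bullet> v)^2 cancel because conf x (1 + |x|^2) =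
  2.\<close>

lemma norm_D\<Phi>: "norm (D\<Phi> x v) = conf x * norm v"
proof -
  let ?l = "conf x" and ?s = "x \<bullet> v"
  have "D\<Phi> x v \<bullet> D\<Phi> x v = ?l\<^sup>2 * (v \<bullet> v) - 2 * ?l ^ 3 * ?s\<^sup>2 + ?l ^ 3 * ?s\<^sup>2 * (?l * (1 + x \<bullet> x))"
    by (simp add: D\<Phi>_def inner_diff_left inner_diff_right EE Eq qE qq inner_commute[of v x])
      (simp add: power2_eq_square power3_eq_cube algebra_simps)
  also have "\<dots> = (?l * norm v)\<^sup>2"
    unfolding conf_eq by (simp add: power_mult_distrib power2_norm_eq_inner)
  finally have "(norm (D\<Phi> x v))\<^sup>2 = (?l * norm v)\<^sup>2" by (simp add: power2_norm_eq_inner)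
  then show ?thesis using conf_pos[of x] by simp
qed

lemma D\<Phi>_onto:
  assumes "\<Phi> x \<bullet> u = 0"
  obtains w where "D\<Phi> x w = u"
proof -
  have lin: "linear (D\<Phi> x)" using has_derivative_linear[OF \<Phi>_has_derivative] .
  have "inj (D\<Phi> x)"
  proof (rule linear_injective_0[OF lin, THEN iffD2, rule_format])
    fix v assume "D\<Phi> x v = 0"
    then show "v = 0" using norm_D\<Phi>[of x v] conf_pos[of x] by simp
  qed
  then have "dim (range (D\<Phi> x)) = dim (UNIV :: (real^'n) set)"
    by (intro dim_image_eq lin) (auto simp: inj_on_def)
  then have 1: "dim (range (D\<Phi> x)) = CARD('n)" by simp
  have "\<Phi> x \<noteq> 0" using \<Phi>_sphere[of x] by auto
  then have 2: "dim {u. \<Phi> x \<bullet> u = 0} = CARD('n)"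
    using card by (subst dim_hyperplane) auto
  have "range (D\<Phi> x) = {u. \<Phi> x \<bullet> u = 0}"
  proof (rule subspace_dim_equal)
    show "subspace (range (D\<Phi> x))" by (intro linear_subspace_image lin) simp
    show "range (D\<Phi> x) \<subseteq> {u. \<Phi> x \<bullet> u = 0}" using D\<Phi>_tangent by auto
  qed (use 1 2 subspace_hyperplane in auto)
  then have "u \<in> range (D\<Phi> x)" using assms by simp
  then show thesis using that by auto
qed

end

lemma ex_stereographic:
  assumes "CARD('m::finite) = CARD('n::finite) + 1"
  shows "\<exists>(E :: real^'n \<Rightarrow> real^'m) q. stereographic E q"
proof -
  define q :: "real^'m" where "q = axis undefined 1"
  have q: "norm q = 1" by (simp add: q_def norm_axis_1)
  have "dim {u. q \<bullet> u = 0} = CARD('n)"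
    using q assms by (subst dim_hyperplane) auto
  then have d: "dim (UNIV :: (real^'n) set) \<le> dim {u. q \<bullet> u = 0}" by simp
  obtain E :: "real^'n \<Rightarrow> real^'m" where E: "linear E" "E \<in> UNIV \<rightarrow> {u. q \<bullet> u = 0}" "\<And>x. x \<in> UNIV \<Longrightarrow> norm (E x) = norm x"
    using isometry_subset_subspace[OF subspace_UNIV subspace_hyperplane d] by blast
  have "E x \<bullet> q = 0" for x using E(2) by (simp add: Pi_iff inner_commute)
  then have "stereographic E q"
    by (rule stereographic.intro[OF E(1) E(3)[OF UNIV_I] q _ assms])
  then show ?thesis by blast
qed

section \<open>Two-sided bounds for the curvature form of the sphere\<close>

lemma curvature_form_eval:
  fixes P :: "real^'n \<Rightarrow> complex^'m^'m"
  assumes D: "(P has_derivative D) (at x)"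
  shows "w \<bullet> (curvature_form P x *v v) = Im (trace (P x ** D w ** D v) - trace (P x ** D v ** D w))"
proof -
  have fD: "frechet_derivative P (at x) = D" using frechet_derivative_at[OF D] by simp
  have lin: "linear D" using has_derivative_linear[OF D] .
  define \<beta> where "\<beta> = (\<lambda>a b. Im (trace (P x ** D a ** D b) - trace (P x ** D b ** D a)))"
  note mm = bounded_bilinear.add_left[OF bounded_bilinear_matrix_mult] bounded_bilinear.add_right[OF bounded_bilinear_matrix_mult]
    bounded_bilinear.scaleR_left[OF bounded_bilinear_matrix_mult] bounded_bilinear.scaleR_right[OF bounded_bilinear_matrix_mult]
    linear_cmul[OF bounded_linear.linear[OF bounded_linear_trace]]
  have l1: "linear (\<beta> a)" and l2: "linear (\<lambda>a. \<beta> a b)" for a b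
    by (rule linearI; simp add: \<beta>_def linear_add[OF lin] linear_cmul[OF lin] mm trace_add algebra_simps)+
  have "\<beta> w v = (\<Sum>i\<in>UNIV. w $ i *\<^sub>R \<beta> (axis i 1) v)" by (rule linear_axis_sum[OF l2])
  also have "\<dots> = (\<Sum>i\<in>UNIV. w $ i * (\<Sum>j\<in>UNIV. v $ j * \<beta> (axis i 1) (axis j 1)))"
    by (subst linear_axis_sum[OF l1]) simp
  also have "\<dots> = w \<bullet> (curvature_form P x *v v)"
    by (simp add: inner_vec_def matrix_vector_mult_def curvature_form_def Let_def fD \<beta>_def mult.commute)
  finally show ?thesis by (simp add: \<beta>_def)
qed

locale stereographic_structure = orthogonal_structure J + stereographic E q
  for J :: "real^'m \<Rightarrow> real^'m \<Rightarrow> real^'m" and E :: "real^'n \<Rightarrow> real^'m" and q :: "real^'m"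
begin

definition P :: "real^'n \<Rightarrow> complex^'m^'m" where
  "P x = PT (\<Phi> x)"

lemma P_idem: "P x ** P x = P x"
  unfolding P_def by (rule PT_idem[OF \<Phi>_sphere])

lemma P_extension:
  assumes V: "open V" "\<And>y. y \<in> V \<Longrightarrow> y \<in> unit_sphere \<Longrightarrow> Q y = PT y"
    and C: "C_on k V Q"
  shows "open (\<Phi> -` V)" "C_on k (\<Phi> -` V) P"
proof -
  have "continuous_on UNIV \<Phi>" by (rule C_on_imp_continuous_on[OF C_on_\<Phi>[of 0]])
  then show o: "open (\<Phi> -` V)" using V(1) by (simp add: open_vimage)
  have "C_on k (\<Phi> -` V) (\<lambda>x. Q (\<Phi> x))"
    by (rule C_on_compose[OF o V(1) C C_on_subset[OF C_on_\<Phi>]]) auto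
  moreover have "P x = Q (\<Phi> x)" if "x \<in> \<Phi> -` V" for x
    using V(2)[OF _ \<Phi>_sphere] that by (simp add: P_def)
  ultimately show "C_on k (\<Phi> -` V) P" using C_on_cong[OF o, of P "\<lambda>x. Q (\<Phi> x)" k] by blast
qed

lemma C_on_P: "C_on k UNIV P"
proof (rule C_on_local)
  fix x
  obtain V Q where V: "open V" "\<Phi> x \<in> V" "\<And>k. C_on k V Q" "\<And>y. y \<in> V \<Longrightarrow> y \<in> unit_sphere \<Longrightarrow> Q y = PT y"
    using PT_smooth_extension[OF \<Phi>_sphere] by blast
  show "\<exists>U. open U \<and> x \<in> U \<and> C_on k U P"
    using P_extension[OF V(1,4,3)] V(2) by (intro exI[of _ "\<Phi> -` V"]) auto
qed

lemma P_derivative: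
  assumes V: "open V" "\<And>y. y \<in> V \<Longrightarrow> y \<in> unit_sphere \<Longrightarrow> Q y = PT y"
    and C: "C_on 1 V Q" and x: "\<Phi> x \<in> V"
  shows "frechet_derivative P (at x) v = frechet_derivative Q (at (\<Phi> x)) (D\<Phi> x v)"
proof -
  have xV: "x \<in> \<Phi> -` V" using x unfolding vimage_eq .
  have eq: "P y = Q (\<Phi> y)" if "y \<in> \<Phi> -` V" for y
    using V(2)[OF _ \<Phi>_sphere] that by (simp add: P_def)
  show ?thesis
    by (rule has_derivative_unique_open[OF C_on_1D(1)[OF C_on_P UNIV_I]
          has_derivative_compose[OF \<Phi>_has_derivative C_on_1D(1)[OF C x]] P_extension(1)[OF V C] xV eq])
qed

text \<open>Measuring derivatives against \<open>D\<Phi> x v\<close> makes the bound a statement on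
  the sphere. It therefore also holds around the pole, which \<Phi> never reaches.\<close>

lemma P_local_bound:
  assumes p: "p \<in> unit_sphere"
  shows "\<exists>V M. open V \<and> p \<in> V \<and>
     (\<forall>x. \<Phi> x \<in> V \<longrightarrow> norm (P x) \<le> M \<and> (\<forall>v. norm (frechet_derivative P (at x) v) \<le> M * norm (D\<Phi> x v)))"
proof -
  obtain V Q where V: "open V" "p \<in> V" "\<And>k. C_on k V Q" "\<And>y. y \<in> V \<Longrightarrow> y \<in> unit_sphere \<Longrightarrow> Q y = PT y"
    using PT_smooth_extension[OF p] by blast
  \<comment> \<open>A continuous function that dominates \<open>Q\<close> and the operator norm of
    its derivative; where it is below g p + 1, both are controlled.\<close>
  define g where "g = (\<lambda>y. norm (Q y) + (\<Sum>b\<in>Basis. norm (frechet_derivative Q (at y) b)))"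
  have g: "continuous_on V g"
    unfolding g_def
    by (intro continuous_intros C_on_imp_continuous_on[OF V(3)[of 0]] C_on_1D(2)[OF V(3)])
  define V' where "V' = V \<inter> g -` {..<g p + 1}"
  have V': "open V'" "p \<in> V'"
    using continuous_open_preimage[OF g V(1), of "{..<g p + 1}"] V(2) by (auto simp: V'_def)
  have "norm (P x) \<le> g p + 1 \<and> (\<forall>v. norm (frechet_derivative P (at x) v) \<le> (g p + 1) * norm (D\<Phi> x v))"
    if "\<Phi> x \<in> V'" for x
  proof -
    have x: "\<Phi> x \<in> V" and gx: "g (\<Phi> x) \<le> g p + 1" using that by (auto simp: V'_def)
    have s: "0 \<le> (\<Sum>b\<in>Basis. norm (frechet_derivative Q (at (\<Phi> x)) b))" by (intro sum_nonneg) auto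
    have "norm (P x) \<le> g (\<Phi> x)"
      using V(4)[OF x \<Phi>_sphere] s by (simp add: g_def P_def)
    moreover have "norm (frechet_derivative P (at x) v) \<le> (g p + 1) * norm (D\<Phi> x v)" for v
    proof -
      let ?u = "D\<Phi> x v" and ?D = "frechet_derivative Q (at (\<Phi> x))"
      have lin: "linear ?D" using has_derivative_linear[OF C_on_1D(1)[OF V(3) x]] .
      have "norm (?D ?u) \<le> (\<Sum>b\<in>Basis. norm ((?u \<bullet> b) *\<^sub>R ?D b))"
        by (subst linear_basis_sum[OF lin]) (rule norm_sum)
      also have "\<dots> \<le> (\<Sum>b\<in>Basis. norm ?u * norm (?D b))"
        by (intro sum_mono) (auto intro!: mult_right_mono Basis_le_norm)
      also have "\<dots> \<le> norm ?u * g (\<Phi> x)"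
        unfolding sum_distrib_left[symmetric] g_def by (intro mult_left_mono) auto
      also have "\<dots> \<le> norm ?u * (g p + 1)" by (intro mult_left_mono gx) auto
      finally show ?thesis
        using P_derivative[OF V(1,4,3) x, of v] by (simp add: mult.commute)
    qed
    ultimately show ?thesis using gx by simp
  qed
  then show ?thesis using V' by blast
qed

text \<open>Finitely many of the local bounds suffice because the sphere is compact, and
  conformality rewrites them with \<open>conf x\<close>.\<close>

lemma P_bound:
  obtains M where "M \<ge> 0" "\<And>x. norm (P x) \<le> M" "\<And>x v. norm (frechet_derivative P (at x) v) \<le> M * (conf x * norm v)"
proof -
  have "\<forall>p\<in>unit_sphere. \<exists>V. \<exists>M. open V \<and> p \<in> V \<and>
     (\<forall>x. \<Phi> x \<in> V \<longrightarrow> norm (P x) \<le> M \<and> (\<forall>v. norm (frechet_derivative P (at x) v) \<le> M * norm (D\<Phi> x v)))"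
    using P_local_bound by blast
  from bchoice[OF this] obtain V where "\<forall>p\<in>unit_sphere. \<exists>M. open (V p) \<and> p \<in> V p \<and>
     (\<forall>x. \<Phi> x \<in> V p \<longrightarrow> norm (P x) \<le> M \<and> (\<forall>v. norm (frechet_derivative P (at x) v) \<le> M * norm (D\<Phi> x v)))"
    by blast
  from bchoice[OF this] obtain M where VM: "\<forall>p\<in>unit_sphere. open (V p) \<and> p \<in> V p \<and>
     (\<forall>x. \<Phi> x \<in> V p \<longrightarrow> norm (P x) \<le> M p \<and> (\<forall>v. norm (frechet_derivative P (at x) v) \<le> M p * norm (D\<Phi> x v)))"
    by blast
  have "compact (unit_sphere :: (real^'m) set)" by simp
  moreover have "open (V p)" if "p \<in> unit_sphere" for p using VM that by blast
  moreover have "unit_sphere \<subseteq> (\<Union>p\<in>unit_sphere. V p)" using VM by blast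
  ultimately obtain K where K: "K \<subseteq> unit_sphere" "finite K" "unit_sphere \<subseteq> (\<Union>p\<in>K. V p)"
    by (rule compactE_image)
  define B where "B = (\<Sum>p\<in>K. \<bar>M p\<bar>)"
  have all: "norm (P x) \<le> B \<and> norm (frechet_derivative P (at x) v) \<le> B * norm (D\<Phi> x v)" for x v
  proof -
    have "\<Phi> x \<in> (\<Union>p\<in>K. V p)" using K(3) \<Phi>_sphere by blast
    then obtain p where p: "p \<in> K" "\<Phi> x \<in> V p" by blast
    have "\<bar>M p\<bar> \<le> B" unfolding B_def using K(2) p(1) by (intro member_le_sum) auto
    then have MB: "M p \<le> B" by simp
    have "norm (P x) \<le> M p" "norm (frechet_derivative P (at x) v) \<le> M p * norm (D\<Phi> x v)"
      using VM p K(1) by blast+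
    then show ?thesis using MB mult_right_mono[OF MB, of "norm (D\<Phi> x v)"] by simp
  qed
  show thesis
  proof (rule that)
    show "B \<ge> 0" by (simp add: B_def sum_nonneg)
    show "norm (P x) \<le> B" for x using all by blast
    show "norm (frechet_derivative P (at x) v) \<le> B * (conf x * norm v)" for x v
      using all[of x v] by (simp add: norm_D\<Phi>)
  qed
qed

text \<open>Each of the two derivatives of P contributes one factor \<open>conf x\<close>;
  \<open>K\<close> and \<open>L\<close> are norm constants of the matrix product and of the
  trace.\<close>

lemma curvature_bound:
  obtains M where "\<And>x i j. \<bar>curvature_form P x $ i $ j\<bar> \<le> M * (conf x)\<^sup>2"
proof -
  obtain B where B: "B \<ge> 0" "\<And>x. norm (P x) \<le> B" "\<And>x v. norm (frechet_derivative P (at x) v) \<le> B * (conf x * norm v)"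
    using P_bound by blast
  obtain K where K: "K > 0" "\<And>(A :: complex^'m^'m) (C :: complex^'m^'m). norm (A ** C) \<le> norm A * norm C * K"
    using bounded_bilinear.pos_bounded[OF bounded_bilinear_matrix_mult] by blast
  obtain L where L: "L > 0" "\<And>A :: complex^'m^'m. norm (trace A) \<le> norm A * L"
    using bounded_linear.pos_bounded[OF bounded_linear_trace] by blast
  have t: "norm (trace (P x ** frechet_derivative P (at x) (axis i 1) ** frechet_derivative P (at x) (axis j 1)))
      \<le> (B * B * K * B * K * L) * (conf x)\<^sup>2" for x i j
  proof -
    let ?A = "frechet_derivative P (at x) (axis i 1)" and ?C = "frechet_derivative P (at x) (axis j 1)"
    have A: "norm ?A \<le> B * conf x" and C: "norm ?C \<le> B * conf x"
      using B(3)[of x "axis i 1"] B(3)[of x "axis j 1"] by (simp_all add: norm_axis_1)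
    have "norm (trace (P x ** ?A ** ?C)) \<le> norm (P x ** ?A ** ?C) * L" by (rule L)
    also have "\<dots> \<le> (norm (P x ** ?A) * norm ?C * K) * L"
      by (rule mult_right_mono[OF K(2)]) (use L(1) in simp)
    also have "\<dots> \<le> ((norm (P x) * norm ?A * K) * norm ?C * K) * L"
      by (rule mult_right_mono[OF mult_right_mono[OF mult_right_mono[OF K(2)]]]) (use L(1) K(1) in auto)
    also have "\<dots> \<le> ((B * (B * conf x) * K) * (B * conf x) * K) * L"
      using L(1) K(1) B(1) conf_pos[of x] by (intro mult_right_mono mult_mono B A C) auto
    finally show ?thesis by (simp add: power2_eq_square mult_ac)
  qed
  have "\<bar>curvature_form P x $ i $ j\<bar> \<le> 2 * (B * B * K * B * K * L) * (conf x)\<^sup>2" for x i j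
  proof -
    have "\<bar>curvature_form P x $ i $ j\<bar> \<le>
      norm (trace (P x ** frechet_derivative P (at x) (axis i 1) ** frechet_derivative P (at x) (axis j 1))
       - trace (P x ** frechet_derivative P (at x) (axis j 1) ** frechet_derivative P (at x) (axis i 1)))"
      unfolding curvature_form_def Let_def vec_lambda_beta by (rule abs_Im_le_cmod)
    also have "\<dots> \<le> (B * B * K * B * K * L) * (conf x)\<^sup>2 + (B * B * K * B * K * L) * (conf x)\<^sup>2"
      by (rule order_trans[OF norm_triangle_ineq4 add_mono[OF t t]])
    finally show ?thesis by (simp only: mult_2 distrib_right)
  qed
  then show thesis by (rule that)
qed

lemma P_derivative_hermitian:
  "frechet_derivative P (at x) v $ a $ b = cnj (frechet_derivative P (at x) v $ b $ a)"
proof -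
  have D: "(P has_derivative frechet_derivative P (at x)) (at x)" by (rule C_on_1D(1)[OF C_on_P UNIV_I])
  have 1: "((\<lambda>x. P x $ a $ b) has_derivative (\<lambda>v. frechet_derivative P (at x) v $ a $ b)) (at x)" for a b
    by (intro bounded_linear.has_derivative[OF bounded_linear_vec_nth] D)
  show ?thesis
    by (rule has_derivative_unique_open[OF 1 bounded_linear.has_derivative[OF bounded_linear_cnj 1] open_UNIV UNIV_I])
      (unfold P_def, rule PT_hermitian[OF \<Phi>_sphere])
qed

lemma matrix_mult_hermitian:
  fixes A B :: "complex^'m^'m"
  assumes "\<And>a b. A $ a $ b = cnj (A $ b $ a)" "\<And>a b. B $ a $ b = cnj (B $ b $ a)"
  shows "(A ** B) $ a $ b = cnj ((B ** A) $ b $ a)"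
proof -
  have "A $ a $ k * B $ k $ b = cnj (B $ b $ k * A $ k $ a)" for k
    using assms(1)[of a k] assms(2)[of k b] by simp
  then show ?thesis by (simp add: matrix_matrix_mult_def)
qed

text \<open>Since \<open>p\<^sup>T P = 0\<close>, the row \<open>p\<^sup>T dP P\<close> equals \<open>- (d\<Phi> v)\<^sup>T P\<close>: this normal component of the second
  fundamental form never vanishes.\<close>

lemma second_fundamental_form_lower_bound:
  fixes x v
  defines "B \<equiv> frechet_derivative P (at x) v ** P x"
  shows "(conf x * norm v)\<^sup>2 \<le> 2 * (\<Sum>b\<in>UNIV. \<Sum>a\<in>UNIV. (cmod (B $ a $ b))\<^sup>2)"
proof -
  let ?A = "frechet_derivative P (at x) v" and ?p = "\<Phi> x" and ?u = "D\<Phi> x v"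
  have D: "(P has_derivative frechet_derivative P (at x)) (at x)" by (rule C_on_1D(1)[OF C_on_P UNIV_I])
  have dP: "((\<lambda>x. P x $ a $ b) has_derivative (\<lambda>v. frechet_derivative P (at x) v $ a $ b)) (at x)" for a b
    by (intro bounded_linear.has_derivative[OF bounded_linear_vec_nth] D)
  have d\<Phi>: "((\<lambda>x. complex_of_real (\<Phi> x $ a)) has_derivative (\<lambda>v. complex_of_real (D\<Phi> x v $ a))) (at x)" for a
    by (intro bounded_linear.has_derivative[OF bounded_linear_of_real]
        bounded_linear.has_derivative[OF bounded_linear_vec_nth] \<Phi>_has_derivative)
  have n: "(\<Sum>a\<in>UNIV. of_real (?p $ a) * ?A $ a $ b + of_real (?u $ a) * P x $ a $ b) = 0" for b
    by (rule has_derivative_unique_open[OF has_derivative_sum[OF has_derivative_mult[OF d\<Phi> dP]] has_derivative_const open_UNIV UNIV_I])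
      (unfold P_def, rule normal_PT[OF \<Phi>_sphere])
  \<comment> \<open>Multiplying \<open>n\<close> by P from the right produces B; the other term is
    unchanged because P is idempotent.\<close>
  have row: "(\<Sum>a\<in>UNIV. of_real (?p $ a) * B $ a $ b) = - (\<Sum>a\<in>UNIV. of_real (?u $ a) * P x $ a $ b)" for b
  proof -
    have "(\<Sum>a\<in>UNIV. of_real (?p $ a) * B $ a $ b)
       = (\<Sum>c\<in>UNIV. (\<Sum>a\<in>UNIV. of_real (?p $ a) * ?A $ a $ c) * P x $ c $ b)"
      unfolding B_def matrix_matrix_mult_def vec_lambda_beta sum_distrib_left sum_distrib_right
      by (subst sum.swap) (simp add: mult.assoc)
    also have "\<dots> = (\<Sum>c\<in>UNIV. - (\<Sum>a\<in>UNIV. of_real (?u $ a) * P x $ a $ c) * P x $ c $ b)"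
      using n by (simp add: sum.distrib add_eq_0_iff2)
    also have "\<dots> = - (\<Sum>a\<in>UNIV. of_real (?u $ a) * (P x ** P x) $ a $ b)"
      unfolding matrix_matrix_mult_def vec_lambda_beta sum_distrib_left sum_distrib_right sum_negf[symmetric]
      by (subst sum.swap) (simp add: sum_distrib_right sum_negf sum_distrib_left mult.assoc)
    finally show ?thesis unfolding P_idem .
  qed
  have tan: "?p \<bullet> ?u = 0" by (rule D\<Phi>_tangent)
  \<comment> \<open>As P is Hermitian, the row u^T P is the conjugate of the column P u.\<close>
  have uP: "(\<Sum>a\<in>UNIV. of_real (?u $ a) * P x $ a $ b) = cnj (hol ?p ?u $ b) / 2" for b
  proof -
    have e: "of_real (?u $ a) * P x $ a $ b = cnj (P x $ b $ a * cvec ?u $ a)" for a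
      using PT_hermitian[OF \<Phi>_sphere, of x a b] by (simp add: P_def cvec_def)
    have "(\<Sum>a\<in>UNIV. of_real (?u $ a) * P x $ a $ b) = cnj ((PT ?p *v cvec ?u) $ b)"
      unfolding e by (simp add: matrix_vector_mult_def P_def)
    then show ?thesis using PT_cvec[OF \<Phi>_sphere, of x ?u] tproj_eq[OF \<Phi>_sphere tan] by simp
  qed
  \<comment> \<open>Cauchy-Schwarz against the unit vector \<Phi> x in each column.\<close>
  have col: "(cmod (hol ?p ?u $ b))\<^sup>2 / 4 \<le> (\<Sum>a\<in>UNIV. (cmod (B $ a $ b))\<^sup>2)" for b
  proof -
    have "cmod (hol ?p ?u $ b) / 2 = cmod (\<Sum>a\<in>UNIV. of_real (?p $ a) * B $ a $ b)"
      unfolding row uP by (simp add: norm_divide)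
    also have "\<dots> \<le> (\<Sum>a\<in>UNIV. \<bar>?p $ a\<bar> * cmod (B $ a $ b))"
      by (rule order_trans[OF norm_sum]) (simp add: norm_mult)
    finally have "(cmod (hol ?p ?u $ b) / 2)\<^sup>2 \<le> (\<Sum>a\<in>UNIV. \<bar>?p $ a\<bar> * cmod (B $ a $ b))\<^sup>2"
      by (intro power_mono) auto
    also have "\<dots> \<le> (\<Sum>a\<in>UNIV. \<bar>?p $ a\<bar>\<^sup>2) * (\<Sum>a\<in>UNIV. (cmod (B $ a $ b))\<^sup>2)"
      by (rule Cauchy_Schwarz_ineq_sum)
    also have "(\<Sum>a\<in>UNIV. \<bar>?p $ a\<bar>\<^sup>2) = ?p \<bullet> ?p" by (simp add: inner_vec_def power2_eq_square)
    also have "\<dots> = 1" using \<Phi>_sphere[of x] by (simp add: norm_eq_1)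
    finally show ?thesis by (simp add: power_divide)
  qed
  have "(conf x * norm v)\<^sup>2 = (\<Sum>b\<in>UNIV. (cmod (hol ?p ?u $ b))\<^sup>2) / 2"
    using norm_hol[OF \<Phi>_sphere tan] by (simp add: norm_D\<Phi>)
  also have "\<dots> = 2 * (\<Sum>b\<in>UNIV. (cmod (hol ?p ?u $ b))\<^sup>2 / 4)"
    by (simp add: sum_divide_distrib[symmetric])
  also have "\<dots> \<le> 2 * (\<Sum>b\<in>UNIV. \<Sum>a\<in>UNIV. (cmod (B $ a $ b))\<^sup>2)"
    by (intro mult_left_mono sum_mono col) auto
  finally show ?thesis .
qed

text \<open>The form is tested on v and on the w whose image is J (d\<Phi> v), of the same length.
  Antiholomorphy gives dP(w) P = - \<i> dP(v) P, so the value is 2 N, with N the squared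
  Hilbert-Schmidt norm of dP(v) P; it is positive as for a Kaehler form. Cauchy-Schwarz then bounds
  |\<Omega> v| from below.\<close>

lemma curvature_lower_bound:
  assumes int: "integrable_acs TYPE('k::finite) J" and dim: "CARD('m) = 2 * CARD('k) + 1"
  shows "(conf x)\<^sup>2 * norm v \<le> norm (curvature_form P x *v v)"
proof -
  let ?p = "\<Phi> x" and ?u = "D\<Phi> x v" and ?D = "frechet_derivative P (at x)"
  have tan: "?p \<bullet> ?u = 0" by (rule D\<Phi>_tangent)
  note Jp = J_props[OF \<Phi>_sphere tan tan]
  obtain w where w: "D\<Phi> x w = J ?p ?u" using D\<Phi>_onto[OF Jp(1)] by blast
  have "(norm (J ?p ?u))\<^sup>2 = (norm ?u)\<^sup>2" using Jp(5) by (simp add: power2_norm_eq_inner)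
  then have "norm (D\<Phi> x w) = norm (D\<Phi> x v)" unfolding w by simp
  then have nw: "norm w = norm v" using conf_pos[of x] by (simp add: norm_D\<Phi>)
  obtain V Q where V: "open V" "?p \<in> V" "\<And>k. C_on k V Q" "\<And>y. y \<in> V \<Longrightarrow> y \<in> unit_sphere \<Longrightarrow> Q y = PT y"
    using PT_smooth_extension[OF \<Phi>_sphere] by blast
  define B where "B = ?D v ** P x"
  have DQ: "?D y = frechet_derivative Q (at ?p) (D\<Phi> x y)" for y
    by (rule P_derivative[OF V(1,4,3,2)])
  have Bw: "(?D w ** P x) $ a $ b = - \<i> * B $ a $ b" for a b
  proof -
    have "(frechet_derivative Q (at ?p) (J ?p ?u) ** P x) $ a $ b = - \<i> * (frechet_derivative Q (at ?p) ?u ** P x) $ a $ b"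
      unfolding P_def[of x] by (rule PT_antiholomorphic[OF \<Phi>_sphere int dim V(1,2,3,4) tan])
    then show ?thesis by (simp only: B_def DQ w)
  qed
  have herm: "P x $ a $ b = cnj (P x $ b $ a)" for a b
    unfolding P_def by (rule PT_hermitian[OF \<Phi>_sphere])
  have PB: "(P x ** ?D y) $ a $ b = cnj ((?D y ** P x) $ b $ a)" for y a b
    by (rule matrix_mult_hermitian[OF herm P_derivative_hermitian])
  \<comment> \<open>Splitting P = P P and moving one copy around the trace exhibits the Hermitian
    inner product of dP(y) P and dP(y') P.\<close>
  have tr: "trace (P x ** ?D y ** ?D y') = (\<Sum>b\<in>UNIV. \<Sum>a\<in>UNIV. cnj ((?D y ** P x) $ a $ b) * (?D y' ** P x) $ a $ b)" for y y'
  proof -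
    have "trace (P x ** ?D y ** ?D y') = trace (P x ** (P x ** ?D y ** ?D y'))"
      by (simp add: matrix_mul_assoc P_idem)
    also have "\<dots> = trace ((P x ** ?D y) ** (?D y' ** P x))"
      by (subst trace_mul_sym) (simp add: matrix_mul_assoc)
    finally show ?thesis
      unfolding trace_def matrix_matrix_mult_def[of "P x ** ?D y"] by (simp add: PB)
  qed
  define N where "N = (\<Sum>b\<in>UNIV. \<Sum>a\<in>UNIV. (cmod (B $ a $ b))\<^sup>2)"
  have nB: "cnj z * z = of_real ((cmod z)\<^sup>2)" for z :: complex
    by (simp only: complex_norm_square mult.commute)
  have t1: "trace (P x ** ?D w ** ?D v) = \<i> * of_real N"
    unfolding tr Bw B_def[symmetric] N_def
    by (simp add: nB sum_distrib_left mult.assoc)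
  have t2: "trace (P x ** ?D v ** ?D w) = - \<i> * of_real N"
    unfolding tr Bw B_def[symmetric] N_def
    by (simp add: nB sum_distrib_left sum_negf mult.left_commute[of _ \<i>])
  have "(P has_derivative ?D) (at x)" by (rule C_on_1D(1)[OF C_on_P UNIV_I])
  then have "w \<bullet> (curvature_form P x *v v) = 2 * N"
    by (simp add: curvature_form_eval t1 t2)
  then have "(conf x * norm v)\<^sup>2 \<le> w \<bullet> (curvature_form P x *v v)"
    using second_fundamental_form_lower_bound[of x v] by (simp add: N_def B_def)
  also have "\<dots> \<le> norm v * norm (curvature_form P x *v v)"
    using norm_cauchy_schwarz[of w] nw by metis
  finally have "norm v * ((conf x)\<^sup>2 * norm v) \<le> norm v * norm (curvature_form P x *v v)"
    by (simp add: power2_eq_square mult_ac)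
  then show ?thesis by (cases "v = 0") auto
qed

end

theorem theorem3p3:
  fixes n :: nat
  assumes "n > 1"
    and "CARD('n::finite) = n"
    and "CARD('m::finite) = 2 * n + 1"
  shows "\<not> (\<exists>J :: real ^ 'm \<Rightarrow> real ^ 'm \<Rightarrow> real ^ 'm.
              almost_complex_structure J \<and> orthogonal_acs J \<and> integrable_acs TYPE('n) J)"
proof
  assume "\<exists>J :: real ^ 'm \<Rightarrow> real ^ 'm \<Rightarrow> real ^ 'm.
              almost_complex_structure J \<and> orthogonal_acs J \<and> integrable_acs TYPE('n) J"
  then obtain J :: "real ^ 'm \<Rightarrow> real ^ 'm \<Rightarrow> real ^ 'm" where
    J: "almost_complex_structure J" "orthogonal_acs J" "integrable_acs TYPE('n) J" by blast
  \<comment> \<open>The sum type 'n + 'n indexes the 2n real coordinates of the stereographic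
    chart.\<close>
  have c: "CARD('n + 'n) = 2 * n" using assms(2) by (simp add: card_UNIV_sum)
  then have "CARD('m) = CARD('n + 'n) + 1" using assms(3) by simp
  from ex_stereographic[OF this] obtain E :: "real^('n + 'n) \<Rightarrow> real^'m" and q where st: "stereographic E q" by blast
  interpret stereographic_structure J E q
    using J st by (simp add: stereographic_structure_def orthogonal_structure_def)
  obtain M where M: "\<And>x i j. \<bar>curvature_form P x $ i $ j\<bar> \<le> M * (conf x)\<^sup>2" using curvature_bound by blast
  have dim: "CARD('m) = 2 * CARD('n) + 1" using assms by simp
  have n3: "CARD('n + 'n) \<ge> 3" using c assms(1) by simp
  show False
    by (rule no_conformally_bounded_symplectic_form[OF C_on_curvature_form[OF C_on_P] curvature_form_skew
          curvature_form_closed[OF C_on_P P_idem] M curvature_lower_bound[OF J(3) dim] n3])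
qed

end
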